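(* The theory $V^0$ proves that the following two statements (each universally quantified over $n$ and the sequences/points involved) are equivalent: (a) If $B$ is a sequence of edges forming a closed curve, $p_1$ and $p_2$ are two points on different sides of $B$, and $R$ is a sequence of edges that connects $p_1$ and $p_2$, then $B$ and $R$ intersect. (b) If $B$ is a sequence of edges that connects $(0,n)$ and $(n,0)$, and $R$ is a sequence of edges that connects $(0,0)$ and $(n,n)$, then $B$ and $R$ intersect.
   Context: Grid: fix $n$; grid points are $(x,y)$ with $0\le x,y\le n$; an edge joins two points differing by exactly 1 in exactly one coordinate. A sequence of edges forms a closed curve if it is $\langle q_0,q_1\rangle,\ldots,\langle q_{t-2},q_{t-1}\rangle,\langle q_{t-1},q_0\rangle$ with $t\ge4$ and the $q_i$ distinct. A sequence of edges connects $p$ and $q$ if it is $\langle r_0,r_1\rangle,\ldots,\langle r_{s-1},r_s\rangle$ with $r_0=p$, $r_s=q$ and the $r_i$ distinct. For a set/sequence $E$ of edges, the $E$-degree of a point is the number of edges of $E$ incident to it; $E_1,E_2$ intersect if some point has positive degree in both; $p_1,p_2$ are on different sides of $E$ if $x(p_1)=x(p_2)$, $|y(p_1)-y(p_2)|=2$, both have $E$-degree $0$, and the point $(x(p_1),\frac12(y(p_1)+y(p_2)))$ has $E$-degree $2$. $V^0$ is the two-sorted first-order theory (numbers and finite subsets of $\mathbb N$) over $0,1,+,\cdot,\le,=,|X|,\in$ axiomatized by 2-BASIC plus $\Sigma^B_0$-comprehension. *)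

theory Defs
  imports Main
begin

section \<open>Two-sorted first-order logic over \<open>0, 1, +, \<cdot>, \<le>, =, |X|, \<in>\<close>\<close>

text \<open>
  Variables are de Bruijn indices, with separate index spaces for the number sort and the
  set sort: a number quantifier shifts only the number indices, a set quantifier only the set
  indices.  The only terms of set sort are variables, so set terms are plain indices.
  The remaining connectives and the existential quantifiers are classical abbreviations.
\<close>

datatype nterm =
    NVar nat
  | Zero (\<open>\<^bold>0\<close>)
  | One (\<open>\<^bold>1\<close>)
  | Plus nterm nterm (infixl \<open>\<^bold>+\<close> 75)
  | Times nterm nterm (infixl \<open>\<^bold>*\<close> 80)
  | Len nat

datatype fm =
    Falsum (\<open>\<^bold>\<bottom>\<close>)
  | NEq nterm nterm (infix \<open>\<^bold>=\<close> 70)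
  | SEq nat nat (infix \<open>\<^bold>=\<^sub>s\<close> 70)
  | Le nterm nterm (infix \<open>\<^bold>\<le>\<close> 70)
  | Mem nterm nat (infix \<open>\<^bold>\<in>\<close> 70)
  | Imp fm fm (infixr \<open>\<^bold>\<longrightarrow>\<close> 60)
  | AllN fm
  | AllS fm

definition Neg :: "fm \<Rightarrow> fm" (\<open>\<^bold>\<not> _\<close> [68] 68) where
  "\<^bold>\<not> \<phi> = (\<phi> \<^bold>\<longrightarrow> \<^bold>\<bottom>)"

definition Conj :: "fm \<Rightarrow> fm \<Rightarrow> fm" (infixr \<open>\<^bold>\<and>\<close> 66) where
  "\<phi> \<^bold>\<and> \<psi> = \<^bold>\<not> (\<phi> \<^bold>\<longrightarrow> \<^bold>\<not> \<psi>)"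

definition Disj :: "fm \<Rightarrow> fm \<Rightarrow> fm" (infixr \<open>\<^bold>\<or>\<close> 64) where
  "\<phi> \<^bold>\<or> \<psi> = (\<^bold>\<not> \<phi> \<^bold>\<longrightarrow> \<psi>)"

definition Iff :: "fm \<Rightarrow> fm \<Rightarrow> fm" (infix \<open>\<^bold>\<longleftrightarrow>\<close> 58) where
  "(\<phi> \<^bold>\<longleftrightarrow> \<psi>) = ((\<phi> \<^bold>\<longrightarrow> \<psi>) \<^bold>\<and> (\<psi> \<^bold>\<longrightarrow> \<phi>))"

definition ExN :: "fm \<Rightarrow> fm" where
  "ExN \<phi> = \<^bold>\<not> AllN (\<^bold>\<not> \<phi>)"

definition ExS :: "fm \<Rightarrow> fm" where
  "ExS \<phi> = \<^bold>\<not> AllS (\<^bold>\<not> \<phi>)"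

definition Lt :: "nterm \<Rightarrow> nterm \<Rightarrow> fm" (infix \<open>\<^bold><\<close> 70) where
  "s \<^bold>< t = (s \<^bold>\<le> t \<^bold>\<and> \<^bold>\<not> s \<^bold>= t)"

text \<open>Simultaneous, capture-avoiding substitution of \<open>\<sigma>\<close> for the number variables and of
  \<open>\<rho>\<close> for the set variables.\<close>

primrec tsub :: "(nat \<Rightarrow> nterm) \<Rightarrow> (nat \<Rightarrow> nat) \<Rightarrow> nterm \<Rightarrow> nterm" where
  "tsub \<sigma> \<rho> (NVar i) = \<sigma> i"
| "tsub \<sigma> \<rho> \<^bold>0 = \<^bold>0"
| "tsub \<sigma> \<rho> \<^bold>1 = \<^bold>1"
| "tsub \<sigma> \<rho> (s \<^bold>+ t) = tsub \<sigma> \<rho> s \<^bold>+ tsub \<sigma> \<rho> t"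
| "tsub \<sigma> \<rho> (s \<^bold>* t) = tsub \<sigma> \<rho> s \<^bold>* tsub \<sigma> \<rho> t"
| "tsub \<sigma> \<rho> (Len X) = Len (\<rho> X)"

text \<open>\<open>\<up>t\<close> is \<open>t\<close> seen from below one more number quantifier, \<open>\<Up>t\<close> is \<open>t\<close> seen from below
  one more set quantifier.\<close>

definition liftN :: "nterm \<Rightarrow> nterm" (\<open>\<up> _\<close> [1000] 1000) where
  "\<up> t = tsub (\<lambda>i. NVar (Suc i)) id t"

definition liftS :: "nterm \<Rightarrow> nterm" (\<open>\<Up> _\<close> [1000] 1000) where
  "\<Up> t = tsub NVar Suc t"

primrec sub :: "(nat \<Rightarrow> nterm) \<Rightarrow> (nat \<Rightarrow> nat) \<Rightarrow> fm \<Rightarrow> fm" where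
  "sub \<sigma> \<rho> \<^bold>\<bottom> = \<^bold>\<bottom>"
| "sub \<sigma> \<rho> (s \<^bold>= t) = (tsub \<sigma> \<rho> s \<^bold>= tsub \<sigma> \<rho> t)"
| "sub \<sigma> \<rho> (X \<^bold>=\<^sub>s Y) = (\<rho> X \<^bold>=\<^sub>s \<rho> Y)"
| "sub \<sigma> \<rho> (s \<^bold>\<le> t) = (tsub \<sigma> \<rho> s \<^bold>\<le> tsub \<sigma> \<rho> t)"
| "sub \<sigma> \<rho> (t \<^bold>\<in> X) = (tsub \<sigma> \<rho> t \<^bold>\<in> \<rho> X)"
| "sub \<sigma> \<rho> (\<phi> \<^bold>\<longrightarrow> \<psi>) = (sub \<sigma> \<rho> \<phi> \<^bold>\<longrightarrow> sub \<sigma> \<rho> \<psi>)"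
| "sub \<sigma> \<rho> (AllN \<phi>) = AllN (sub (case_nat (NVar 0) (\<lambda>i. \<up>(\<sigma> i))) \<rho> \<phi>)"
| "sub \<sigma> \<rho> (AllS \<phi>) = AllS (sub (\<lambda>i. \<Up>(\<sigma> i)) (case_nat 0 (\<lambda>X. Suc (\<rho> X))) \<phi>)"

definition liftN_fm :: "fm \<Rightarrow> fm" where
  "liftN_fm = sub (\<lambda>i. NVar (Suc i)) id"

definition liftS_fm :: "fm \<Rightarrow> fm" where
  "liftS_fm = sub NVar Suc"

definition instN :: "nterm \<Rightarrow> fm \<Rightarrow> fm" where
  "instN t = sub (case_nat t NVar) id"

definition instS :: "nat \<Rightarrow> fm \<Rightarrow> fm" where
  "instS X = sub NVar (case_nat X id)"

text \<open>
  Natural deduction with equality, relative to a set \<open>T\<close> of non-logical axioms.  Free variables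
  of axioms are read as universally quantified: only the assumptions in \<open>\<Gamma>\<close>, not the axioms in
  \<open>T\<close>, are subject to the eigenvariable condition (expressed by lifting \<open>\<Gamma>\<close>) of the rules
  \<open>AllNI\<close> and \<open>AllSI\<close>.
\<close>

inductive derivable :: "fm set \<Rightarrow> fm list \<Rightarrow> fm \<Rightarrow> bool" (\<open>_; _ \<turnstile> _\<close> [51, 51, 51] 50)
  for T :: "fm set" where
  Axiom: "\<phi> \<in> T \<Longrightarrow> T; \<Gamma> \<turnstile> \<phi>"
| Assum: "\<phi> \<in> set \<Gamma> \<Longrightarrow> T; \<Gamma> \<turnstile> \<phi>"
| ImpI: "T; \<phi> # \<Gamma> \<turnstile> \<psi> \<Longrightarrow> T; \<Gamma> \<turnstile> (\<phi> \<^bold>\<longrightarrow> \<psi>)"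
| ImpE: "T; \<Gamma> \<turnstile> (\<phi> \<^bold>\<longrightarrow> \<psi>) \<Longrightarrow> T; \<Gamma> \<turnstile> \<phi> \<Longrightarrow> T; \<Gamma> \<turnstile> \<psi>"
| Raa: "T; (\<^bold>\<not> \<phi>) # \<Gamma> \<turnstile> \<^bold>\<bottom> \<Longrightarrow> T; \<Gamma> \<turnstile> \<phi>"
| AllNI: "T; map liftN_fm \<Gamma> \<turnstile> \<phi> \<Longrightarrow> T; \<Gamma> \<turnstile> AllN \<phi>"
| AllNE: "T; \<Gamma> \<turnstile> AllN \<phi> \<Longrightarrow> T; \<Gamma> \<turnstile> instN t \<phi>"
| AllSI: "T; map liftS_fm \<Gamma> \<turnstile> \<phi> \<Longrightarrow> T; \<Gamma> \<turnstile> AllS \<phi>"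
| AllSE: "T; \<Gamma> \<turnstile> AllS \<phi> \<Longrightarrow> T; \<Gamma> \<turnstile> instS X \<phi>"
| NRefl: "T; \<Gamma> \<turnstile> t \<^bold>= t"
| NSubst: "T; \<Gamma> \<turnstile> s \<^bold>= t \<Longrightarrow> T; \<Gamma> \<turnstile> instN s \<phi> \<Longrightarrow> T; \<Gamma> \<turnstile> instN t \<phi>"
| SRefl: "T; \<Gamma> \<turnstile> X \<^bold>=\<^sub>s X"
| SSubst: "T; \<Gamma> \<turnstile> X \<^bold>=\<^sub>s Y \<Longrightarrow> T; \<Gamma> \<turnstile> instS X \<phi> \<Longrightarrow> T; \<Gamma> \<turnstile> instS Y \<phi>"

definition proves :: "fm set \<Rightarrow> fm \<Rightarrow> bool" (\<open>_ \<turnstile> _\<close> [51, 51] 50) where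
  "T \<turnstile> \<phi> \<longleftrightarrow> T; [] \<turnstile> \<phi>"


section \<open>The theory \<open>V\<^sup>0\<close>\<close>

text \<open>Bounded number quantifiers.  The bound is a term outside the scope of the quantifier.\<close>

definition AllLe :: "nterm \<Rightarrow> fm \<Rightarrow> fm" where
  "AllLe t \<phi> = AllN (NVar 0 \<^bold>\<le> \<up>t \<^bold>\<longrightarrow> \<phi>)"

definition ExLe :: "nterm \<Rightarrow> fm \<Rightarrow> fm" where
  "ExLe t \<phi> = ExN (NVar 0 \<^bold>\<le> \<up>t \<^bold>\<and> \<phi>)"

definition AllLt :: "nterm \<Rightarrow> fm \<Rightarrow> fm" where
  "AllLt t \<phi> = AllN (NVar 0 \<^bold>< \<up>t \<^bold>\<longrightarrow> \<phi>)"

definition ExLt :: "nterm \<Rightarrow> fm \<Rightarrow> fm" where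
  "ExLt t \<phi> = ExN (NVar 0 \<^bold>< \<up>t \<^bold>\<and> \<phi>)"

inductive_set SigmaB0 :: "fm set" where
  "\<^bold>\<bottom> \<in> SigmaB0"
| "(s \<^bold>= t) \<in> SigmaB0"
| "(X \<^bold>=\<^sub>s Y) \<in> SigmaB0"
| "(s \<^bold>\<le> t) \<in> SigmaB0"
| "(t \<^bold>\<in> X) \<in> SigmaB0"
| "\<phi> \<in> SigmaB0 \<Longrightarrow> \<psi> \<in> SigmaB0 \<Longrightarrow> (\<phi> \<^bold>\<longrightarrow> \<psi>) \<in> SigmaB0"
| "\<phi> \<in> SigmaB0 \<Longrightarrow> AllLe t \<phi> \<in> SigmaB0"
| "\<phi> \<in> SigmaB0 \<Longrightarrow> ExLe t \<phi> \<in> SigmaB0"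

text \<open>The axioms B1--B12, L1, L2 and SE (extensionality) of Cook and Nguyen, in this order.\<close>

definition two_BASIC :: "fm set" where
  "two_BASIC =
    (let x = NVar 0; y = NVar 1; X = 0; Y = 1 in
     {\<^bold>\<not> x \<^bold>+ \<^bold>1 \<^bold>= \<^bold>0,
      x \<^bold>+ \<^bold>1 \<^bold>= y \<^bold>+ \<^bold>1 \<^bold>\<longrightarrow> x \<^bold>= y,
      x \<^bold>+ \<^bold>0 \<^bold>= x,
      x \<^bold>+ (y \<^bold>+ \<^bold>1) \<^bold>= (x \<^bold>+ y) \<^bold>+ \<^bold>1,
      x \<^bold>* \<^bold>0 \<^bold>= \<^bold>0,
      x \<^bold>* (y \<^bold>+ \<^bold>1) \<^bold>= (x \<^bold>* y) \<^bold>+ x,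
      x \<^bold>\<le> y \<^bold>\<and> y \<^bold>\<le> x \<^bold>\<longrightarrow> x \<^bold>= y,
      x \<^bold>\<le> x \<^bold>+ y,
      \<^bold>0 \<^bold>\<le> x,
      x \<^bold>\<le> y \<^bold>\<or> y \<^bold>\<le> x,
      x \<^bold>\<le> y \<^bold>\<longleftrightarrow> x \<^bold>< y \<^bold>+ \<^bold>1,
      \<^bold>\<not> x \<^bold>= \<^bold>0 \<^bold>\<longrightarrow> ExLe x (NVar 0 \<^bold>+ \<^bold>1 \<^bold>= \<up>x),
      y \<^bold>\<in> X \<^bold>\<longrightarrow> y \<^bold>< Len X,
      y \<^bold>+ \<^bold>1 \<^bold>= Len X \<^bold>\<longrightarrow> y \<^bold>\<in> X,
      Len X \<^bold>= Len Y \<^bold>\<and> AllLt (Len X) (NVar 0 \<^bold>\<in> X \<^bold>\<longleftrightarrow> NVar 0 \<^bold>\<in> Y) \<^bold>\<longrightarrow> X \<^bold>=\<^sub>s Y})"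

text \<open>
  \<open>\<exists>X \<le> y. \<forall>z < y. (X(z) \<longleftrightarrow> \<phi>(z))\<close>, where \<open>\<exists>X \<le> y\<close> means \<open>\<exists>X. |X| \<le> y \<and> \<dots>\<close>.  In \<open>\<phi>\<close>, number
  index 0 is \<open>z\<close> and all other indices are parameters (possibly including \<open>y\<close>); lifting \<open>\<phi>\<close>
  keeps \<open>X\<close> from occurring free in it.
\<close>

definition comprehension :: "nat \<Rightarrow> fm \<Rightarrow> fm" where
  "comprehension y \<phi> =
     ExS (Len 0 \<^bold>\<le> NVar y \<^bold>\<and> AllLt (NVar y) (NVar 0 \<^bold>\<in> 0 \<^bold>\<longleftrightarrow> liftS_fm \<phi>))"

definition V0 :: "fm set" where
  "V0 = two_BASIC \<union> {comprehension y \<phi> | y \<phi>. \<phi> \<in> SigmaB0}"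


section \<open>Points, edges and sequences in the language of \<open>V\<^sup>0\<close>\<close>

text \<open>The pairing function \<open>\<langle>x, y\<rangle> = (x + y) \<cdot> (x + y + 1) + 2 \<cdot> y\<close> used throughout bounded
  arithmetic.\<close>

definition pairing :: "nterm \<Rightarrow> nterm \<Rightarrow> nterm" (\<open>\<^bold>\<langle>_, _\<^bold>\<rangle>\<close>) where
  "\<^bold>\<langle>s, t\<^bold>\<rangle> = (s \<^bold>+ t) \<^bold>* (s \<^bold>+ t \<^bold>+ \<^bold>1) \<^bold>+ (\<^bold>1 \<^bold>+ \<^bold>1) \<^bold>* t"

text \<open>
  \<open>elem Z i v\<close> says \<open>(Z)\<^sup>i = v\<close>, for the sequence of numbers coded by the set \<open>Z\<close>: \<open>(Z)\<^sup>i\<close> is the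
  least \<open>v\<close> such that \<open>\<langle>i, v\<rangle> \<in> Z\<close>, and \<open>|Z|\<close> if there is none.  A finite sequence is given by
  such a \<open>Z\<close> together with its length.
\<close>

definition elem :: "nat \<Rightarrow> nterm \<Rightarrow> nterm \<Rightarrow> fm" where
  "elem Z i v =
     ((v \<^bold>< Len Z \<^bold>\<and> \<^bold>\<langle>i, v\<^bold>\<rangle> \<^bold>\<in> Z \<^bold>\<and> AllLt v (\<^bold>\<not> \<^bold>\<langle>\<up>i, NVar 0\<^bold>\<rangle> \<^bold>\<in> Z))
      \<^bold>\<or> (AllLt (Len Z) (\<^bold>\<not> \<^bold>\<langle>\<up>i, NVar 0\<^bold>\<rangle> \<^bold>\<in> Z) \<^bold>\<and> v \<^bold>= Len Z))"

text \<open>A point is given by its two coordinates.  Quantification over grid points binds two number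
  variables: in the scope, \<open>(NVar 1, NVar 0)\<close> is the bound point, and outer terms are lifted
  twice.\<close>

type_synonym point = "nterm \<times> nterm"

definition liftP :: "point \<Rightarrow> point" (\<open>\<up>\<^sub>p _\<close> [1000] 1000) where
  "\<up>\<^sub>p p = map_prod liftN liftN p"

definition liftPS :: "point \<Rightarrow> point" (\<open>\<Up>\<^sub>p _\<close> [1000] 1000) where
  "\<Up>\<^sub>p p = map_prod liftS liftS p"

definition code :: "point \<Rightarrow> nterm" where
  "code p = \<^bold>\<langle>fst p, snd p\<^bold>\<rangle>"

definition eqP :: "point \<Rightarrow> point \<Rightarrow> fm" where
  "eqP p q = (fst p \<^bold>= fst q \<^bold>\<and> snd p \<^bold>= snd q)"

definition grid :: "nterm \<Rightarrow> point \<Rightarrow> fm" where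
  "grid n p = (fst p \<^bold>\<le> n \<^bold>\<and> snd p \<^bold>\<le> n)"

definition AllP :: "nterm \<Rightarrow> fm \<Rightarrow> fm" where
  "AllP n \<phi> = AllN (AllN (grid \<up>\<up>n (NVar 1, NVar 0) \<^bold>\<longrightarrow> \<phi>))"

definition ExP :: "nterm \<Rightarrow> fm \<Rightarrow> fm" where
  "ExP n \<phi> = ExN (ExN (grid \<up>\<up>n (NVar 1, NVar 0) \<^bold>\<and> \<phi>))"

definition adjacent :: "point \<Rightarrow> point \<Rightarrow> fm" where
  "adjacent p q =
     ((fst p \<^bold>= fst q \<^bold>\<and> (snd p \<^bold>= snd q \<^bold>+ \<^bold>1 \<^bold>\<or> snd q \<^bold>= snd p \<^bold>+ \<^bold>1))
      \<^bold>\<or> (snd p \<^bold>= snd q \<^bold>\<and> (fst p \<^bold>= fst q \<^bold>+ \<^bold>1 \<^bold>\<or> fst q \<^bold>= fst p \<^bold>+ \<^bold>1)))"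

text \<open>Edges are undirected: the edge joining \<open>p\<close> and \<open>q\<close> may be coded as \<open>\<langle>p, q\<rangle>\<close> or as
  \<open>\<langle>q, p\<rangle>\<close>.\<close>

definition edge_at :: "nat \<Rightarrow> nterm \<Rightarrow> point \<Rightarrow> point \<Rightarrow> fm" where
  "edge_at E i p q = (elem E i \<^bold>\<langle>code p, code q\<^bold>\<rangle> \<^bold>\<or> elem E i \<^bold>\<langle>code q, code p\<^bold>\<rangle>)"

text \<open>In the following, \<open>E\<close> and \<open>t\<close> represent the sequence of edges \<open>(E)\<^sup>0, \<dots>, (E)\<^sup>t\<^sup>-\<^sup>1\<close>.\<close>

definition has_edge :: "nat \<Rightarrow> nterm \<Rightarrow> point \<Rightarrow> point \<Rightarrow> fm" where
  "has_edge E t p q = ExLt t (edge_at E (NVar 0) \<up>\<^sub>p p \<up>\<^sub>p q)"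

text \<open>The \<open>i\<close>-th edge of \<open>E\<close> is a grid edge joining the points \<open>(Q)\<^sup>i\<close> and \<open>(Q)\<^sup>j\<close>.\<close>

definition joins :: "nterm \<Rightarrow> nat \<Rightarrow> nat \<Rightarrow> nterm \<Rightarrow> nterm \<Rightarrow> fm" where
  "joins n E Q i j =
     ExP n (ExP \<up>\<up>n
       (let p = (NVar 3, NVar 2); q = (NVar 1, NVar 0) in
        elem Q \<up>\<up>\<up>\<up>i (code p) \<^bold>\<and> elem Q \<up>\<up>\<up>\<up>j (code q) \<^bold>\<and> adjacent p q
        \<^bold>\<and> edge_at E \<up>\<up>\<up>\<up>i p q))"

definition distinct_upto :: "nat \<Rightarrow> nterm \<Rightarrow> fm" where
  "distinct_upto Q m =
     AllLt m (AllLt \<up>m (AllN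
       (elem Q (NVar 2) (NVar 0) \<^bold>\<and> elem Q (NVar 1) (NVar 0) \<^bold>\<longrightarrow> NVar 2 \<^bold>= NVar 1)))"

text \<open>\<open>4 \<le> t\<close>, and \<open>E\<close> is \<open>\<langle>q\<^sub>0, q\<^sub>1\<rangle>, \<dots>, \<langle>q\<^sub>t\<^sub>-\<^sub>2, q\<^sub>t\<^sub>-\<^sub>1\<rangle>, \<langle>q\<^sub>t\<^sub>-\<^sub>1, q\<^sub>0\<rangle>\<close> with distinct \<open>q\<^sub>i = (Q)\<^sup>i\<close>.\<close>

definition closed_curve :: "nterm \<Rightarrow> nat \<Rightarrow> nterm \<Rightarrow> fm" where
  "closed_curve n E t =
     (\<^bold>1 \<^bold>+ \<^bold>1 \<^bold>+ \<^bold>1 \<^bold>+ \<^bold>1 \<^bold>\<le> t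
      \<^bold>\<and> ExS (let Q = 0; E = Suc E in
          distinct_upto Q \<Up>t
          \<^bold>\<and> AllLt \<Up>t
              (let i = NVar 0; t = \<up>\<Up>t; n = \<up>\<Up>n in
               (i \<^bold>+ \<^bold>1 \<^bold>< t \<^bold>\<longrightarrow> joins n E Q i (i \<^bold>+ \<^bold>1))
               \<^bold>\<and> (i \<^bold>+ \<^bold>1 \<^bold>= t \<^bold>\<longrightarrow> joins n E Q i \<^bold>0))))"

text \<open>\<open>E\<close> is the nonempty sequence \<open>\<langle>r\<^sub>0, r\<^sub>1\<rangle>, \<dots>, \<langle>r\<^sub>s\<^sub>-\<^sub>1, r\<^sub>s\<rangle>\<close> with distinct \<open>r\<^sub>i = (Q)\<^sup>i\<close>,
  \<open>r\<^sub>0 = p\<close> and \<open>r\<^sub>s = q\<close>.  Nonemptiness matters for the one-point grid \<open>n = 0\<close>.\<close>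

definition connects :: "nterm \<Rightarrow> nat \<Rightarrow> nterm \<Rightarrow> point \<Rightarrow> point \<Rightarrow> fm" where
  "connects n E s p q =
     (\<^bold>1 \<^bold>\<le> s
      \<^bold>\<and> ExS (let Q = 0; E = Suc E in
          elem Q \<^bold>0 (code \<Up>\<^sub>p p)
          \<^bold>\<and> elem Q \<Up>s (code \<Up>\<^sub>p q)
          \<^bold>\<and> distinct_upto Q (\<Up>s \<^bold>+ \<^bold>1)
          \<^bold>\<and> AllLt \<Up>s (joins \<up>\<Up>n E Q (NVar 0) (NVar 0 \<^bold>+ \<^bold>1))))"

text \<open>The degree of a point counts undirected edges, hence the neighbours along edges of \<open>E\<close>.\<close>

definition degree_pos :: "nterm \<Rightarrow> nat \<Rightarrow> nterm \<Rightarrow> point \<Rightarrow> fm" where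
  "degree_pos n E t p = ExP n (has_edge E \<up>\<up>t \<up>\<^sub>p\<up>\<^sub>p p (NVar 1, NVar 0))"

definition degree_0 :: "nterm \<Rightarrow> nat \<Rightarrow> nterm \<Rightarrow> point \<Rightarrow> fm" where
  "degree_0 n E t p = \<^bold>\<not> degree_pos n E t p"

definition degree_2 :: "nterm \<Rightarrow> nat \<Rightarrow> nterm \<Rightarrow> point \<Rightarrow> fm" where
  "degree_2 n E t p =
     ExP n (ExP \<up>\<up>n
       (\<^bold>\<not> eqP (NVar 3, NVar 2) (NVar 1, NVar 0)
        \<^bold>\<and> AllP \<up>\<up>\<up>\<up>n
            (has_edge E \<up>\<up>\<up>\<up>\<up>\<up>t \<up>\<^sub>p\<up>\<^sub>p\<up>\<^sub>p\<up>\<^sub>p\<up>\<^sub>p\<up>\<^sub>p p (NVar 1, NVar 0)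
             \<^bold>\<longleftrightarrow> eqP (NVar 1, NVar 0) (NVar 5, NVar 4) \<^bold>\<or> eqP (NVar 1, NVar 0) (NVar 3, NVar 2))))"

definition intersect :: "nterm \<Rightarrow> nat \<Rightarrow> nterm \<Rightarrow> nat \<Rightarrow> nterm \<Rightarrow> fm" where
  "intersect n E t F s =
     ExP n (degree_pos \<up>\<up>n E \<up>\<up>t (NVar 1, NVar 0) \<^bold>\<and> degree_pos \<up>\<up>n F \<up>\<up>s (NVar 1, NVar 0))"

definition different_sides :: "nterm \<Rightarrow> nat \<Rightarrow> nterm \<Rightarrow> point \<Rightarrow> point \<Rightarrow> fm" where
  "different_sides n E t p q =
     (fst p \<^bold>= fst q
      \<^bold>\<and> (snd p \<^bold>= snd q \<^bold>+ (\<^bold>1 \<^bold>+ \<^bold>1) \<^bold>\<or> snd q \<^bold>= snd p \<^bold>+ (\<^bold>1 \<^bold>+ \<^bold>1))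
      \<^bold>\<and> degree_0 n E t p \<^bold>\<and> degree_0 n E t q
      \<^bold>\<and> ExLe n ((\<^bold>1 \<^bold>+ \<^bold>1) \<^bold>* NVar 0 \<^bold>= \<up>(snd p) \<^bold>+ \<up>(snd q)
               \<^bold>\<and> degree_2 \<up>n E \<up>t (\<up>(fst p), NVar 0)))"


section \<open>The two principles\<close>

definition jordan_curve_principle :: fm where
  "jordan_curve_principle =
     AllS (AllS (AllN (AllN (AllN (AllN (AllN (AllN (AllN
       (let B = 1; R = 0; n = NVar 6; t = NVar 5; s = NVar 4;
            p1 = (NVar 3, NVar 2); p2 = (NVar 1, NVar 0) in
        closed_curve n B t \<^bold>\<and> grid n p1 \<^bold>\<and> grid n p2 \<^bold>\<and> different_sides n B t p1 p2
        \<^bold>\<and> connects n R s p1 p2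
        \<^bold>\<longrightarrow> intersect n B t R s)))))))))"

definition grid_crossing_principle :: fm where
  "grid_crossing_principle =
     AllS (AllS (AllN (AllN (AllN
       (let B = 1; R = 0; n = NVar 2; t = NVar 1; s = NVar 0 in
        connects n B t (\<^bold>0, n) (n, \<^bold>0) \<^bold>\<and> connects n R s (\<^bold>0, \<^bold>0) (n, n)
        \<^bold>\<longrightarrow> intersect n B t R s)))))"

end

theory Submission
  imports Defs "HOL-Library.Countable" "HOL-Library.Nat_Bijection"
begin

text \<open>
  In fact \<open>V\<^sup>0\<close> proves both principles.  By the completeness theorem it suffices to establish them
  in every model of \<open>V\<^sup>0\<close>.  The key is an invariant of two disjoint grid paths \<open>P\<close> and \<open>Q\<close> that
  is provable by \<open>\<Sigma>\<^sup>B\<^sub>0\<close>-induction on the column \<open>m\<close>, without any counting: if an arc of \<open>P\<close> and an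
  arc of \<open>Q\<close> stay in the columns up to \<open>m\<close> and all their ends lie on column \<open>m\<close>, then these ends do
  not interleave.  Indeed, each arc decomposes into vertical unit steps on column \<open>m\<close> and excursions
  to smaller columns, and interleaving is a parity that is additive under this decomposition.

  For the grid crossing principle, prolonging the two paths to a new last column makes their ends
  interleave.  For the Jordan curve principle, \<open>R\<close> is closed up by a hop over the point of \<open>B\<close>
  between \<open>p\<^sub>1\<close> and \<open>p\<^sub>2\<close>, and the invariant says that the ends interleave iff both arcs contain this
  single crossing.  This is contradictory for arcs that wind once around one of the two closed curves.
\<close>

section \<open>Completeness of the calculus\<close>

text \<open>Interleaving only compares the heights of four ends. Excursions are replaced by their
  ends, which lie one column further left, and all quantifiers over arcs are bounded by the lengths
  of the two paths; this keeps the induction claim bounded. In the Jordan case a parity invariant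
  has to be told where the two closed curves cross. The hop between \<open>p1\<close> and
  \<open>p2\<close> fixes a single place, and pushing it to the left moves this crossing from a
  vertex into the inside of a horizontal edge. On the logical side, models are types of a type
  class, which makes ordered arithmetic available to simplification. A type cannot be defined under
  the assumption that a derivation is missing. The theory \<open>H\<close> is therefore chosen
  unconditionally, as a Henkin theory that contains the equivalence only if the equivalence is
  derivable; in the derivable case the standard model shows that there is one.\<close>

lemma tsub_tsub: "tsub \<sigma> \<rho> (tsub \<sigma>' \<rho>' t) = tsub (\<lambda>i. tsub \<sigma> \<rho> (\<sigma>' i)) (\<rho> \<circ> \<rho>') t"
  by (induction t) auto

lemma tsub_id [simp]: "tsub NVar (\<lambda>X. X) t = t" "tsub NVar id t = t"
  by (induction t) auto

abbreviation up_sub :: "(nat \<Rightarrow> nterm) \<Rightarrow> nat \<Rightarrow> nterm" where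
  "up_sub \<sigma> \<equiv> case_nat (NVar 0) (\<lambda>i. \<up>(\<sigma> i))"

abbreviation up_ren :: "(nat \<Rightarrow> nat) \<Rightarrow> nat \<Rightarrow> nat" where
  "up_ren \<rho> \<equiv> case_nat 0 (\<lambda>X. Suc (\<rho> X))"

lemma up_ren_comp: "up_ren \<rho> \<circ> up_ren \<rho>' = up_ren (\<rho> \<circ> \<rho>')"
  by (auto simp: fun_eq_iff split: nat.split)

lemma sub_sub: "sub \<sigma> \<rho> (sub \<sigma>' \<rho>' \<phi>) = sub (\<lambda>i. tsub \<sigma> \<rho> (\<sigma>' i)) (\<rho> \<circ> \<rho>') \<phi>"
proof (induction \<phi> arbitrary: \<sigma> \<rho> \<sigma>' \<rho>')
  case (AllN \<phi>)
  have "(\<lambda>i. tsub (up_sub \<sigma>) \<rho> (up_sub \<sigma>' i)) = up_sub (\<lambda>i. tsub \<sigma> \<rho> (\<sigma>' i))"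
    by (auto simp: fun_eq_iff liftN_def tsub_tsub split: nat.split)
  then show ?case using AllN by simp
next
  case (AllS \<phi>)
  have "(\<lambda>i. tsub (\<lambda>i. \<Up>(\<sigma> i)) (up_ren \<rho>) (\<Up>(\<sigma>' i))) = (\<lambda>i. \<Up>(tsub \<sigma> \<rho> (\<sigma>' i)))"
    by (auto simp: fun_eq_iff liftS_def tsub_tsub comp_def)
  then show ?case unfolding sub.simps AllS up_ren_comp by metis
qed (auto simp: tsub_tsub)

lemma sub_id [simp]: "sub NVar (\<lambda>X. X) \<phi> = \<phi>" "sub NVar id \<phi> = \<phi>"
proof -
  show 1: "sub NVar (\<lambda>X. X) \<phi> = \<phi>"
  proof (induction \<phi>)
    case (AllN \<phi>)
    have "up_sub NVar = NVar" by (auto simp: fun_eq_iff liftN_def split: nat.split)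
    then show ?case using AllN by simp
  next
    case (AllS \<phi>)
    have "(\<lambda>i. \<Up>(NVar i)) = NVar" "up_ren (\<lambda>X. X) = (\<lambda>X. X)"
      by (auto simp: fun_eq_iff liftS_def split: nat.split)
    then show ?case using AllS by simp
  qed auto
  then show "sub NVar id \<phi> = \<phi>" by (simp only: id_def)
qed

text \<open>\<open>bounded_by k \<phi>\<close>: all free variables of \<open>\<phi>\<close> have index below \<open>k\<close>.\<close>

definition bounded_by :: "nat \<Rightarrow> fm \<Rightarrow> bool" where
  "bounded_by k \<phi> \<longleftrightarrow> (\<forall>\<sigma> \<sigma>' \<rho> \<rho>'. (\<forall>i<k. \<sigma> i = \<sigma>' i \<and> \<rho> i = \<rho>' i) \<longrightarrow> sub \<sigma> \<rho> \<phi> = sub \<sigma>' \<rho>' \<phi>)"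

definition tbounded_by :: "nat \<Rightarrow> nterm \<Rightarrow> bool" where
  "tbounded_by k t \<longleftrightarrow> (\<forall>\<sigma> \<sigma>' \<rho> \<rho>'. (\<forall>i<k. \<sigma> i = \<sigma>' i \<and> \<rho> i = \<rho>' i) \<longrightarrow> tsub \<sigma> \<rho> t = tsub \<sigma>' \<rho>' t)"

lemma tbounded_by_mono: "tbounded_by k t \<Longrightarrow> k \<le> l \<Longrightarrow> tbounded_by l t"
  unfolding tbounded_by_def by (meson less_le_trans)

lemma tbounded_by_exists: "\<exists>k. tbounded_by k t"
proof (induction t)
  case (NVar i)
  show ?case by (rule exI[of _ "Suc i"]) (auto simp: tbounded_by_def)
next
  case (Len X)
  show ?case by (rule exI[of _ "Suc X"]) (auto simp: tbounded_by_def)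
next
  case (Plus s t)
  then obtain k l where "tbounded_by k s" "tbounded_by l t" by blast
  then have "tbounded_by (max k l) s" "tbounded_by (max k l) t" by (auto intro: tbounded_by_mono)
  then have "tbounded_by (max k l) (s \<^bold>+ t)" unfolding tbounded_by_def tsub.simps by blast
  then show ?case ..
next
  case (Times s t)
  then obtain k l where "tbounded_by k s" "tbounded_by l t" by blast
  then have "tbounded_by (max k l) s" "tbounded_by (max k l) t" by (auto intro: tbounded_by_mono)
  then have "tbounded_by (max k l) (s \<^bold>* t)" unfolding tbounded_by_def tsub.simps by blast
  then show ?case ..
qed (auto simp: tbounded_by_def)

lemma bounded_by_mono: "bounded_by k \<phi> \<Longrightarrow> k \<le> l \<Longrightarrow> bounded_by l \<phi>"
  unfolding bounded_by_def by (meson less_le_trans)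

lemma bounded_by_exists: "\<exists>k. bounded_by k \<phi>"
proof (induction \<phi>)
  case (NEq s t)
  obtain k l where "tbounded_by k s" "tbounded_by l t" using tbounded_by_exists by blast
  then have "tbounded_by (max k l) s" "tbounded_by (max k l) t" by (auto intro: tbounded_by_mono)
  then have "bounded_by (max k l) (s \<^bold>= t)" unfolding tbounded_by_def bounded_by_def sub.simps by blast
  then show ?case ..
next
  case (Le s t)
  obtain k l where "tbounded_by k s" "tbounded_by l t" using tbounded_by_exists by blast
  then have "tbounded_by (max k l) s" "tbounded_by (max k l) t" by (auto intro: tbounded_by_mono)
  then have "bounded_by (max k l) (s \<^bold>\<le> t)" unfolding tbounded_by_def bounded_by_def sub.simps by blast
  then show ?case ..
next
  case (SEq X Y)
  show ?case unfolding bounded_by_def by (rule exI[of _ "Suc (max X Y)"]) auto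
next
  case (Mem t X)
  obtain k where "tbounded_by k t" using tbounded_by_exists by blast
  then have "tbounded_by (max k (Suc X)) t" by (auto intro: tbounded_by_mono)
  then have "bounded_by (max k (Suc X)) (t \<^bold>\<in> X)"
    unfolding tbounded_by_def bounded_by_def sub.simps by (metis lessI less_max_iff_disj)
  then show ?case ..
next
  case (Imp \<phi> \<psi>)
  then obtain k l where "bounded_by k \<phi>" "bounded_by l \<psi>" by blast
  then have "bounded_by (max k l) \<phi>" "bounded_by (max k l) \<psi>" by (auto intro: bounded_by_mono)
  then have "bounded_by (max k l) (\<phi> \<^bold>\<longrightarrow> \<psi>)" unfolding bounded_by_def sub.simps by blast
  then show ?case ..
next
  case (AllN \<phi>)
  then obtain k where k: "bounded_by k \<phi>" by blast
  have "bounded_by k (AllN \<phi>)" unfolding bounded_by_def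
  proof (intro allI impI)
    fix \<sigma> \<sigma>' :: "nat \<Rightarrow> nterm" and \<rho> \<rho>' :: "nat \<Rightarrow> nat"
    assume "\<forall>i<k. \<sigma> i = \<sigma>' i \<and> \<rho> i = \<rho>' i"
    then have "sub (up_sub \<sigma>) \<rho> \<phi> = sub (up_sub \<sigma>') \<rho>' \<phi>"
      using k[unfolded bounded_by_def] by (auto split: nat.split)
    then show "sub \<sigma> \<rho> (AllN \<phi>) = sub \<sigma>' \<rho>' (AllN \<phi>)" by simp
  qed
  then show ?case ..
next
  case (AllS \<phi>)
  then obtain k where k: "bounded_by k \<phi>" by blast
  have "bounded_by k (AllS \<phi>)" unfolding bounded_by_def
  proof (intro allI impI)
    fix \<sigma> \<sigma>' :: "nat \<Rightarrow> nterm" and \<rho> \<rho>' :: "nat \<Rightarrow> nat"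
    assume "\<forall>i<k. \<sigma> i = \<sigma>' i \<and> \<rho> i = \<rho>' i"
    then have "sub (\<lambda>i. \<Up>(\<sigma> i)) (up_ren \<rho>) \<phi> = sub (\<lambda>i. \<Up>(\<sigma>' i)) (up_ren \<rho>') \<phi>"
      using k[unfolded bounded_by_def] by (auto split: nat.split)
    then show "sub \<sigma> \<rho> (AllS \<phi>) = sub \<sigma>' \<rho>' (AllS \<phi>)" by simp
  qed
  then show ?case ..
qed (auto simp: bounded_by_def)

lemma case_nat_comp: "case_nat X id \<circ> Suc = id"
  by (simp add: fun_eq_iff)

lemma instN_sub: "instN t (sub (up_sub \<sigma>) \<rho> \<phi>) = sub (case_nat t \<sigma>) \<rho> \<phi>"
proof -
  have "(\<lambda>i. tsub (case_nat t NVar) id (up_sub \<sigma> i)) = case_nat t \<sigma>"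
    by (auto simp: fun_eq_iff liftN_def tsub_tsub split: nat.split)
  then show ?thesis by (simp add: instN_def sub_sub)
qed

lemma instS_sub: "instS X (sub (\<lambda>i. \<Up>(\<sigma> i)) (up_ren \<rho>) \<phi>) = sub \<sigma> (case_nat X \<rho>) \<phi>"
proof -
  have "(\<lambda>i. tsub NVar (case_nat X id) (\<Up>(\<sigma> i))) = \<sigma>" 
    by (auto simp: fun_eq_iff liftS_def tsub_tsub case_nat_comp)
  moreover have "case_nat X id \<circ> up_ren \<rho> = case_nat X \<rho>"
    by (auto simp: fun_eq_iff split: nat.split)
  ultimately show ?thesis by (simp add: instS_def sub_sub)
qed

lemma sub_instN: "sub \<sigma> \<rho> (instN t \<phi>) = instN (tsub \<sigma> \<rho> t) (sub (up_sub \<sigma>) \<rho> \<phi>)"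
proof -
  have "(\<lambda>i. tsub \<sigma> \<rho> (case_nat t NVar i)) = case_nat (tsub \<sigma> \<rho> t) \<sigma>"
    by (auto simp: fun_eq_iff split: nat.split)
  then show ?thesis unfolding instN_sub by (simp add: instN_def sub_sub)
qed

lemma sub_instS: "sub \<sigma> \<rho> (instS X \<phi>) = instS (\<rho> X) (sub (\<lambda>i. \<Up>(\<sigma> i)) (up_ren \<rho>) \<phi>)"
proof -
  have "\<rho> \<circ> case_nat X id = case_nat (\<rho> X) \<rho>"
    by (auto simp: fun_eq_iff split: nat.split)
  then show ?thesis unfolding instS_sub by (simp add: instS_def sub_sub)
qed

lemma sub_liftN: "sub (up_sub \<sigma>) \<rho> (liftN_fm \<phi>) = liftN_fm (sub \<sigma> \<rho> \<phi>)"
  by (simp add: liftN_fm_def sub_sub liftN_def)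

lemma sub_liftS: "sub (\<lambda>i. \<Up>(\<sigma> i)) (up_ren \<rho>) (liftS_fm \<phi>) = liftS_fm (sub \<sigma> \<rho> \<phi>)"
  by (auto simp: liftS_fm_def sub_sub liftS_def comp_def)

section \<open>Derivability under weakening, substitution and fresh variables\<close>

lemma weaken: "T; \<Gamma> \<turnstile> \<phi> \<Longrightarrow> set \<Gamma> \<subseteq> set \<Delta> \<Longrightarrow> T; \<Delta> \<turnstile> \<phi>"
proof (induction arbitrary: \<Delta> rule: derivable.induct)
  case (ImpI \<phi> \<Gamma> \<psi>)
  then show ?case by (intro derivable.ImpI ImpI.IH) auto
next
  case (Raa \<phi> \<Gamma>)
  show ?case by (rule derivable.Raa[OF Raa.IH]) (use Raa.prems in auto)
next
  case (AllNI \<Gamma> \<phi>)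
  then show ?case by (intro derivable.AllNI AllNI.IH) auto
next
  case (AllSI \<Gamma> \<phi>)
  then show ?case by (intro derivable.AllSI AllSI.IH) auto
next
  case (Axiom \<phi> \<Gamma>)
  then show ?case by (intro derivable.Axiom)
next
  case (Assum \<phi> \<Gamma>)
  then show ?case by (intro derivable.Assum) auto
next
  case (ImpE \<Gamma> \<phi> \<psi>)
  show ?case by (rule derivable.ImpE[of _ _ \<phi>]) (rule ImpE.IH ImpE.prems)+
next
  case (AllNE \<Gamma> \<phi> t)
  show ?case by (rule derivable.AllNE) (rule AllNE.IH AllNE.prems)+
next
  case (AllSE \<Gamma> \<phi> X)
  show ?case by (rule derivable.AllSE) (rule AllSE.IH AllSE.prems)+
next
  case (NSubst \<Gamma> s t \<phi>)
  show ?case by (rule derivable.NSubst[of _ _ s]) (rule NSubst.IH NSubst.prems)+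
next
  case (SSubst \<Gamma> X Y \<phi>)
  show ?case by (rule derivable.SSubst[of _ _ X]) (rule SSubst.IH SSubst.prems)+
qed (rule derivable.NRefl derivable.SRefl)+

text \<open>Single uses of \<open>AllNE\<close> are strung together into a simultaneous substitution
  for the first \<open>k\<close> variables; the variables beyond the prefix drop by
  \<open>k\<close>.\<close>

lemma funpow_AllN_inst:
  "T; \<Gamma> \<turnstile> (AllN ^^ k) \<phi> \<Longrightarrow> T; \<Gamma> \<turnstile> sub (\<lambda>i. if i < k then \<tau> i else NVar (i - k)) id \<phi>"
proof (induction k arbitrary: \<phi> \<tau>)
  case 0
  have "(\<lambda>i. if i < 0 then \<tau> i else NVar (i - 0)) = NVar" by auto
  with 0 show ?case by (metis funpow_0 sub_id)
next
  case (Suc k)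
  let ?\<sigma> = "\<lambda>i. if i < k then \<tau> (Suc i) else NVar (i - k)"
  have "T; \<Gamma> \<turnstile> sub ?\<sigma> id (AllN \<phi>)"
    using Suc.prems by (intro Suc.IH[of "AllN \<phi>" "\<lambda>i. \<tau> (Suc i)"]) (simp add: funpow_swap1)
  from derivable.AllNE[OF this[simplified sub.simps], of "\<tau> 0"] 
  have "T; \<Gamma> \<turnstile> sub (case_nat (\<tau> 0) ?\<sigma>) id \<phi>" by (simp add: instN_sub)
  moreover have "case_nat (\<tau> 0) ?\<sigma> = (\<lambda>i. if i < Suc k then \<tau> i else NVar (i - Suc k))"
    by (auto simp: fun_eq_iff split: nat.split)
  ultimately show ?case by (simp only:)
qed

lemma funpow_AllS_inst:
  "T; \<Gamma> \<turnstile> (AllS ^^ k) \<phi> \<Longrightarrow> T; \<Gamma> \<turnstile> sub NVar (\<lambda>i. if i < k then \<rho> i else i - k) \<phi>"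
proof (induction k arbitrary: \<phi> \<rho>)
  case 0
  have "(\<lambda>i. if i < 0 then \<rho> i else i - 0) = id" by auto
  with 0 show ?case by (metis funpow_0 sub_id)
next
  case (Suc k)
  let ?\<rho> = "\<lambda>i. if i < k then \<rho> (Suc i) else i - k"
  have "T; \<Gamma> \<turnstile> sub NVar ?\<rho> (AllS \<phi>)"
    using Suc.prems by (intro Suc.IH[of "AllS \<phi>" "\<lambda>i. \<rho> (Suc i)"]) (simp add: funpow_swap1)
  from derivable.AllSE[OF this[simplified sub.simps], of "\<rho> 0"] 
  have "T; \<Gamma> \<turnstile> sub NVar (case_nat (\<rho> 0) ?\<rho>) \<phi>" by (simp add: instS_sub)
  moreover have "case_nat (\<rho> 0) ?\<rho> = (\<lambda>i. if i < Suc k then \<rho> i else i - Suc k)"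
    by (auto simp: fun_eq_iff split: nat.split)
  ultimately show ?case by simp
qed

text \<open>The calculus has no substitution rule, so the formula is generalized over more variables
  than occur in it and then instantiated. The hypothesis ranges over all contexts because
  generalization lifts the context.\<close>

lemma valid_sub:
  assumes "\<And>\<Gamma>. T; \<Gamma> \<turnstile> \<phi>"
  shows "T; \<Gamma> \<turnstile> sub \<sigma> \<rho> \<phi>"
proof -
  obtain k where k: "bounded_by k \<phi>" using bounded_by_exists by blast
  have allS: "T; \<Delta> \<turnstile> (AllS ^^ k) \<phi>" for \<Delta>
    by (induction k arbitrary: \<Delta>) (auto intro: assms derivable.AllSI)
  let ?\<sigma> = "\<lambda>i. if i < k then \<sigma> i else NVar (i - k)" and ?\<rho> = "\<lambda>i. if i < k then \<rho> i else i - k"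
  note inst = funpow_AllS_inst[OF allS, of _ \<rho>]
  have allN: "T; \<Delta> \<turnstile> (AllN ^^ k) (sub NVar ?\<rho> \<phi>)" for \<Delta>
  proof -
    have "T; \<Delta> \<turnstile> (AllN ^^ j) (sub NVar ?\<rho> \<phi>)" for j
      by (induction j arbitrary: \<Delta>) (auto intro: inst derivable.AllNI)
    then show ?thesis .
  qed
  have "T; \<Gamma> \<turnstile> sub ?\<sigma> id (sub NVar ?\<rho> \<phi>)"
    by (rule funpow_AllN_inst[OF allN])
  moreover have "sub ?\<sigma> id (sub NVar ?\<rho> \<phi>) = sub \<sigma> \<rho> \<phi>"
    unfolding sub_sub using k[unfolded bounded_by_def] by auto
  ultimately show ?thesis by simp
qed

text \<open>The substitution is pushed through each rule. The set of axioms need not be closed under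
  substitution, so the axiom case rests on \<open>valid_sub\<close>.\<close>

lemma derivable_sub: "T; \<Gamma> \<turnstile> \<phi> \<Longrightarrow> T; map (sub \<sigma> \<rho>) \<Gamma> \<turnstile> sub \<sigma> \<rho> \<phi>"
proof (induction arbitrary: \<sigma> \<rho> rule: derivable.induct)
  case (Axiom \<phi> \<Gamma>)
  then show ?case by (intro valid_sub derivable.Axiom)
next
  case (Assum \<phi> \<Gamma>)
  then show ?case by (intro derivable.Assum) auto
next
  case (ImpI \<phi> \<Gamma> \<psi>)
  from ImpI.IH[of \<sigma> \<rho>] show ?case by (auto intro: derivable.ImpI)
next
  case (ImpE \<Gamma> \<phi> \<psi>)
  from ImpE.IH[of \<sigma> \<rho>] show ?case by (auto dest: derivable.ImpE)
next
  case (Raa \<phi> \<Gamma>)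
  show ?case by (rule derivable.Raa) (use Raa.IH[of \<sigma> \<rho>] in \<open>simp add: Neg_def\<close>)
next
  case (AllNI \<Gamma> \<phi>)
  from AllNI.IH[of "up_sub \<sigma>" \<rho>] show ?case
    by (auto intro!: derivable.AllNI simp: sub_liftN comp_def)
next
  case (AllNE \<Gamma> \<phi> t)
  from AllNE.IH[of \<sigma> \<rho>] show ?case unfolding sub_instN by (auto dest: derivable.AllNE)
next
  case (AllSI \<Gamma> \<phi>)
  from AllSI.IH[of "\<lambda>i. \<Up>(\<sigma> i)" "up_ren \<rho>"] show ?case
    by (auto intro!: derivable.AllSI simp: sub_liftS comp_def)
next
  case (AllSE \<Gamma> \<phi> X)
  from AllSE.IH[of \<sigma> \<rho>] show ?case unfolding sub_instS by (auto dest: derivable.AllSE)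
next
  case (NRefl \<Gamma> t)
  show ?case by (auto intro: derivable.NRefl)
next
  case (NSubst \<Gamma> s t \<phi>)
  from NSubst.IH[of \<sigma> \<rho>] show ?case unfolding sub_instN by (auto dest: derivable.NSubst)
next
  case (SRefl \<Gamma> X)
  show ?case by (auto intro: derivable.SRefl)
next
  case (SSubst \<Gamma> X Y \<phi>)
  from SSubst.IH[of \<sigma> \<rho>] show ?case unfolding sub_instS by (auto dest: derivable.SSubst)
qed

text \<open>The rule \<open>AllNI\<close> expresses freshness by lifting, whereas the Henkin
  construction supplies a named variable. Renaming \<open>v\<close> to index 0 and shifting all
  other indices up turns the instance at \<open>v\<close> back into \<phi>, and the formulas of
  \<Gamma>, in which \<open>v\<close> does not occur, into their lifts.\<close>

lemma AllN_fresh: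
  assumes "T; \<Gamma> \<turnstile> instN (NVar v) \<phi>" "bounded_by v \<phi>" "\<forall>\<psi>\<in>set \<Gamma>. bounded_by v \<psi>"
  shows "T; \<Gamma> \<turnstile> AllN \<phi>"
proof (rule derivable.AllNI)
  let ?\<sigma> = "\<lambda>i. if i = v then NVar 0 else NVar (Suc i)"
  have "map (sub ?\<sigma> id) \<Gamma> = map liftN_fm \<Gamma>"
    using assms(3) by (auto simp: liftN_fm_def bounded_by_def)
  moreover have "sub ?\<sigma> id (instN (NVar v) \<phi>) = sub (case_nat (NVar 0) ?\<sigma>) id \<phi>"
  proof -
    have "(\<lambda>i. tsub ?\<sigma> id (case_nat (NVar v) NVar i)) = case_nat (NVar 0) ?\<sigma>"
      by (auto simp: fun_eq_iff split: nat.split)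
    then show ?thesis by (simp add: instN_def sub_sub)
  qed
  moreover have "\<dots> = sub NVar id \<phi>"
    by (rule assms(2)[unfolded bounded_by_def, rule_format]) (auto split: nat.split)
  ultimately show "T; map liftN_fm \<Gamma> \<turnstile> \<phi>"
    using derivable_sub[OF assms(1), of ?\<sigma> id] by (metis sub_id)
qed

lemma AllS_fresh:
  assumes "T; \<Gamma> \<turnstile> instS v \<phi>" "bounded_by v \<phi>" "\<forall>\<psi>\<in>set \<Gamma>. bounded_by v \<psi>"
  shows "T; \<Gamma> \<turnstile> AllS \<phi>"
proof (rule derivable.AllSI)
  let ?\<rho> = "\<lambda>i. if i = v then 0 else Suc i"
  have "map (sub NVar ?\<rho>) \<Gamma> = map liftS_fm \<Gamma>"
    using assms(3) by (auto simp: liftS_fm_def bounded_by_def)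
  moreover have "sub NVar ?\<rho> (instS v \<phi>) = sub NVar (case_nat 0 ?\<rho>) \<phi>"
  proof -
    have "?\<rho> \<circ> case_nat v id = case_nat 0 ?\<rho>"
      by (auto simp: fun_eq_iff split: nat.split)
    then show ?thesis by (simp add: instS_def sub_sub)
  qed
  moreover have "\<dots> = sub NVar id \<phi>"
    by (rule assms(2)[unfolded bounded_by_def, rule_format]) (auto split: nat.split)
  ultimately show "T; map liftS_fm \<Gamma> \<turnstile> \<phi>"
    using derivable_sub[OF assms(1), of NVar ?\<rho>] by (metis sub_id)
qed

section \<open>The Henkin extension of a consistent list of formulas\<close>

instance nterm :: countable by countable_datatype
instance fm :: countable by countable_datatype

definition consistent :: "fm set \<Rightarrow> fm list \<Rightarrow> bool" where
  "consistent T \<Gamma> \<longleftrightarrow> \<not> T; \<Gamma> \<turnstile> \<^bold>\<bottom>"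

lemma inconsistentD:
  assumes "\<not> consistent T ((\<^bold>\<not> \<phi>) # \<Gamma>)"
  shows "T; \<Gamma> \<turnstile> \<phi>"
  using assms by (auto simp: consistent_def intro: derivable.Raa)

lemma consistent_cases: "consistent T \<Gamma> \<Longrightarrow> consistent T (\<phi> # \<Gamma>) \<or> consistent T ((\<^bold>\<not> \<phi>) # \<Gamma>)"
proof (rule ccontr)
  assume "consistent T \<Gamma>" and *: "\<not> (consistent T (\<phi> # \<Gamma>) \<or> consistent T ((\<^bold>\<not> \<phi>) # \<Gamma>))"
  from * have "T; \<Gamma> \<turnstile> \<phi>" by (intro inconsistentD) simp
  moreover from * have "T; \<Gamma> \<turnstile> (\<phi> \<^bold>\<longrightarrow> \<^bold>\<bottom>)" by (intro derivable.ImpI) (simp add: consistent_def)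
  ultimately have "T; \<Gamma> \<turnstile> \<^bold>\<bottom>" by (rule derivable.ImpE[rotated])
  with \<open>consistent T \<Gamma>\<close> show False by (simp add: consistent_def)
qed

text \<open>Witnesses are demanded for rejected universal formulas only, since existential
  quantifiers are abbreviations.\<close>

definition decided :: "fm \<Rightarrow> fm set \<Rightarrow> bool" where
  "decided \<phi> H \<longleftrightarrow> \<phi> \<in> H \<or> ((\<^bold>\<not> \<phi>) \<in> H
     \<and> (\<forall>\<psi>. \<phi> = AllN \<psi> \<longrightarrow> (\<exists>t. (\<^bold>\<not> instN t \<psi>) \<in> H))
     \<and> (\<forall>\<psi>. \<phi> = AllS \<psi> \<longrightarrow> (\<exists>X. (\<^bold>\<not> instS X \<psi>) \<in> H)))"

lemma fresh_exists: "\<exists>v. \<forall>\<psi>\<in>set \<Gamma>. bounded_by v \<psi>"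
proof (induction \<Gamma>)
  case (Cons \<phi> \<Gamma>)
  then obtain v w where "\<forall>\<psi>\<in>set \<Gamma>. bounded_by v \<psi>" "bounded_by w \<phi>"
    using bounded_by_exists by blast
  then show ?case by (intro exI[of _ "max v w"]) (auto intro: bounded_by_mono)
qed auto

text \<open>A stage is a finite list, so some variable lies above all its indices and can serve as
  the witness. If the negated instance at this variable were inconsistent with the stage, the
  fresh-variable rule would derive the rejected universal formula.\<close>

lemma henkin_step:
  assumes "consistent T \<Gamma>"
  shows "\<exists>\<Delta>. consistent T \<Delta> \<and> set \<Gamma> \<subseteq> set \<Delta> \<and> decided \<phi> (set \<Delta>)"
proof (cases "consistent T (\<phi> # \<Gamma>)")
  case True
  then show ?thesis by (intro exI[of _ "\<phi> # \<Gamma>"]) (auto simp: decided_def)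
next
  case False
  define \<Delta> where "\<Delta> = (\<^bold>\<not> \<phi>) # \<Gamma>"
  have con: "consistent T \<Delta>" using consistent_cases[OF assms, of \<phi>] False by (simp add: \<Delta>_def)
  show ?thesis
  proof (cases \<phi>)
    case (AllN \<psi>)
    obtain v where v: "\<forall>\<chi>\<in>set (\<psi> # \<Delta>). bounded_by v \<chi>" using fresh_exists by blast
    have "consistent T ((\<^bold>\<not> instN (NVar v) \<psi>) # \<Delta>)"
    proof (rule ccontr)
      assume "\<not> ?thesis"
      from inconsistentD[OF this] have "T; \<Delta> \<turnstile> \<phi>" using v AllN by (auto intro: AllN_fresh)
      moreover have "T; \<Delta> \<turnstile> \<^bold>\<not> \<phi>" by (auto intro: derivable.Assum simp: \<Delta>_def)
      ultimately show False using con by (metis Neg_def consistent_def derivable.ImpE)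
    qed
    then show ?thesis
      by (intro exI[of _ "(\<^bold>\<not> instN (NVar v) \<psi>) # \<Delta>"]) (auto simp: AllN \<Delta>_def decided_def)
  next
    case (AllS \<psi>)
    obtain v where v: "\<forall>\<chi>\<in>set (\<psi> # \<Delta>). bounded_by v \<chi>" using fresh_exists by blast
    have "consistent T ((\<^bold>\<not> instS v \<psi>) # \<Delta>)"
    proof (rule ccontr)
      assume "\<not> ?thesis"
      from inconsistentD[OF this] have "T; \<Delta> \<turnstile> \<phi>" using v AllS by (auto intro: AllS_fresh)
      moreover have "T; \<Delta> \<turnstile> \<^bold>\<not> \<phi>" by (auto intro: derivable.Assum simp: \<Delta>_def)
      ultimately show False using con by (metis Neg_def consistent_def derivable.ImpE)
    qed
    then show ?thesis
      by (intro exI[of _ "(\<^bold>\<not> instS v \<psi>) # \<Delta>"]) (auto simp: AllS \<Delta>_def decided_def)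
  qed (use con in \<open>auto intro!: exI[of _ \<Delta>] simp: \<Delta>_def decided_def\<close>)
qed

text \<open>The properties of the complete theory of a two-sorted structure all of whose elements are
  named by terms, and in which all instances of \<open>T\<close> are true.\<close>

locale henkin =
  fixes T H :: "fm set"
  assumes Falsum: "\<^bold>\<bottom> \<notin> H"
    and Imp: "(\<phi> \<^bold>\<longrightarrow> \<psi>) \<in> H \<longleftrightarrow> (\<phi> \<in> H \<longrightarrow> \<psi> \<in> H)"
    and AllN: "AllN \<phi> \<in> H \<longleftrightarrow> (\<forall>t. instN t \<phi> \<in> H)"
    and AllS: "AllS \<phi> \<in> H \<longleftrightarrow> (\<forall>X. instS X \<phi> \<in> H)"
    and NRefl: "(t \<^bold>= t) \<in> H"
    and NSubst: "(s \<^bold>= t) \<in> H \<Longrightarrow> instN s \<phi> \<in> H \<Longrightarrow> instN t \<phi> \<in> H"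
    and SRefl: "(X \<^bold>=\<^sub>s X) \<in> H"
    and SSubst: "(X \<^bold>=\<^sub>s Y) \<in> H \<Longrightarrow> instS X \<phi> \<in> H \<Longrightarrow> instS Y \<phi> \<in> H"
    and axiom: "\<phi> \<in> T \<Longrightarrow> sub \<sigma> \<rho> \<phi> \<in> H"

lemma henkin_exists:
  assumes "consistent T \<Gamma>"
  shows "\<exists>H. henkin T H \<and> set \<Gamma> \<subseteq> H"
proof -
  define ext where "ext \<Delta> \<phi> = (SOME \<Delta>'. consistent T \<Delta>' \<and> set \<Delta> \<subseteq> set \<Delta>' \<and> decided \<phi> (set \<Delta>'))"
    for \<Delta> and \<phi> :: fm
  have nxt: "consistent T (ext \<Delta> \<phi>) \<and> set \<Delta> \<subseteq> set (ext \<Delta> \<phi>) \<and> decided \<phi> (set (ext \<Delta> \<phi>))"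
    if "consistent T \<Delta>" for \<Delta> \<phi>
    unfolding ext_def by (rule someI_ex[OF henkin_step[OF that]])
  \<comment> \<open>Stage \<open>k + 1\<close> decides the formula with number \<open>k\<close>, so
    every formula is decided at some stage.\<close>
  define G where "G = rec_nat \<Gamma> (\<lambda>k \<Delta>. ext \<Delta> (from_nat k))"
  have G: "G 0 = \<Gamma>" "G (Suc k) = ext (G k) (from_nat k)" for k by (auto simp: G_def)
  have con: "consistent T (G k)" for k by (induction k) (auto simp: G assms nxt)
  have mono: "set (G k) \<subseteq> set (G l)" if "k \<le> l" for k l
    using that
  proof (induction l rule: dec_induct)
    case (step l)
    then show ?case using nxt[OF con[of l], of "from_nat l"] G(2)[of l] by auto
  qed auto
  define H where "H = (\<Union>k. set (G k))"
  have dec: "decided \<phi> H" for \<phi>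
  proof -
    have "decided \<phi> (set (G (Suc (to_nat \<phi>))))" using nxt[OF con[of "to_nat \<phi>"], of \<phi>] G by auto
    then show ?thesis unfolding decided_def H_def by blast
  qed
  have fin: "\<exists>k. set \<Delta> \<subseteq> set (G k)" if "set \<Delta> \<subseteq> H" for \<Delta>
    using that
  proof (induction \<Delta>)
    case (Cons \<phi> \<Delta>)
    then obtain k l where "set \<Delta> \<subseteq> set (G k)" "\<phi> \<in> set (G l)" by (auto simp: H_def)
    then show ?case using mono[of k "max k l"] mono[of l "max k l"]
      by (intro exI[of _ "max k l"]) auto
  qed auto
  have noF: "\<not> T; \<Delta> \<turnstile> \<^bold>\<bottom>" if \<Delta>: "set \<Delta> \<subseteq> H" for \<Delta>
  proof
    assume \<Delta>F: "T; \<Delta> \<turnstile> \<^bold>\<bottom>"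
    obtain k where "set \<Delta> \<subseteq> set (G k)" using fin[OF \<Delta>] by blast
    from weaken[OF \<Delta>F this] con[of k] show False unfolding consistent_def by contradiction
  qed
  \<comment> \<open>If \<phi> is missing, its negation is present, and together with \<Delta> it
    derives falsity; some finite stage would then be inconsistent.\<close>
  have closed: "\<phi> \<in> H" if "set \<Delta> \<subseteq> H" "T; \<Delta> \<turnstile> \<phi>" for \<phi> \<Delta>
  proof (rule ccontr)
    assume "\<phi> \<notin> H"
    then have neg: "(\<^bold>\<not> \<phi>) \<in> H" using dec by (auto simp: decided_def)
    have "T; (\<^bold>\<not> \<phi>) # \<Delta> \<turnstile> (\<phi> \<^bold>\<longrightarrow> \<^bold>\<bottom>)" by (rule derivable.Assum) (simp add: Neg_def)
    then have "T; (\<^bold>\<not> \<phi>) # \<Delta> \<turnstile> \<^bold>\<bottom>" by (rule derivable.ImpE) (rule weaken[OF that(2)], auto)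
    then show False using noF[of "(\<^bold>\<not> \<phi>) # \<Delta>"] neg that(1) by simp
  qed
  have mp: "\<psi> \<in> H" if "(\<phi> \<^bold>\<longrightarrow> \<psi>) \<in> H" "\<phi> \<in> H" for \<phi> \<psi>
  proof (rule closed)
    show "T; [\<phi> \<^bold>\<longrightarrow> \<psi>, \<phi>] \<turnstile> \<psi>" by (rule derivable.ImpE[of _ _ \<phi>]; rule derivable.Assum; simp)
  qed (use that in simp)
  have F: "\<^bold>\<bottom> \<notin> H" using noF[of "[\<^bold>\<bottom>]"] by (auto simp: derivable.Assum)
  have neg: "(\<^bold>\<not> \<phi>) \<in> H \<longleftrightarrow> \<phi> \<notin> H" for \<phi>
    using mp[of \<phi> "\<^bold>\<bottom>"] F dec[of \<phi>] by (auto simp: decided_def Neg_def)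
  have "henkin T H"
  proof
    show "\<^bold>\<bottom> \<notin> H" by (rule F)
    fix \<phi> \<psi>
    show "(\<phi> \<^bold>\<longrightarrow> \<psi>) \<in> H \<longleftrightarrow> (\<phi> \<in> H \<longrightarrow> \<psi> \<in> H)"
    proof
      assume imp: "\<phi> \<in> H \<longrightarrow> \<psi> \<in> H"
      show "(\<phi> \<^bold>\<longrightarrow> \<psi>) \<in> H"
      proof (cases "\<phi> \<in> H")
        case True
        have "T; [\<psi>] \<turnstile> (\<phi> \<^bold>\<longrightarrow> \<psi>)" by (rule derivable.ImpI[OF derivable.Assum]) simp
        then show ?thesis by (rule closed[rotated]) (use True imp in simp)
      next
        case False
        have "T; [\<phi>, \<^bold>\<not> \<phi>] \<turnstile> \<^bold>\<bottom>" unfolding Neg_def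
          by (rule derivable.ImpE[of _ _ \<phi>]; rule derivable.Assum; simp)
        then have "T; [\<^bold>\<not> \<psi>, \<phi>, \<^bold>\<not> \<phi>] \<turnstile> \<^bold>\<bottom>" by (rule weaken) auto
        then have "T; [\<^bold>\<not> \<phi>] \<turnstile> (\<phi> \<^bold>\<longrightarrow> \<psi>)" by (rule derivable.ImpI[OF derivable.Raa])
        then show ?thesis by (rule closed[rotated]) (use False neg in simp)
      qed
    qed (use mp in auto)
    show "AllN \<phi> \<in> H \<longleftrightarrow> (\<forall>t. instN t \<phi> \<in> H)"
    proof (intro iffI allI)
      fix t assume "AllN \<phi> \<in> H"
      moreover have "T; [AllN \<phi>] \<turnstile> instN t \<phi>" by (rule derivable.AllNE[OF derivable.Assum]) simp
      ultimately show "instN t \<phi> \<in> H" by (intro closed[of "[AllN \<phi>]"]) simp_all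
    next
      assume "\<forall>t. instN t \<phi> \<in> H"
      then show "AllN \<phi> \<in> H" using dec[of "AllN \<phi>"] neg by (auto simp: decided_def)
    qed
    show "AllS \<phi> \<in> H \<longleftrightarrow> (\<forall>X. instS X \<phi> \<in> H)"
    proof (intro iffI allI)
      fix X assume "AllS \<phi> \<in> H"
      moreover have "T; [AllS \<phi>] \<turnstile> instS X \<phi>" by (rule derivable.AllSE[OF derivable.Assum]) simp
      ultimately show "instS X \<phi> \<in> H" by (intro closed[of "[AllS \<phi>]"]) simp_all
    next
      assume "\<forall>X. instS X \<phi> \<in> H"
      then show "AllS \<phi> \<in> H" using dec[of "AllS \<phi>"] neg by (auto simp: decided_def)
    qed
    fix s t X Y \<sigma> \<rho>
    show "(t \<^bold>= t) \<in> H" by (rule closed[of "[]"]) (simp_all add: derivable.NRefl)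
    show "(X \<^bold>=\<^sub>s X) \<in> H" by (rule closed[of "[]"]) (simp_all add: derivable.SRefl)
    show "instN t \<phi> \<in> H" if "(s \<^bold>= t) \<in> H" "instN s \<phi> \<in> H"
    proof (rule closed)
      show "T; [s \<^bold>= t, instN s \<phi>] \<turnstile> instN t \<phi>"
        by (rule derivable.NSubst[of _ _ s]; rule derivable.Assum; simp)
    qed (use that in simp)
    show "instS Y \<phi> \<in> H" if "(X \<^bold>=\<^sub>s Y) \<in> H" "instS X \<phi> \<in> H"
    proof (rule closed)
      show "T; [X \<^bold>=\<^sub>s Y, instS X \<phi>] \<turnstile> instS Y \<phi>"
        by (rule derivable.SSubst[of _ _ X]; rule derivable.Assum; simp)
    qed (use that in simp)
    show "sub \<sigma> \<rho> \<phi> \<in> H" if "\<phi> \<in> T"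
      by (rule closed[of "[]"]) (simp_all add: valid_sub[OF derivable.Axiom[OF that]])
  qed
  moreover have "set \<Gamma> \<subseteq> H" using G(1) by (auto simp: H_def)
  ultimately show ?thesis by blast
qed

section \<open>Models of \<open>V\<^sup>0\<close>\<close>

text \<open>The second sort consists of actual subsets of the first, so that equality of sets is
  equality of extensions. The strict order and subtraction are not in the language; they are there
  to make models instances of an algebraic class.\<close>

class v0_struct = plus + times + zero + one + ord + minus +
  fixes Sets :: "'a set set" and len :: "'a set \<Rightarrow> 'a"

primrec tval :: "(nat \<Rightarrow> 'a::v0_struct) \<Rightarrow> (nat \<Rightarrow> 'a set) \<Rightarrow> nterm \<Rightarrow> 'a" where
  "tval e S (NVar i) = e i"
| "tval e S \<^bold>0 = 0"
| "tval e S \<^bold>1 = 1"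
| "tval e S (s \<^bold>+ t) = tval e S s + tval e S t"
| "tval e S (s \<^bold>* t) = tval e S s * tval e S t"
| "tval e S (Len X) = len (S X)"

primrec sat :: "(nat \<Rightarrow> 'a::v0_struct) \<Rightarrow> (nat \<Rightarrow> 'a set) \<Rightarrow> fm \<Rightarrow> bool" where
  "sat e S \<^bold>\<bottom> \<longleftrightarrow> False"
| "sat e S (s \<^bold>= t) \<longleftrightarrow> tval e S s = tval e S t"
| "sat e S (X \<^bold>=\<^sub>s Y) \<longleftrightarrow> S X = S Y"
| "sat e S (s \<^bold>\<le> t) \<longleftrightarrow> tval e S s \<le> tval e S t"
| "sat e S (t \<^bold>\<in> X) \<longleftrightarrow> tval e S t \<in> S X"
| "sat e S (\<phi> \<^bold>\<longrightarrow> \<psi>) \<longleftrightarrow> (sat e S \<phi> \<longrightarrow> sat e S \<psi>)"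
| "sat e S (AllN \<phi>) \<longleftrightarrow> (\<forall>x. sat (case_nat x e) S \<phi>)"
| "sat e S (AllS \<phi>) \<longleftrightarrow> (\<forall>X\<in>Sets. sat e (case_nat X S) \<phi>)"

lemma tval_tsub: "tval e S (tsub \<sigma> \<rho> t) = tval (\<lambda>i. tval e S (\<sigma> i)) (\<lambda>X. S (\<rho> X)) t"
  by (induction t) auto

lemma tval_liftN [simp]: "tval (case_nat x e) S (\<up>t) = tval e S t"
  by (simp add: liftN_def tval_tsub)

lemma tval_liftS [simp]: "tval e (case_nat X S) (\<Up>t) = tval e S t"
  by (simp add: liftS_def tval_tsub)

lemma sat_sub: "sat e S (sub \<sigma> \<rho> \<phi>) \<longleftrightarrow> sat (\<lambda>i. tval e S (\<sigma> i)) (\<lambda>X. S (\<rho> X)) \<phi>"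
proof (induction \<phi> arbitrary: e S \<sigma> \<rho>)
  case (AllN \<phi>)
  have "(\<lambda>i. tval (case_nat x e) S (up_sub \<sigma> i)) = case_nat x (\<lambda>i. tval e S (\<sigma> i))" for x
    by (auto simp: fun_eq_iff split: nat.split)
  then show ?case using AllN by simp
next
  case (AllS \<phi>)
  have "(\<lambda>Y. case_nat X S (up_ren \<rho> Y)) = case_nat X (\<lambda>Y. S (\<rho> Y))" for X
    by (auto simp: fun_eq_iff split: nat.split)
  then show ?case using AllS by simp
qed (auto simp: tval_tsub)

lemma sat_liftS [simp]: "sat e (case_nat X S) (liftS_fm \<phi>) \<longleftrightarrow> sat e S \<phi>"
  by (simp add: liftS_fm_def sat_sub)

lemma sat_derived [simp]:
  "sat e S (\<^bold>\<not> \<phi>) \<longleftrightarrow> \<not> sat e S \<phi>"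
  "sat e S (\<phi> \<^bold>\<and> \<psi>) \<longleftrightarrow> sat e S \<phi> \<and> sat e S \<psi>"
  "sat e S (\<phi> \<^bold>\<or> \<psi>) \<longleftrightarrow> sat e S \<phi> \<or> sat e S \<psi>"
  "sat e S (\<phi> \<^bold>\<longleftrightarrow> \<psi>) \<longleftrightarrow> (sat e S \<phi> \<longleftrightarrow> sat e S \<psi>)"
  "sat e S (ExN \<phi>) \<longleftrightarrow> (\<exists>x. sat (case_nat x e) S \<phi>)"
  "sat e S (ExS \<phi>) \<longleftrightarrow> (\<exists>X\<in>Sets. sat e (case_nat X S) \<phi>)"
  "sat e S (s \<^bold>< t) \<longleftrightarrow> tval e S s \<le> tval e S t \<and> tval e S s \<noteq> tval e S t"
  by (auto simp: Neg_def Conj_def Disj_def Iff_def ExN_def ExS_def Lt_def)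

lemma sat_bounded [simp]:
  "sat e S (AllLe t \<phi>) \<longleftrightarrow> (\<forall>x. x \<le> tval e S t \<longrightarrow> sat (case_nat x e) S \<phi>)"
  "sat e S (ExLe t \<phi>) \<longleftrightarrow> (\<exists>x. x \<le> tval e S t \<and> sat (case_nat x e) S \<phi>)"
  "sat e S (AllLt t \<phi>) \<longleftrightarrow> (\<forall>x. x \<le> tval e S t \<and> x \<noteq> tval e S t \<longrightarrow> sat (case_nat x e) S \<phi>)"
  "sat e S (ExLt t \<phi>) \<longleftrightarrow> (\<exists>x. (x \<le> tval e S t \<and> x \<noteq> tval e S t) \<and> sat (case_nat x e) S \<phi>)"
  by (auto simp: AllLe_def ExLe_def AllLt_def ExLt_def)

lemma AllLe_sub: "sub \<sigma> \<rho> (AllLe t \<phi>) = AllLe (tsub \<sigma> \<rho> t) (sub (up_sub \<sigma>) \<rho> \<phi>)"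
  by (simp add: AllLe_def liftN_def tsub_tsub comp_def)

lemma ExLe_sub: "sub \<sigma> \<rho> (ExLe t \<phi>) = ExLe (tsub \<sigma> \<rho> t) (sub (up_sub \<sigma>) \<rho> \<phi>)"
  by (simp add: ExLe_def ExN_def Neg_def Conj_def liftN_def tsub_tsub comp_def)

lemma SigmaB0_sub: "\<phi> \<in> SigmaB0 \<Longrightarrow> sub \<sigma> \<rho> \<phi> \<in> SigmaB0"
  by (induction arbitrary: \<sigma> \<rho> rule: SigmaB0.induct)
    (auto simp: AllLe_sub ExLe_sub intro: SigmaB0.intros)

text \<open>The axioms read semantically, with extensionality absorbed into the representation of
  sets. \<open>less_iff\<close> and \<open>minus_eq\<close> fix the two operations outside the
  language, subtraction being truncated as on the natural numbers.\<close>

class v0_model = v0_struct +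
  assumes B1: "x + 1 \<noteq> 0"
    and B2: "x + 1 = y + 1 \<Longrightarrow> x = y"
    and B3: "x + 0 = x"
    and B4: "x + (y + 1) = (x + y) + 1"
    and B5: "x * 0 = 0"
    and B6: "x * (y + 1) = x * y + x"
    and B7: "x \<le> y \<Longrightarrow> y \<le> x \<Longrightarrow> x = y"
    and B8: "x \<le> x + y"
    and B9: "0 \<le> x"
    and B10: "x \<le> y \<or> y \<le> x"
    and B11: "x \<le> y \<longleftrightarrow> x \<le> y + 1 \<and> x \<noteq> y + 1"
    and B12: "x \<noteq> 0 \<Longrightarrow> \<exists>y. y \<le> x \<and> y + 1 = x"
    and L1: "X \<in> Sets \<Longrightarrow> y \<in> X \<Longrightarrow> y \<le> len X \<and> y \<noteq> len X"
    and L2: "X \<in> Sets \<Longrightarrow> y + 1 = len X \<Longrightarrow> y \<in> X"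
    and Sets_nonempty: "Sets \<noteq> {}"
    and comprehension: "\<phi> \<in> SigmaB0 \<Longrightarrow> (\<And>i. S i \<in> Sets) \<Longrightarrow>
      \<exists>X\<in>Sets. len X \<le> y \<and> (\<forall>z. z \<le> y \<and> z \<noteq> y \<longrightarrow> (z \<in> X \<longleftrightarrow> sat (case_nat z e) S \<phi>))"
    and less_iff: "x < y \<longleftrightarrow> x \<le> y \<and> x \<noteq> y"
    and minus_eq: "x - y = (if y \<le> x then THE z. y + z = x else 0)"

text \<open>Two infinite families share one valuation, so no number of arguments or parameters has
  to be fixed in advance. The same interleaving later merges two lists of parameters into
  one.\<close>

definition mix :: "(nat \<Rightarrow> 'a) \<Rightarrow> (nat \<Rightarrow> 'a) \<Rightarrow> nat \<Rightarrow> 'a" where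
  "mix e c i = (if even i then e (i div 2) else c (i div 2))"

lemma mix_simps [simp]: "mix e c (2 * i) = e i" "mix e c (Suc (2 * i)) = c i" "mix e c 0 = e 0"
  by (auto simp: mix_def)

lemma eq_mixI: "(\<And>i. f (2 * i) = e i) \<Longrightarrow> (\<And>i. f (Suc (2 * i)) = c i) \<Longrightarrow> f = mix e c"
  by (auto simp: fun_eq_iff mix_def elim!: evenE oddE)

text \<open>\<open>\<Sigma>\<^sup>B\<^sub>0\<close>-definability with parameters of both sorts: the even number variables are the
  arguments, the odd ones the parameters.\<close>

definition defin :: "(nat \<Rightarrow> 'a) \<Rightarrow> (nat \<Rightarrow> 'a set) \<Rightarrow> ((nat \<Rightarrow> 'a::v0_struct) \<Rightarrow> bool) \<Rightarrow> bool" where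
  "defin c S P \<longleftrightarrow> range S \<subseteq> Sets \<and> (\<exists>\<phi>\<in>SigmaB0. \<forall>e. P e \<longleftrightarrow> sat (mix e c) S \<phi>)"

definition definable :: "((nat \<Rightarrow> 'a::v0_struct) \<Rightarrow> bool) \<Rightarrow> bool" where
  "definable P \<longleftrightarrow> (\<exists>c S. defin c S P)"

text \<open>The value must not depend on \<open>S\<close>, which keeps lengths from contributing; a
  length enters as a constant parameter instead.\<close>

definition term_in :: "(nat \<Rightarrow> 'a) \<Rightarrow> ((nat \<Rightarrow> 'a::v0_struct) \<Rightarrow> 'a) \<Rightarrow> bool" where
  "term_in c t \<longleftrightarrow> (\<exists>u. \<forall>e S. t e = tval (mix e c) S u)"

definition polynomial :: "((nat \<Rightarrow> 'a::v0_struct) \<Rightarrow> 'a) \<Rightarrow> bool" where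
  "polynomial t \<longleftrightarrow> (\<exists>c. term_in c t)"

text \<open>Renumbering the parameters makes room for those of a second formula, so that two
  formulas with different parameters can be joined by a connective.\<close>

lemma defin_mixL:
  assumes "defin c S P" "range U \<subseteq> Sets"
  shows "defin (mix c d) (mix S U) P"
proof -
  obtain \<phi> where \<phi>: "\<phi> \<in> SigmaB0" "\<And>e. P e \<longleftrightarrow> sat (mix e c) S \<phi>" "range S \<subseteq> Sets"
    using assms(1) by (auto simp: defin_def)
  let ?\<sigma> = "\<lambda>i. NVar (if even i then i else Suc (2 * (2 * (i div 2))))"
  have "(\<lambda>i. tval (mix e (mix c d)) (mix S U) (?\<sigma> i)) = mix e c" for e
    by (rule eq_mixI) (simp_all add: mix_def)
  then have "P e \<longleftrightarrow> sat (mix e (mix c d)) (mix S U) (sub ?\<sigma> (\<lambda>X. 2 * X) \<phi>)" for e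
    by (simp only: sat_sub \<phi>(2) mix_simps)
  moreover have "range (mix S U) \<subseteq> Sets" using assms(2) \<phi>(3) by (auto simp: mix_def)
  ultimately show ?thesis unfolding defin_def using SigmaB0_sub[OF \<phi>(1)] by blast
qed

lemma defin_mixR:
  assumes "defin d U P" "range S \<subseteq> Sets"
  shows "defin (mix c d) (mix S U) P"
proof -
  obtain \<phi> where \<phi>: "\<phi> \<in> SigmaB0" "\<And>e. P e \<longleftrightarrow> sat (mix e d) U \<phi>" "range U \<subseteq> Sets"
    using assms(1) by (auto simp: defin_def)
  let ?\<sigma> = "\<lambda>i. NVar (if even i then i else Suc (2 * (Suc (2 * (i div 2)))))"
  have "(\<lambda>i. tval (mix e (mix c d)) (mix S U) (?\<sigma> i)) = mix e d" for e
    by (rule eq_mixI) (simp_all add: mix_def)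
  then have "P e \<longleftrightarrow> sat (mix e (mix c d)) (mix S U) (sub ?\<sigma> (\<lambda>X. Suc (2 * X)) \<phi>)" for e
    by (simp only: sat_sub \<phi>(2) mix_simps)
  moreover have "range (mix S U) \<subseteq> Sets" using assms(2) \<phi>(3) by (auto simp: mix_def)
  ultimately show ?thesis unfolding defin_def using SigmaB0_sub[OF \<phi>(1)] by blast
qed

lemma term_mixL:
  assumes "term_in c t" shows "term_in (mix c d) t"
proof -
  obtain u where u: "\<And>e S. t e = tval (mix e c) S u" using assms by (auto simp: term_in_def)
  let ?\<sigma> = "\<lambda>i. NVar (if even i then i else Suc (2 * (2 * (i div 2))))"
  have "(\<lambda>i. tval (mix e (mix c d)) S (?\<sigma> i)) = mix e c" for e S
    by (rule eq_mixI) (simp_all add: mix_def)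
  then have "t e = tval (mix e (mix c d)) S (tsub ?\<sigma> id u)" for e S
    by (simp only: tval_tsub id_apply u[of _ S])
  then show ?thesis unfolding term_in_def by blast
qed

lemma term_mixR:
  assumes "term_in d t" shows "term_in (mix c d) t"
proof -
  obtain u where u: "\<And>e S. t e = tval (mix e d) S u" using assms by (auto simp: term_in_def)
  let ?\<sigma> = "\<lambda>i. NVar (if even i then i else Suc (2 * (Suc (2 * (i div 2)))))"
  have "(\<lambda>i. tval (mix e (mix c d)) S (?\<sigma> i)) = mix e d" for e S
    by (rule eq_mixI) (simp_all add: mix_def)
  then have "t e = tval (mix e (mix c d)) S (tsub ?\<sigma> id u)" for e S
    by (simp only: tval_tsub id_apply u[of _ S])
  then show ?thesis unfolding term_in_def by blast
qed

lemma polynomial_var: "polynomial (\<lambda>e. e i)"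
  unfolding polynomial_def term_in_def
  by (rule exI[of _ undefined], rule exI[of _ "NVar (2 * i)"]) simp

lemma polynomial_const: "polynomial (\<lambda>e. a)"
  unfolding polynomial_def term_in_def
  by (rule exI[of _ "\<lambda>_. a"], rule exI[of _ "NVar (Suc (2 * 0))"]) (simp only: tval.simps mix_simps simp_thms)

lemma polynomial_op:
  assumes "polynomial s" "polynomial t"
  shows "\<exists>c u v. \<forall>e S. s e = tval (mix e c) S u \<and> t e = tval (mix e c) S v"
proof -
  obtain c d where "term_in c s" "term_in d t" using assms by (auto simp: polynomial_def)
  then have "term_in (mix c d) s" "term_in (mix c d) t" by (auto intro: term_mixL term_mixR)
  then show ?thesis unfolding term_in_def by blast
qed

lemma polynomial_plus: "polynomial s \<Longrightarrow> polynomial t \<Longrightarrow> polynomial (\<lambda>e. s e + t e)"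
  unfolding polynomial_def[of "\<lambda>e. s e + t e"] term_in_def
  by (drule (1) polynomial_op) (metis tval.simps(4))

lemma polynomial_times: "polynomial s \<Longrightarrow> polynomial t \<Longrightarrow> polynomial (\<lambda>e. s e * t e)"
  unfolding polynomial_def[of "\<lambda>e. s e * t e"] term_in_def
  by (drule (1) polynomial_op) (metis tval.simps(5))

lemma definableI:
  "\<phi> \<in> SigmaB0 \<Longrightarrow> range S \<subseteq> Sets \<Longrightarrow> (\<And>e. P e \<longleftrightarrow> sat (mix e c) S \<phi>) \<Longrightarrow> definable P"
  unfolding definable_def defin_def by blast

lemma definable_atom:
  fixes s t :: "(nat \<Rightarrow> 'a::v0_model) \<Rightarrow> 'a"
  assumes "polynomial s" "polynomial t"
  shows "definable (\<lambda>e. s e = t e)" "definable (\<lambda>e. s e \<le> t e)"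
    and "X \<in> Sets \<Longrightarrow> definable (\<lambda>e. s e \<in> X)"
proof -
  obtain c u v where *: "\<And>e S. s e = tval (mix e c) S u" "\<And>e S. t e = tval (mix e c) S v"
    using polynomial_op[OF assms] by blast
  obtain Y :: "'a set" where Y: "Y \<in> Sets" using Sets_nonempty by blast
  show "definable (\<lambda>e. s e = t e)"
    by (rule definableI[of "u \<^bold>= v" "\<lambda>_. Y" _ c]) (use Y in \<open>auto simp: *[symmetric] intro: SigmaB0.intros\<close>)
  show "definable (\<lambda>e. s e \<le> t e)"
    by (rule definableI[of "u \<^bold>\<le> v" "\<lambda>_. Y" _ c]) (use Y in \<open>auto simp: *[symmetric] intro: SigmaB0.intros\<close>)
  show "definable (\<lambda>e. s e \<in> X)" if "X \<in> Sets"
    by (rule definableI[of "u \<^bold>\<in> 0" "\<lambda>_. X" _ c]) (use that in \<open>auto simp: *[symmetric] intro: SigmaB0.intros\<close>)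
qed

lemma definable_mem: "X \<in> Sets \<Longrightarrow> polynomial s \<Longrightarrow> definable (\<lambda>e. (s e::'a::v0_model) \<in> X)"
  by (rule definable_atom(3))

lemma definable_False: "definable (\<lambda>e::nat \<Rightarrow> 'a::v0_model. False)"
proof -
  obtain Y :: "'a set" where Y: "Y \<in> Sets" using Sets_nonempty by blast
  show ?thesis
    by (rule definableI[of "\<^bold>\<bottom>" "\<lambda>_. Y"]) (use Y in \<open>auto intro: SigmaB0.intros\<close>)
qed

lemma definable_imp:
  fixes P Q :: "(nat \<Rightarrow> 'a::v0_model) \<Rightarrow> bool"
  assumes "definable P" "definable Q"
  shows "definable (\<lambda>e. P e \<longrightarrow> Q e)"
proof -
  obtain c S d U where *: "defin c S P" "defin d U Q" using assms by (auto simp: definable_def)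
  then have "range S \<subseteq> Sets" "range U \<subseteq> Sets" by (auto simp: defin_def)
  with * have "defin (mix c d) (mix S U) P" "defin (mix c d) (mix S U) Q"
    by (blast intro: defin_mixL defin_mixR)+
  then obtain \<phi> \<psi> where "\<phi> \<in> SigmaB0" "\<psi> \<in> SigmaB0" "range (mix S U) \<subseteq> Sets"
    "\<And>e. P e \<longleftrightarrow> sat (mix e (mix c d)) (mix S U) \<phi>"
    "\<And>e. Q e \<longleftrightarrow> sat (mix e (mix c d)) (mix S U) \<psi>"
    unfolding defin_def by blast
  then show ?thesis
    by (intro definableI[of "\<phi> \<^bold>\<longrightarrow> \<psi>" "mix S U" _ "mix c d"]) (auto intro: SigmaB0.intros)
qed

lemma definable_all_poly:
  fixes P :: "'a::v0_model \<Rightarrow> (nat \<Rightarrow> 'a) \<Rightarrow> bool"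
  assumes "polynomial t" "definable (\<lambda>e. P (e 0) (\<lambda>i. e (Suc i)))"
  shows "definable (\<lambda>e. \<forall>x. x \<le> t e \<longrightarrow> P x e)"
proof -
  obtain d c S where d: "term_in d t" and c: "defin c S (\<lambda>e. P (e 0) (\<lambda>i. e (Suc i)))"
    using assms by (auto simp: definable_def polynomial_def)
  from c have S: "range S \<subseteq> Sets" by (simp add: defin_def)
  let ?c = "mix c d" and ?S = "mix S S"
  obtain u where u: "\<And>e S. t e = tval (mix e ?c) S u" using term_mixR[OF d] unfolding term_in_def by blast
  obtain \<phi> where \<phi>: "\<phi> \<in> SigmaB0" "\<And>e. P (e 0) (\<lambda>i. e (Suc i)) \<longleftrightarrow> sat (mix e ?c) ?S \<phi>"
    "range ?S \<subseteq> Sets"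
    using defin_mixL[OF c S, of d] unfolding defin_def by blast
  \<comment> \<open>The quantifier puts \<open>x\<close> in front of the interleaved valuation,
    which swaps the roles of even and odd places behind it. The renaming restores the roles.\<close>
  let ?\<sigma> = "\<lambda>i. NVar (if i = 0 then 0 else if even i then i - 1 else Suc i)"
  have "(\<lambda>i. tval (case_nat x (mix e ?c)) ?S (?\<sigma> i)) = mix (case_nat x e) ?c" for x e
    by (rule eq_mixI) (auto simp: mix_def split: nat.split)
  then have "P x e \<longleftrightarrow> sat (case_nat x (mix e ?c)) ?S (sub ?\<sigma> id \<phi>)" for x e
    using \<phi>(2)[of "case_nat x e"] by (simp add: sat_sub)
  then have "(\<forall>x. x \<le> t e \<longrightarrow> P x e) \<longleftrightarrow> sat (mix e ?c) ?S (AllLe u (sub ?\<sigma> id \<phi>))" for e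
    by (simp add: u[of _ ?S])
  moreover have "AllLe u (sub ?\<sigma> id \<phi>) \<in> SigmaB0"
    by (intro SigmaB0.intros SigmaB0_sub \<phi>(1))
  ultimately show ?thesis unfolding definable_def defin_def using \<phi>(3) by blast
qed

lemma definable_rename:
  assumes "definable P"
  shows "definable (\<lambda>e. P (\<lambda>i. e (r i)))"
proof -
  obtain c S \<phi> where *: "range S \<subseteq> Sets" "\<phi> \<in> SigmaB0" "\<And>e. P e \<longleftrightarrow> sat (mix e c) S \<phi>"
    using assms by (auto simp: definable_def defin_def)
  let ?\<sigma> = "\<lambda>i. NVar (if even i then 2 * r (i div 2) else i)"
  have "(\<lambda>i. tval (mix e c) S (?\<sigma> i)) = mix (\<lambda>i. e (r i)) c" for e
    by (rule eq_mixI) (simp_all add: mix_def)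
  then have "P (\<lambda>i. e (r i)) \<longleftrightarrow> sat (mix e c) S (sub ?\<sigma> id \<phi>)" for e
    by (simp add: sat_sub *(3))
  then show ?thesis unfolding definable_def defin_def using *(1) SigmaB0_sub[OF *(2)] by blast
qed

lemma definable_not:
  fixes P :: "(nat \<Rightarrow> 'a::v0_model) \<Rightarrow> bool"
  shows "definable P \<Longrightarrow> definable (\<lambda>e. \<not> P e)"
  using definable_imp[OF _ definable_False] by simp

lemma definable_or:
  fixes P Q :: "(nat \<Rightarrow> 'a::v0_model) \<Rightarrow> bool"
  shows "definable P \<Longrightarrow> definable Q \<Longrightarrow> definable (\<lambda>e. P e \<or> Q e)"
  using definable_imp[OF definable_not] by (simp add: imp_conv_disj)

lemma definable_and:
  fixes P Q :: "(nat \<Rightarrow> 'a::v0_model) \<Rightarrow> bool"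
  assumes "definable P" "definable Q"
  shows "definable (\<lambda>e. P e \<and> Q e)"
  using definable_not[OF definable_imp[OF assms(1) definable_not[OF assms(2)]]] by simp

lemma definable_iff:
  fixes P Q :: "(nat \<Rightarrow> 'a::v0_model) \<Rightarrow> bool"
  assumes "definable P" "definable Q"
  shows "definable (\<lambda>e. P e \<longleftrightarrow> Q e)"
  using definable_and[OF definable_imp[OF assms] definable_imp[OF assms(2,1)]]
  by (simp add: iff_conv_conj_imp)

lemma definable_ex_poly:
  fixes P :: "'a::v0_model \<Rightarrow> (nat \<Rightarrow> 'a) \<Rightarrow> bool"
  assumes "polynomial t" "definable (\<lambda>e. P (e 0) (\<lambda>i. e (Suc i)))"
  shows "definable (\<lambda>e. \<exists>x. x \<le> t e \<and> P x e)"
  using definable_not[OF definable_all_poly[OF assms(1) definable_not[OF assms(2)]]] by simp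

section \<open>Arithmetic in models of \<open>V\<^sup>0\<close>\<close>

lemma definable_set:
  assumes "definable (\<lambda>e. P (e 0))"
  obtains X :: "'a::v0_model set" where "X \<in> Sets" "len X \<le> b" "\<And>z. z < b \<Longrightarrow> z \<in> X \<longleftrightarrow> P z"
proof -
  obtain c S \<phi> where *: "range S \<subseteq> Sets" "\<phi> \<in> SigmaB0" "\<And>e. P (e 0) \<longleftrightarrow> sat (mix e c) S \<phi>"
    using assms by (auto simp: definable_def defin_def)
  \<comment> \<open>The property reads only argument 0, so all argument variables may be given the
    value \<open>z\<close>; the parameters stay at the odd places.\<close>
  let ?\<sigma> = "\<lambda>i. NVar (if even i then 0 else Suc i)"
  have S: "S i \<in> Sets" for i using *(1) by auto
  obtain X where X: "X \<in> Sets" "len X \<le> b"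
    "\<And>z. z < b \<Longrightarrow> z \<in> X \<longleftrightarrow> sat (case_nat z (mix c c)) S (sub ?\<sigma> id \<phi>)"
    using comprehension[of "sub ?\<sigma> id \<phi>" S b "mix c c"] SigmaB0_sub[OF *(2)] S
    unfolding less_iff by auto
  have "(\<lambda>i. tval (case_nat z (mix c c)) S (?\<sigma> i)) = mix (\<lambda>_. z) c" for z
    by (rule eq_mixI) (simp_all add: mix_def)
  then have "sat (case_nat z (mix c c)) S (sub ?\<sigma> id \<phi>) \<longleftrightarrow> P z" for z
    using *(3)[of "\<lambda>_. z"] by (simp add: sat_sub)
  with X show ?thesis by (intro that[of X]) simp_all
qed

lemma v0_refl: "(x::'a::v0_model) \<le> x"
  using B10[of x x] by simp

lemma v0_less_Suc: "(x::'a::v0_model) < y + 1 \<longleftrightarrow> x \<le> y"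
  by (simp add: less_iff B11[of x y])

text \<open>If \<open>X\<close> is the set of counterexamples and \<open>Y\<close> that of the numbers below all elements of \<open>X\<close>, then
  \<open>|Y|\<close> is the least counterexample.  No arithmetic is available yet at this point.\<close>

lemma definable_induct:
  fixes a :: "'a::v0_model"
  assumes P: "definable (\<lambda>e. P (e 0))" and zero: "P 0" and Suc: "\<And>x. P x \<Longrightarrow> P (x + 1)"
  shows "P a"
proof (rule ccontr)
  assume "\<not> P a"
  obtain X where X: "X \<in> Sets" "len X \<le> a + 1" "\<And>z. z < a + 1 \<Longrightarrow> z \<in> X \<longleftrightarrow> \<not> P z"
    using definable_set[OF definable_not[OF P]] by blast
  have aX: "a \<in> X" using X(3)[of a] \<open>\<not> P a\<close> by (simp add: v0_less_Suc v0_refl)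
  have "definable (\<lambda>e. \<forall>x. x \<le> e 0 \<longrightarrow> x \<notin> X)"
    by (intro definable_all_poly polynomial_var definable_not definable_mem X(1))
  then obtain Y where Y: "Y \<in> Sets" "len Y \<le> len X" "\<And>z. z < len X \<Longrightarrow> z \<in> Y \<longleftrightarrow> (\<forall>x. x \<le> z \<longrightarrow> x \<notin> X)"
    by (rule definable_set[where b = "len X" and P = "\<lambda>z. \<forall>x. x \<le> z \<longrightarrow> x \<notin> X"]) blast
  have below: "x < len X" if "x \<in> X" for x using L1[OF X(1) that] by (simp add: less_iff)
  have X0: "0 \<notin> X" using X(3)[of 0] zero by (simp add: v0_less_Suc B9)
  have X_step: "x + 1 \<notin> X" if *: "\<And>y. y \<le> x \<Longrightarrow> y \<notin> X" for x
  proof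
    assume "x + 1 \<in> X"
    have ax: "\<not> a \<le> x" using aX *[of a] by auto
    then have "x < a + 1" using B10[of a x] v0_less_Suc[of x a] by simp
    then have "P x" using X(3)[of x] *[of x] v0_refl[of x] by simp
    then have "P (x + 1)" by (rule Suc)
    moreover have "x + 1 \<le> a"
    proof (rule ccontr)
      assume 1: "\<not> x + 1 \<le> a"
      then have "a \<le> x + 1" using B10[of a "x + 1"] by simp
      moreover have "a \<noteq> x + 1" using 1 v0_refl[of a] by auto
      ultimately have "a \<le> x" using B11[of a x] by simp
      then show False using ax by contradiction
    qed
    ultimately show False using X(3)[of "x + 1"] \<open>x + 1 \<in> X\<close> v0_less_Suc[of "x + 1" a] by simp
  qed
  have "len X \<noteq> 0" using below[OF aX] B9[of a] B7[of a 0] by (auto simp: less_iff)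
  then have "0 < len X" using B9[of "len X"] by (auto simp: less_iff)
  then have "0 \<in> Y" using Y(3)[of 0] X0 B7[OF _ B9] by auto
  then have "len Y \<noteq> 0" using L1[OF Y(1), of 0] by simp
  then obtain y where y: "y + 1 = len Y" using B12 by blast
  then have "y \<in> Y" by (rule L2[OF Y(1)])
  have nY: "y + 1 \<notin> Y" using L1[OF Y(1), of "y + 1"] y by auto
  have le: "y + 1 \<le> len X" using Y(2) y by simp
  have "y < len X"
  proof (rule ccontr)
    assume "\<not> y < len X"
    then have "len X \<le> y" using B10[of y "len X"] v0_refl[of y] by (auto simp: less_iff)
    then have "len X \<le> y + 1" "len X \<noteq> y + 1" using B11[of "len X" y] by simp_all
    then show False using le B7[of "len X" "y + 1"] by simp
  qed
  then have nX: "\<And>x. x \<le> y \<Longrightarrow> x \<notin> X" using \<open>y \<in> Y\<close> Y(3)[of y] by simp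
  \<comment> \<open>Otherwise \<open>L2\<close> would put \<open>y\<close> itself into
    \<open>X\<close>. So \<open>y + 1\<close> is in the range where \<open>Y\<close> is specified,
    and its absence from \<open>Y\<close> forces \<open>y + 1\<close> into \<open>X\<close>.\<close>
  have "y + 1 \<noteq> len X" using L2[OF X(1), of y] nX[OF v0_refl] by auto
  then have "y + 1 < len X" using le by (simp add: less_iff)
  then obtain x where x: "x \<le> y + 1" "x \<in> X" using nY Y(3)[of "y + 1"] by auto
  then have "x = y + 1" using nX[of x] B11[of x y] by auto
  then show False using X_step[OF nX] x(2) by simp
qed

section \<open>Semiring laws and the order, by induction\<close>

context
begin

private lemmas defs = definable_atom(1) polynomial_var polynomial_const polynomial_plus polynomial_times

lemma v0_add_assoc: "(x + y) + z = x + (y + (z::'a::v0_model))"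
proof (rule definable_induct[where a = z])
  show "definable (\<lambda>e. (x + y) + e 0 = x + (y + e 0))" by (intro defs)
qed (simp_all add: B3 B4)

lemma v0_zero_add: "0 + x = (x::'a::v0_model)"
proof (rule definable_induct[where a = x])
  show "definable (\<lambda>e. 0 + e 0 = (e 0::'a))" by (intro defs)
qed (simp_all add: B3 B4)

lemma v0_one_add: "1 + x = (x::'a::v0_model) + 1"
proof (rule definable_induct[where a = x])
  show "definable (\<lambda>e. 1 + e 0 = (e 0::'a) + 1)" by (intro defs)
qed (simp_all add: B3 B4 v0_zero_add)

lemma v0_add_commute: "x + y = y + (x::'a::v0_model)"
proof (rule definable_induct[where a = y])
  show "definable (\<lambda>e. x + e 0 = e 0 + (x::'a))" by (intro defs)
  show "x + (y + 1) = (y + 1) + x" if "x + y = y + x" for y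
    using that by (metis B4 v0_add_assoc v0_one_add)
qed (simp add: B3 v0_zero_add)

lemma v0_add_cancel:
  assumes "x + z = y + (z::'a::v0_model)" shows "x = y"
proof -
  have "x + z = y + z \<longrightarrow> x = y"
  proof (rule definable_induct[where a = z])
    show "definable (\<lambda>e. x + e 0 = y + e 0 \<longrightarrow> x = y)" by (intro defs definable_imp)
    show "x + (z + 1) = y + (z + 1) \<longrightarrow> x = y" if "x + z = y + z \<longrightarrow> x = y" for z
      using that by (auto simp: B4 dest: B2)
  qed (simp add: B3)
  with assms show ?thesis by simp
qed

lemma v0_distrib: "x * (y + z) = x * y + x * (z::'a::v0_model)"
proof (rule definable_induct[where a = z])
  show "definable (\<lambda>e. x * (y + e 0) = x * y + x * e 0)" by (intro defs)
  show "x * (y + (z + 1)) = x * y + x * (z + 1)" if "x * (y + z) = x * y + x * z" for z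
  proof -
    have "x * (y + (z + 1)) = (x * y + x * z) + x" by (simp only: B4 B6 that)
    then show ?thesis by (simp only: v0_add_assoc B6)
  qed
qed (simp add: B3 B5)

lemma v0_zero_mult: "0 * x = (0::'a::v0_model)"
proof (rule definable_induct[where a = x])
  show "definable (\<lambda>e. 0 * e 0 = (0::'a))" by (intro defs)
qed (simp_all add: B5 B6 B3)

lemma v0_Suc_mult: "(x + 1) * y = x * y + (y::'a::v0_model)"
proof (rule definable_induct[where a = y])
  show "definable (\<lambda>e. (x + 1) * e 0 = x * e 0 + e 0)" by (intro defs)
  show "(x + 1) * (y + 1) = x * (y + 1) + (y + 1)" if "(x + 1) * y = x * y + y" for y
    using that by (metis B6 v0_add_assoc v0_add_commute)
qed (simp add: B3 B5)

lemma v0_mult_commute: "x * y = y * (x::'a::v0_model)"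
proof (rule definable_induct[where a = y])
  show "definable (\<lambda>e. x * e 0 = e 0 * x)" by (intro defs)
qed (simp_all add: B5 B6 v0_zero_mult v0_Suc_mult)

lemma v0_mult_one: "x * 1 = (x::'a::v0_model)"
  using B6[of x 0] by (simp add: B5 v0_zero_add)

lemma v0_mult_assoc: "(x * y) * z = x * (y * (z::'a::v0_model))"
proof (rule definable_induct[where a = z])
  show "definable (\<lambda>e. (x * y) * e 0 = x * (y * e 0))" by (intro defs)
  show "(x * y) * (z + 1) = x * (y * (z + 1))" if "(x * y) * z = x * (y * z)" for z
    using that by (simp only: B6 v0_distrib v0_mult_one)
qed (simp add: B5)

text \<open>The witness is bounded by \<open>y\<close>, so the claim is a bounded formula and
  induction on \<open>y\<close> applies; \<open>B11\<close> splits the case of a successor.\<close>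

lemma v0_le_iff: "x \<le> y \<longleftrightarrow> (\<exists>z. x + z = (y::'a::v0_model))"
proof
  have "x \<le> y \<longrightarrow> (\<exists>z. z \<le> y \<and> x + z = y)"
  proof (rule definable_induct[where a = y])
    show "definable (\<lambda>e. x \<le> e 0 \<longrightarrow> (\<exists>z. z \<le> e 0 \<and> x + z = e 0))"
      by (intro defs definable_atom definable_imp definable_ex_poly)
    show "x \<le> 0 \<longrightarrow> (\<exists>z. z \<le> 0 \<and> x + z = 0)" by (metis B3 B7 B9)
    show "x \<le> y + 1 \<longrightarrow> (\<exists>z. z \<le> y + 1 \<and> x + z = y + 1)"
      if IH: "x \<le> y \<longrightarrow> (\<exists>z. z \<le> y \<and> x + z = y)" for y
    proof
      assume "x \<le> y + 1"
      show "\<exists>z. z \<le> y + 1 \<and> x + z = y + 1"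
      proof (cases "x = y + 1")
        case False
        then obtain z where "x + z = y" using IH B11 \<open>x \<le> y + 1\<close> by blast
        then have "x + (z + 1) = y + 1" by (simp add: B4)
        then show ?thesis by (metis B8 v0_add_commute)
      qed (use B3 B9 in blast)
    qed
  qed
  then show "x \<le> y \<Longrightarrow> \<exists>z. x + z = y" by blast
qed (use B8 in blast)

end

text \<open>The laws of truncated subtraction are reduced to sums: where the difference is proper,
  it is the unique summand, and elsewhere it is 0.\<close>

instance v0_model \<subseteq> linordered_semidom
proof
  fix a b c :: 'a
  show "a + b + c = a + (b + c)" by (rule v0_add_assoc)
  show "a + b = b + a" by (rule v0_add_commute)
  show "0 + a = a" by (rule v0_zero_add)
  show "a * b * c = a * (b * c)" by (rule v0_mult_assoc)
  show "a * b = b * a" by (rule v0_mult_commute)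
  show "1 * a = a" using v0_Suc_mult[of 0 a] by (simp add: v0_zero_add v0_zero_mult)
  show "(a + b) * c = a * c + b * c" by (metis v0_distrib v0_mult_commute)
  show "a * (b + c) = a * b + a * c" by (rule v0_distrib)
  show "0 * a = 0" by (rule v0_zero_mult)
  show "a * 0 = 0" by (rule B5)
  show "(0::'a) \<noteq> 1" using B1[of 0] by (metis v0_zero_add)
  have trans: "x \<le> z" if "x \<le> y" "y \<le> z" for x y z :: 'a
    using that unfolding v0_le_iff by (metis v0_add_assoc)
  then show "a \<le> b \<Longrightarrow> b \<le> c \<Longrightarrow> a \<le> c" .
  show "a \<le> a" by (rule v0_refl)
  show anti: "a \<le> b \<Longrightarrow> b \<le> a \<Longrightarrow> a = b" by (rule B7)
  show "(a < b) = (a \<le> b \<and> \<not> b \<le> a)" using B7 v0_refl by (auto simp: less_iff)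
  show "a \<le> b \<or> b \<le> a" by (rule B10)
  show "a \<le> b \<Longrightarrow> c + a \<le> c + b" unfolding v0_le_iff by (metis v0_add_assoc)
  show "(0::'a) < 1" using B9 B1[of 0] by (metis less_iff v0_zero_add)
  have diff: "x + z = y \<Longrightarrow> y - x = z" for x y z :: 'a
  proof -
    assume *: "x + z = y"
    have "(THE w. x + w = y) = z"
      using * by (intro the_equality) (auto intro: v0_add_cancel[of _ x] simp: v0_add_commute[of _ x])
    then show ?thesis using * by (simp add: minus_eq) (metis B8 *)
  qed
  have diff0: "y - x = 0" if "\<not> x \<le> y" for x y :: 'a using that by (simp add: minus_eq)
  show "a + b - a = b" by (rule diff) simp
  show "b \<le> a \<Longrightarrow> a - b + b = a" unfolding v0_le_iff by (metis diff v0_add_commute)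
  show "a - b - c = a - (b + c)"
  proof (cases "b + c \<le> a")
    case True
    then show ?thesis unfolding v0_le_iff by (metis diff v0_add_assoc)
  next
    case False
    show ?thesis
    proof (cases "b \<le> a")
      case True
      then obtain d where d: "b + d = a" unfolding v0_le_iff by blast
      have "\<not> c \<le> d" using False d unfolding v0_le_iff by (metis v0_add_assoc)
      then show ?thesis using diff[OF d] False by (simp add: diff0)
    next
      case F: False
      have "0 - c = (0::'a)"
        by (cases "c = 0") (metis diff v0_zero_add, metis B7 B9 diff0)
      then show ?thesis using F False by (simp add: diff0)
    qed
  qed
  show "a \<noteq> 0 \<Longrightarrow> b \<noteq> 0 \<Longrightarrow> a * b \<noteq> 0" by (metis B1 B4 B6 B12)
  show "a * (b - c) = a * b - a * c" 
  proof (cases "c \<le> b")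
    case True
    then show ?thesis unfolding v0_le_iff by (metis diff v0_distrib)
  next
    case False
    then obtain d where "b + d = c" using B10 unfolding v0_le_iff by blast
    then have *: "a * b + a * d = a * c" by (metis v0_distrib)
    then have "a * b \<le> a * c" unfolding v0_le_iff by blast
    then have "a * b - a * c = 0" by (metis B3 B7 diff diff0)
    then show ?thesis using False by (simp add: diff0 B5)
  qed
  show "a < b \<Longrightarrow> 0 < c \<Longrightarrow> c * a < c * b"
  proof -
    assume "a < b" "0 < c"
    then obtain d where d: "a + d = b" "d \<noteq> 0" unfolding less_iff v0_le_iff by (metis B3)
    have "c * d \<noteq> 0" using d \<open>0 < c\<close> by (metis B1 B4 B6 B12 less_iff)
    moreover have "c * a + c * d = c * b" using d by (metis v0_distrib)
    ultimately show ?thesis unfolding less_iff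
      by (metis B3 B8 v0_add_cancel v0_add_commute)
  qed
qed

lemma v0_Suc_le: "(x::'a::v0_model) + 1 \<le> y \<longleftrightarrow> x < y"
  by (metis not_le v0_less_Suc)

lemma v0_not_less_0: "\<not> (x::'a::v0_model) < 0"
  using B9 by (simp add: not_less)

lemma v0_pred: "(x::'a::v0_model) < y \<Longrightarrow> \<exists>z. z + 1 = y"
  using B12 v0_not_less_0 by metis

section \<open>Definable functions\<close>

text \<open>The functions that may be substituted into bounded formulas although the language has no
  symbols for them: a quantifier over the value, bounded by the polynomial, eliminates the function
  in favour of its graph.\<close>

definition fdef :: "((nat \<Rightarrow> 'a::v0_model) \<Rightarrow> 'a) \<Rightarrow> bool" where
  "fdef t \<longleftrightarrow> (\<exists>b. polynomial b \<and> (\<forall>e. t e \<le> b e)) \<and> definable (\<lambda>e. e 0 = t (\<lambda>i. e (Suc i)))"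

text \<open>Coordinates of paths as functions of time. A constant bound on the values makes any
  composite bounded, without monotonicity.\<close>

definition dfun :: "('a::v0_model \<Rightarrow> 'a) \<Rightarrow> bool" where
  "dfun f \<longleftrightarrow> (\<exists>c. \<forall>x. f x \<le> c) \<and> definable (\<lambda>e. e 0 = f (e 1))"

lemma definable_subst:
  fixes P :: "'a::v0_model \<Rightarrow> (nat \<Rightarrow> 'a) \<Rightarrow> bool"
  assumes "fdef t" "definable (\<lambda>e. P (e 0) (\<lambda>i. e (Suc i)))"
  shows "definable (\<lambda>e. P (t e) e)"
proof -
  obtain b where b: "polynomial b" "\<And>e. t e \<le> b e" using assms(1) by (auto simp: fdef_def)
  have "definable (\<lambda>e. \<exists>x. x \<le> b e \<and> (x = t e \<and> P x e))"
    using assms by (intro definable_ex_poly b definable_and) (simp_all add: fdef_def)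
  moreover have "(\<exists>x. x \<le> b e \<and> (x = t e \<and> P x e)) \<longleftrightarrow> P (t e) e" for e using b(2) by auto
  ultimately show ?thesis by simp
qed

lemma polynomial_rename: "polynomial t \<Longrightarrow> polynomial (\<lambda>e. t (\<lambda>i. e (r i)))"
proof -
  assume "polynomial t"
  then obtain c u where u: "\<And>e S. t e = tval (mix e c) S u" by (auto simp: polynomial_def term_in_def)
  let ?\<sigma> = "\<lambda>i. NVar (if even i then 2 * r (i div 2) else i)"
  have "(\<lambda>i. tval (mix e c) S (?\<sigma> i)) = mix (\<lambda>i. e (r i)) c" for e S
    by (rule eq_mixI) (simp_all add: mix_def)
  then have "t (\<lambda>i. e (r i)) = tval (mix e c) S (tsub ?\<sigma> id u)" for e S
    by (simp add: tval_tsub u[of _ S])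
  then show ?thesis unfolding polynomial_def term_in_def by blast
qed

lemma fdef_rename: "fdef t \<Longrightarrow> fdef (\<lambda>e. t (\<lambda>i. e (r i)))"
proof -
  assume t: "fdef t"
  then obtain b where b: "polynomial b" "\<And>e. t e \<le> b e" by (auto simp: fdef_def)
  have "definable (\<lambda>e. e 0 = t (\<lambda>i. e (Suc i)))" using t by (simp add: fdef_def)
  from definable_rename[OF this, of "case_nat 0 (\<lambda>i. Suc (r i))"]
  have "definable (\<lambda>e. e 0 = t (\<lambda>i. e (Suc (r i))))" by simp
  with b polynomial_rename[OF b(1), of r] show ?thesis unfolding fdef_def by fast
qed

lemma definable_rel:
  assumes "definable (\<lambda>e. R (e 0) (e 1))" "fdef s" "fdef t"
  shows "definable (\<lambda>e. R (s e) (t e))"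
proof (rule definable_subst[OF assms(2)])
  show "definable (\<lambda>e. R (e 0) (t (\<lambda>i. e (Suc i))))"
  proof (rule definable_subst[OF fdef_rename[OF assms(3), of Suc]])
    show "definable (\<lambda>e. R (e (Suc 0)) (e 0))"
      using definable_rename[OF assms(1), of "\<lambda>i. if i = 0 then Suc 0 else 0"] by simp
  qed
qed

lemma definable_rel3:
  assumes "definable (\<lambda>e. R (e 0) (e 1) (e 2))" "fdef s" "fdef t" "fdef u"
  shows "definable (\<lambda>e. R (s e) (t e) (u e))"
proof (rule definable_subst[OF assms(2)])
  show "definable (\<lambda>e. R (e 0) (t (\<lambda>i. e (Suc i))) (u (\<lambda>i. e (Suc i))))"
  proof (rule definable_subst[OF fdef_rename[OF assms(3), of Suc]])
    show "definable (\<lambda>e. R (e (Suc 0)) (e 0) (u (\<lambda>i. e (Suc (Suc i)))))"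
    proof (rule definable_subst[OF fdef_rename[OF assms(4), of "\<lambda>i. Suc (Suc i)"]])
      show "definable (\<lambda>e. R (e (Suc (Suc 0))) (e (Suc 0)) (e 0))"
        using definable_rename[OF assms(1), of "\<lambda>i. if i = 0 then Suc (Suc 0) else if i = 1 then Suc 0 else 0"]
        by simp
    qed
  qed
qed

context
begin

private lemmas base = definable_atom(1,2) polynomial_var polynomial_const polynomial_plus

lemma definable_eq: "fdef s \<Longrightarrow> fdef t \<Longrightarrow> definable (\<lambda>e. s e = t e)"
  by (rule definable_rel[where R = "(=)"]) (intro base)

lemma definable_le: "fdef s \<Longrightarrow> fdef t \<Longrightarrow> definable (\<lambda>e. s e \<le> t e)"
  by (rule definable_rel[where R = "(\<le>)"]) (intro base)

lemma definable_less: "fdef s \<Longrightarrow> fdef t \<Longrightarrow> definable (\<lambda>e. s e < t e)"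
  using definable_not[OF definable_le, of t s] by (simp add: not_le)

lemma fdef_poly: "polynomial t \<Longrightarrow> fdef t"
  unfolding fdef_def using definable_atom(1)[OF polynomial_var polynomial_rename] by fast

lemma fdef_var: "fdef (\<lambda>e. e i)"
  by (intro fdef_poly base)

lemma fdef_const: "fdef (\<lambda>e. a)"
  by (intro fdef_poly base)

lemma fdef_binop:
  fixes s t :: "(nat \<Rightarrow> 'a::v0_model) \<Rightarrow> 'a"
  assumes "definable (\<lambda>e. e 0 = f (e 1) (e 2))" "\<And>x y. f x y \<le> x + y" "fdef s" "fdef t"
  shows "fdef (\<lambda>e. f (s e) (t e))"
proof -
  obtain b c where bc: "polynomial b" "\<And>e. s e \<le> b e" "polynomial c" "\<And>e. t e \<le> c e"
    using assms(3,4) by (auto simp: fdef_def)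
  have "f (s e) (t e) \<le> b e + c e" for e
    using assms(2) add_mono[OF bc(2,4)] order_trans by blast
  moreover have "polynomial (\<lambda>e. b e + c e)" by (intro polynomial_plus bc)
  moreover have "definable (\<lambda>e. e 0 = f (s (\<lambda>i. e (Suc i))) (t (\<lambda>i. e (Suc i))))"
    by (rule definable_rel3[OF assms(1) fdef_var fdef_rename fdef_rename]) (rule assms)+
  ultimately show ?thesis unfolding fdef_def by fast
qed

lemma fdef_plus: "fdef s \<Longrightarrow> fdef t \<Longrightarrow> fdef (\<lambda>e. s e + t e)"
  by (rule fdef_binop[where f = "(+)"]) (intro base, simp_all)

lemma fdef_minus:
  assumes "fdef s" "fdef t" shows "fdef (\<lambda>e. (s e::'a::v0_model) - t e)"
proof (rule fdef_binop[OF _ _ assms])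
  have "z = x - y \<longleftrightarrow> y + z = x \<or> (x \<le> y \<and> z = 0)" for x y z :: 'a
  proof (cases "y \<le> x")
    case True
    then obtain d where "x = y + d" using v0_le_iff by metis
    then show ?thesis using B7[of d 0] B9[of d] by auto
  next
    case False
    then have "x - y = 0" by (simp add: minus_eq)
    moreover have "y + z \<noteq> x" using False B8[of y z] by auto
    ultimately show ?thesis using False by auto
  qed
  then show "definable (\<lambda>e. e 0 = e 1 - (e 2::'a))"
    by (simp only:) (intro definable_atom(1,2) base definable_or definable_and)
  show "x - y \<le> x + y" for x y :: 'a
  proof (cases "y \<le> x")
    case True
    then have "x = y + (x - y)" by (metis add.commute le_add_diff_inverse2)
    then have "x - y \<le> x" by (metis B8 add.commute)
    then show ?thesis using B8 order_trans by blast
  qed (simp add: minus_eq B9)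
qed

lemma fdef_if:
  fixes s t :: "(nat \<Rightarrow> 'a::v0_model) \<Rightarrow> 'a"
  assumes "definable P" "fdef s" "fdef t"
  shows "fdef (\<lambda>e. if P e then s e else t e)"
proof -
  obtain b c where bc: "polynomial b" "\<And>e. s e \<le> b e" "polynomial c" "\<And>e. t e \<le> c e"
    using assms(2,3) by (auto simp: fdef_def)
  \<comment> \<open>The sum replaces the maximum as a bound because it is again a
    polynomial.\<close>
  have "(if P e then s e else t e) \<le> b e + c e" for e
    using bc(2,4) B9 by (auto intro: add_increasing add_increasing2)
  moreover have "polynomial (\<lambda>e. b e + c e)" by (intro polynomial_plus bc)
  moreover have "definable (\<lambda>e. (P (\<lambda>i. e (Suc i)) \<and> e 0 = s (\<lambda>i. e (Suc i)))
      \<or> (\<not> P (\<lambda>i. e (Suc i)) \<and> e 0 = t (\<lambda>i. e (Suc i))))"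
    using definable_rename[OF assms(1), of Suc] assms(2,3)
    by (intro definable_or definable_and definable_not) (simp_all add: fdef_def)
  then have "definable (\<lambda>e. e 0 = (if P (\<lambda>i. e (Suc i)) then s (\<lambda>i. e (Suc i)) else t (\<lambda>i. e (Suc i))))"
    by (rule back_subst[of definable]) (auto simp: fun_eq_iff)
  ultimately show ?thesis unfolding fdef_def by fast
qed

lemma fdef_app:
  assumes "dfun f" "fdef t"
  shows "fdef (\<lambda>e. f (t e))"
proof -
  obtain c where c: "\<And>x. f x \<le> c" using assms(1) by (auto simp: dfun_def)
  have "definable (\<lambda>e. e 0 = f (t (\<lambda>i. e (Suc i))))"
    by (rule definable_rel[OF _ fdef_var fdef_rename[OF assms(2)], of "\<lambda>x y. x = f y"])
      (use assms(1) in \<open>simp add: dfun_def\<close>)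
  then show ?thesis using c polynomial_const[of c] unfolding fdef_def by fast
qed

end

lemma dfunI: "(\<And>x. f x \<le> c) \<Longrightarrow> fdef (\<lambda>e. f (e 0)) \<Longrightarrow> dfun f"
  by (auto simp: fdef_def dfun_def)

lemma definable_all:
  fixes P :: "'a::v0_model \<Rightarrow> (nat \<Rightarrow> 'a) \<Rightarrow> bool"
  assumes "fdef t" "definable (\<lambda>e. P (e 0) (\<lambda>i. e (Suc i)))"
  shows "definable (\<lambda>e. \<forall>x. x \<le> t e \<longrightarrow> P x e)" "definable (\<lambda>e. \<forall>x. x < t e \<longrightarrow> P x e)"
proof -
  obtain b where b: "polynomial b" "\<And>e. t e \<le> b e" using assms(1) by (auto simp: fdef_def)
  have "definable (\<lambda>e. \<forall>x. x \<le> b e \<longrightarrow> x \<le> t e \<longrightarrow> P x e)" "definable (\<lambda>e. \<forall>x. x \<le> b e \<longrightarrow> x < t e \<longrightarrow> P x e)"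
    by (intro definable_all_poly b definable_imp assms definable_le definable_less fdef_var
        fdef_rename[OF assms(1)])+
  moreover have "(\<forall>x. x \<le> b e \<longrightarrow> x \<le> t e \<longrightarrow> P x e) \<longleftrightarrow> (\<forall>x. x \<le> t e \<longrightarrow> P x e)"
    "(\<forall>x. x \<le> b e \<longrightarrow> x < t e \<longrightarrow> P x e) \<longleftrightarrow> (\<forall>x. x < t e \<longrightarrow> P x e)" for e
    using b(2)[of e] by (meson order_trans less_imp_le)+
  ultimately show "definable (\<lambda>e. \<forall>x. x \<le> t e \<longrightarrow> P x e)" "definable (\<lambda>e. \<forall>x. x < t e \<longrightarrow> P x e)"
    by simp_all
qed

lemma definable_ex:
  fixes P :: "'a::v0_model \<Rightarrow> (nat \<Rightarrow> 'a) \<Rightarrow> bool"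
  assumes "fdef t" "definable (\<lambda>e. P (e 0) (\<lambda>i. e (Suc i)))"
  shows "definable (\<lambda>e. \<exists>x. x \<le> t e \<and> P x e)" "definable (\<lambda>e. \<exists>x. x < t e \<and> P x e)"
  using definable_not[OF definable_all(1)[OF assms(1) definable_not[OF assms(2)]]]
    definable_not[OF definable_all(2)[OF assms(1) definable_not[OF assms(2)]]] by simp_all

lemmas definable_intros = definable_eq definable_le definable_less definable_not definable_and
  definable_or definable_imp definable_iff definable_all definable_ex
  fdef_var fdef_const fdef_plus fdef_minus fdef_if

section \<open>Strong induction, least and greatest elements\<close>

lemma definable_less_induct:
  fixes a :: "'a::v0_model"
  assumes P: "definable (\<lambda>e. P (e 0))" and step: "\<And>x. (\<And>y. y < x \<Longrightarrow> P y) \<Longrightarrow> P x"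
  shows "P a"
proof -
  have "\<forall>y. y < a \<longrightarrow> P y"
  proof (rule definable_induct[where a = a])
    show "definable (\<lambda>e. \<forall>y. y < e 0 \<longrightarrow> P y)" by (intro definable_intros P)
    show "\<forall>y. y < x + 1 \<longrightarrow> P y" if "\<forall>y. y < x \<longrightarrow> P y" for x
      using that step by (metis le_less v0_less_Suc)
  qed (simp add: v0_not_less_0)
  then show ?thesis using step by blast
qed

lemma definable_least:
  fixes a :: "'a::v0_model"
  assumes "definable (\<lambda>e. P (e 0))" "P a"
  obtains m where "P m" "m \<le> a" "\<And>y. y < m \<Longrightarrow> \<not> P y"
  using definable_less_induct[OF definable_not[OF assms(1)]] assms(2) not_less by metis

text \<open>The least upper bound of the solutions up to \<open>b\<close> is itself a solution,
  because its predecessor is not an upper bound.\<close>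

lemma definable_greatest:
  fixes a :: "'a::v0_model"
  assumes P: "definable (\<lambda>e. P (e 0))" and a: "P a" "a \<le> b"
  obtains m where "P m" "a \<le> m" "m \<le> b" "\<And>y. m < y \<Longrightarrow> y \<le> b \<Longrightarrow> \<not> P y"
proof -
  have "definable (\<lambda>e. \<forall>y. y \<le> b \<longrightarrow> P y \<longrightarrow> y \<le> e 0)"
    by (intro definable_intros P)
  then obtain m where m: "\<And>y. y \<le> b \<Longrightarrow> P y \<Longrightarrow> y \<le> m" "m \<le> b"
    "\<And>z. z < m \<Longrightarrow> \<exists>y\<le>b. P y \<and> \<not> y \<le> z"
    by (rule definable_least[where P = "\<lambda>m. \<forall>y. y \<le> b \<longrightarrow> P y \<longrightarrow> y \<le> m"]) auto
  have "P m"
  proof (cases "m = 0")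
    case True
    then show ?thesis using m(1)[OF a(2,1)] a(1) by (metis B7 B9)
  next
    case False
    then obtain z where "z + 1 = m" using B12 by blast
    then obtain y where "y \<le> b" "P y" "\<not> y \<le> z" using m(3)[of z] v0_less_Suc by blast
    then show ?thesis using m(1)[of y] \<open>z + 1 = m\<close> v0_less_Suc by (metis le_less)
  qed
  with m a show ?thesis by (intro that[of m]) force+
qed

section \<open>The parity of crossings of two paths\<close>

definition adj :: "'a::v0_model \<Rightarrow> 'a \<Rightarrow> 'a \<Rightarrow> 'a \<Rightarrow> bool" where
  "adj x y x' y' \<longleftrightarrow> (x = x' \<and> (y = y' + 1 \<or> y' = y + 1)) \<or> (y = y' \<and> (x = x' + 1 \<or> x' = x + 1))"

lemma adj_sym: "adj x y x' y' \<Longrightarrow> adj x' y' x y"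
  by (auto simp: adj_def)

lemma less_add_one: "(x::'a::v0_model) < x + 1"
  by (simp add: v0_less_Suc)

lemma adj_left: "adj x y x' y' \<Longrightarrow> x' < x \<Longrightarrow> x = x' + 1 \<and> y = y'"
  using less_add_one[of x] by (auto simp: adj_def)

lemma adj_vertical: "adj m y m y' \<Longrightarrow> y = y' + 1 \<or> y' = y + 1"
  by (auto simp: adj_def)

text \<open>Here \<open>f\<close> is the \<open>x\<close>-coordinate of a path as a function of time, so \<open>m\<close> is a column.\<close>

definition arc :: "('a::v0_model \<Rightarrow> 'a) \<Rightarrow> 'a \<Rightarrow> 'a \<Rightarrow> 'a \<Rightarrow> bool" where
  "arc f m i j \<longleftrightarrow> i \<le> j \<and> f i = m \<and> f j = m \<and> (\<forall>u. u \<le> j \<longrightarrow> i \<le> u \<longrightarrow> f u \<le> m)"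

text \<open>The piece of an arc between two consecutive visits to its column. With
  \<open>j = i + 1\<close> there is no interior, and the piece is a single step on the
  column.\<close>

definition leap :: "('a::v0_model \<Rightarrow> 'a) \<Rightarrow> 'a \<Rightarrow> 'a \<Rightarrow> 'a \<Rightarrow> bool" where
  "leap f m i j \<longleftrightarrow> i < j \<and> f i = m \<and> f j = m \<and> (\<forall>u. i < u \<longrightarrow> u < j \<longrightarrow> f u < m)"

lemma definable_arc:
  assumes "dfun f" "fdef m" "fdef i" "fdef j"
  shows "definable (\<lambda>e. arc f (m e) (i e) (j e))"
  unfolding arc_def
  by (intro definable_intros fdef_app[OF assms(1)] assms fdef_rename[OF assms(2)] fdef_rename[OF assms(3)])

text \<open>The cut is made at the last visit to column \<open>m\<close> before time
  \<open>j\<close>, which exists because visits are definable.\<close>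

lemma arc_last_leap:
  assumes "dfun f" "arc f m i j" "i < j"
  obtains k where "i \<le> k" "k < j" "arc f m i k" "leap f m k j"
proof -
  obtain j' where j': "j' + 1 = j" using v0_pred[OF assms(3)] by blast
  then have "i \<le> j'" using assms(3) v0_less_Suc by blast
  obtain k where k: "f k = m" "i \<le> k" "k \<le> j'" "\<And>u. k < u \<Longrightarrow> u \<le> j' \<Longrightarrow> f u \<noteq> m"
  proof (rule definable_greatest[of "\<lambda>u. f u = m" i j'])
    show "definable (\<lambda>e. f (e 0) = m)" by (intro definable_intros fdef_app[OF assms(1)])
  qed (use assms(2) \<open>i \<le> j'\<close> in \<open>auto simp: arc_def\<close>)
  have "k < j" using k(3) j' v0_less_Suc by blast
  moreover have "arc f m i k" using k assms(2) \<open>k < j\<close> unfolding arc_def by (meson less_imp_le order_trans)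
  moreover have "f u < m" if "k < u" "u < j" for u
  proof -
    have "u \<le> j'" using that j' v0_less_Suc by blast
    then have "f u \<noteq> m" using k that by blast
    moreover have "f u \<le> m" using assms(2) that k(2) unfolding arc_def by (meson less_imp_le order_trans)
    ultimately show ?thesis by simp
  qed
  then have "leap f m k j" using \<open>k < j\<close> k(1) assms(2) by (simp add: leap_def arc_def)
  ultimately show ?thesis using k(2) that by blast
qed

text \<open>A longer leap leaves and re-enters column \<open>m\<close> horizontally, so removing its
  first and last step gives an arc one column further left with the same heights at its ends. Only
  these two steps are assumed to be grid steps; the interior may contain the hop.\<close>

lemma leap_cases:
  assumes "leap f m i j" and "adj (f i) (g i) (f (i + 1)) (g (i + 1))"
    and "\<forall>j'. j' + 1 = j \<longrightarrow> adj (f j') (g j') (f j) (g j)"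
  obtains (unit) "j = i + 1" "g i = g j + 1 \<or> g j = g i + 1"
  | (excursion) m' j' where "m' + 1 = m" "j' + 1 = j" "i + 1 \<le> j'" "arc f m' (i + 1) j'"
      "g (i + 1) = g i" "g j' = g j"
proof (cases "j = i + 1")
  case True
  then show ?thesis using unit assms(1,2) adj_vertical by (metis leap_def)
next
  case False
  have ij: "i < j" "f i = m" "f j = m" and inner: "\<And>u. i < u \<Longrightarrow> u < j \<Longrightarrow> f u < m"
    using assms(1) by (auto simp: leap_def)
  obtain j' where j': "j' + 1 = j" using v0_pred[OF ij(1)] by blast
  have "i + 1 < j" using False ij(1) v0_Suc_le[of i j] by simp
  then have le: "i + 1 \<le> j'" using j' v0_less_Suc by blast
  have "f (i + 1) < m" by (rule inner[OF less_add_one \<open>i + 1 < j\<close>])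
  with assms(2) ij(2) have 1: "m = f (i + 1) + 1" "g i = g (i + 1)" using adj_left by metis+
  have "i < j'" using le v0_Suc_le by blast
  moreover have "j' < j" using j' less_add_one by metis
  ultimately have "f j' < m" by (rule inner)
  with adj_sym[OF assms(3)[rule_format, OF j']] ij(3) have 2: "m = f j' + 1" "g j = g j'" using adj_left by metis+
  have "arc f (f (i + 1)) (i + 1) j'"
    unfolding arc_def
  proof (intro conjI allI impI le)
    show "f j' = f (i + 1)" using 1 2 by simp
    fix u assume "u \<le> j'" "i + 1 \<le> u"
    then have "f u < m" using inner[of u] \<open>j' < j\<close> v0_Suc_le by force
    then show "f u \<le> f (i + 1)" using 1(1) v0_less_Suc by blast
  qed simp
  then show ?thesis using excursion[of "f (i + 1)" j'] 1 2 j' le by simp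
qed

text \<open>Two disjoint grid paths \<open>P\<close> and \<open>Q\<close>, except that step \<open>h\<close> of \<open>Q\<close> is a vertical hop over
  \<open>(x, y)\<close>.  It is thought of as passing just to the left of \<open>(x, y)\<close>, hence crossing step \<open>g\<close> of
  \<open>P\<close>, which joins \<open>(x, y)\<close> to its left neighbour.  With \<open>h = S\<close> there is no hop.\<close>

locale two_paths =
  fixes px py qx qy :: "'a::v0_model \<Rightarrow> 'a" and T S g h x y :: 'a
  assumes dfuns: "dfun px" "dfun py" "dfun qx" "dfun qy"
    and stepP: "i < T \<Longrightarrow> adj (px i) (py i) (px (i + 1)) (py (i + 1))"
    and stepQ: "k < S \<Longrightarrow> k \<noteq> h \<Longrightarrow> adj (qx k) (qy k) (qx (k + 1)) (qy (k + 1))"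
    and disjoint: "i \<le> T \<Longrightarrow> k \<le> S \<Longrightarrow> px i = qx k \<Longrightarrow> py i \<noteq> qy k"
    and hop: "h < S \<Longrightarrow> qx h = x \<and> qx (h + 1) = x
      \<and> (y = qy h + 1 \<and> qy (h + 1) = y + 1 \<or> y = qy (h + 1) + 1 \<and> qy h = y + 1)"
    and left_edge: "h < S \<Longrightarrow> u < T \<Longrightarrow> u = g \<longleftrightarrow> px u = x \<and> py u = y \<and> px (u + 1) + 1 = x
      \<or> px (u + 1) = x \<and> py (u + 1) = y \<and> px u + 1 = x"
    and unique: "h < S \<Longrightarrow> u \<le> T \<Longrightarrow> v \<le> T \<Longrightarrow> px u = x \<Longrightarrow> py u = y \<Longrightarrow> px v = x \<Longrightarrow> py v = y \<Longrightarrow> u = v"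
begin

text \<open>The four ends are meant to lie on one column.  Being a parity, this is additive under
  concatenation of arcs, and so is \<open>crossed\<close> below.\<close>

definition interleave :: "'a \<Rightarrow> 'a \<Rightarrow> 'a \<Rightarrow> 'a \<Rightarrow> bool" where
  "interleave i j k l \<longleftrightarrow> ((py i < qy k) \<noteq> (py j < qy k)) \<noteq> ((py i < qy l) \<noteq> (py j < qy l))"

definition crossed :: "'a \<Rightarrow> 'a \<Rightarrow> 'a \<Rightarrow> 'a \<Rightarrow> bool" where
  "crossed i j k l \<longleftrightarrow> (i \<le> g \<and> g < j) \<and> (k \<le> h \<and> h < l)"

text \<open>The order is discrete, so a unit step cannot pass a height without meeting it.\<close>

lemma unit_same_side:
  assumes "(b::'a) = a + 1 \<or> a = b + 1" "c \<noteq> a" "c \<noteq> b"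
  shows "a < c \<longleftrightarrow> b < c" "c < a \<longleftrightarrow> c < b"
proof -
  have "a < c \<longleftrightarrow> a + 1 < c" if "c \<noteq> a + 1" for a c :: 'a
    using that v0_Suc_le[of a c] by (metis le_less less_add_one less_trans)
  then show "a < c \<longleftrightarrow> b < c" using assms by metis
  have "c < a \<longleftrightarrow> c < a + 1" if "c \<noteq> a" for a c :: 'a
    using that v0_less_Suc[of c a] by (simp add: le_less)
  then show "c < a \<longleftrightarrow> c < b" using assms by metis
qed

lemma crossedD:
  assumes "crossed i j k l" "j \<le> T" "l \<le> S"
  shows "h < S" "g < T" "px g = x \<and> py g = y \<and> px (g + 1) + 1 = x
      \<or> px (g + 1) = x \<and> py (g + 1) = y \<and> px g + 1 = x"
proof -
  show 1: "h < S" "g < T" using assms by (auto simp: crossed_def)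
  show "px g = x \<and> py g = y \<and> px (g + 1) + 1 = x \<or> px (g + 1) = x \<and> py (g + 1) = y \<and> px g + 1 = x"
    using left_edge[OF 1] by simp
qed

text \<open>A vertical unit step separates no two heights that avoid its ends, and disjointness
  makes them avoid it. If both leaps are excursions, removing their first and last steps leads to a
  smaller column. There remains the leap of \<open>Q\<close> that is the hop itself, whose ends
  enclose the height \<open>y\<close> alone.\<close>

lemma leap_leap:
  assumes P: "leap px m i j" "j \<le> T" and Q: "leap qx m k l" "l \<le> S"
    and IH: "\<And>m' i j k l. m' < m \<Longrightarrow> arc px m' i j \<Longrightarrow> j \<le> T \<Longrightarrow> arc qx m' k l \<Longrightarrow> l \<le> S
      \<Longrightarrow> interleave i j k l \<longleftrightarrow> crossed i j k l"
  shows "interleave i j k l \<longleftrightarrow> crossed i j k l"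
proof -
  have ij: "i < j" "px i = m" "px j = m" and innerP: "\<And>u. i < u \<Longrightarrow> u < j \<Longrightarrow> px u < m"
    using P(1) by (auto simp: leap_def)
  have kl: "k < l" "qx k = m" "qx l = m" and innerQ: "\<And>u. k < u \<Longrightarrow> u < l \<Longrightarrow> qx u < m"
    using Q(1) by (auto simp: leap_def)
  have iT: "i < T" and kS: "k < S" using ij kl P Q by auto
  have neq: "py i \<noteq> qy k" "py i \<noteq> qy l" "py j \<noteq> qy k" "py j \<noteq> qy l"
    using disjoint[of i k] disjoint[of i l] disjoint[of j k] disjoint[of j l] iT kS P(2) Q(2) ij kl by auto
  have last_step: "\<forall>j'. j' + 1 = j \<longrightarrow> adj (px j') (py j') (px j) (py j)"
  proof (intro allI impI)
    fix j' assume that: "j' + 1 = j"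
    have "j' < j" using that less_add_one by metis
    then show "adj (px j') (py j') (px j) (py j)" using stepP[of j'] that P(2) by auto
  qed
  show ?thesis
  proof (cases rule: leap_cases[OF P(1) stepP[OF iT] last_step, case_names unit excursion])
    case 1: unit
    then have "\<not> interleave i j k l"
      using unit_same_side(1)[of "py j" "py i" "qy k"] unit_same_side(1)[of "py j" "py i" "qy l"] neq
      unfolding interleave_def by metis
    \<comment> \<open>Step \<open>g\<close> joins two different columns, whereas the unit step stays
      on column \<open>m\<close>.\<close>
    moreover have "\<not> crossed i j k l"
    proof
      assume c: "crossed i j k l"
      then have "g = i" using 1 v0_less_Suc by (auto simp: crossed_def intro: antisym)
      then show False using crossedD[OF c P(2) Q(2)] ij 1 by auto
    qed
    ultimately show ?thesis by blast
  next
    case exP: (excursion m' j')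
    have j'j: "j' < j" using exP(2) less_add_one by metis
    show ?thesis
    \<comment> \<open>In a longer leap the hop is neither the first nor the last step, since one end
      of the hop would then be an interior visit to column \<open>m\<close>. So those two steps are
      grid steps.\<close>
    proof (cases "k = h \<and> l = h + 1")
      case True
      then have h: "h < S" using kS by simp
      have mx: "m = x" using hop[OF h] True kl by simp
      \<comment> \<open>The hop has its ends directly below and directly above
        \<open>(x, y)\<close>, so \<open>y\<close> is the only height between them.\<close>
      have side: "(py u < qy k) \<noteq> (py u < qy l) \<longleftrightarrow> py u = y" if "py u \<noteq> qy k" "py u \<noteq> qy l" for u
      proof -
        have hop_side: "(a < c) \<noteq> (a < c') \<longleftrightarrow> a = b"
          if "b = c + 1" "c' = b + 1" "a \<noteq> c" "a \<noteq> c'" for a b c c' :: 'a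
        proof (cases "a = b")
          case True
          then have "\<not> a < c" "a < c'" using that(1,2) less_add_one[of c] less_add_one[of b] by auto
          then show ?thesis using True by simp
        next
          case False
          then show ?thesis using unit_same_side(2)[of b c a] unit_same_side(2)[of c' b a] that by auto
        qed
        show ?thesis using hop[OF h] that True
          hop_side[of y "qy k" "qy l" "py u"] hop_side[of y "qy l" "qy k" "py u"] by blast
      qed
      have "interleave i j k l \<longleftrightarrow> (py i = y) \<noteq> (py j = y)"
        using side[of i] side[of j] neq unfolding interleave_def by blast
      \<comment> \<open>The exclusive disjunction becomes an ordinary one because the path visits
        \<open>(x, y)\<close> at most once.\<close>
      also have "\<dots> \<longleftrightarrow> py i = y \<or> py j = y"
      proof -
        have "\<not> (py i = y \<and> py j = y)"
          using unique[OF h less_imp_le[OF iT] P(2)] ij(1) unfolding ij(2,3) mx by blast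
        then show ?thesis by blast
      qed
      also have "\<dots> \<longleftrightarrow> i \<le> g \<and> g < j"
      proof
        assume "py i = y \<or> py j = y"
        then show "i \<le> g \<and> g < j"
        proof
          assume "py i = y"
          \<comment> \<open>From \<open>(x, y)\<close> the excursion departs to the left, along the
            edge of step \<open>g\<close>. In the other case it returns to \<open>(x, y)\<close>
            along this edge.\<close>
          then have "i = g" using left_edge[OF h iT] ij mx exP(1,4) by (simp add: arc_def)
          then show ?thesis using ij by simp
        next
          assume "py j = y"
          moreover have "j' < T" using j'j P(2) by simp
          ultimately have "j' = g" using left_edge[OF h, of j'] ij mx exP(1,2,4) by (simp add: arc_def)
          then show ?thesis using j'j exP(3) v0_Suc_le[of i g] by auto
        qed
      next
        assume g: "i \<le> g \<and> g < j"
        then have "g < T" using P(2) by auto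
        then consider "px g = x" "py g = y" | "px (g + 1) = x" "py (g + 1) = y"
          using left_edge[OF h] by blast
        then show "py i = y \<or> py j = y"
        proof cases
          case 1
          then have "g = i" using innerP[of g] g mx by (metis le_less less_irrefl)
          then show ?thesis using 1 by simp
        next
          case 2
          have "i < g + 1" using g v0_less_Suc by blast
          then have "\<not> g + 1 < j" using innerP[of "g + 1"] 2 mx by auto
          then have "g + 1 = j" using g v0_Suc_le[of g j] by simp
          then show ?thesis using 2 by simp
        qed
      qed
      finally show ?thesis using True less_add_one by (simp add: crossed_def)
    next
      case False
      have kh: "k \<noteq> h"
      proof
        assume "k = h"
        then have "qx (k + 1) = m" using hop kS kl by simp
        moreover have "k + 1 < l" using False kl(1) v0_Suc_le[of k l] \<open>k = h\<close> by auto
        ultimately show False using innerQ[of "k + 1"] less_add_one by auto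
      qed
      have lh: "l' \<noteq> h" if "l' + 1 = l" for l'
      proof
        assume "l' = h"
        have "l' < l" using that less_add_one by metis
        then have "h < S" using Q(2) \<open>l' = h\<close> by auto
        then have "qx l' = m" using hop \<open>l' = h\<close> that kl by simp
        moreover have "k < l'" using kl(1) that v0_less_Suc[of k l'] kh \<open>l' = h\<close> by auto
        ultimately show False using innerQ[of l'] \<open>l' < l\<close> by simp
      qed
      have last_stepQ: "\<forall>l'. l' + 1 = l \<longrightarrow> adj (qx l') (qy l') (qx l) (qy l)"
      proof (intro allI impI)
        fix l' assume that: "l' + 1 = l"
        have "l' < l" using that less_add_one by metis
        then show "adj (qx l') (qy l') (qx l) (qy l)" using stepQ[of l'] that Q(2) lh[OF that] by auto
      qed
      show ?thesis
      proof (cases rule: leap_cases[OF Q(1) stepQ[OF kS kh] last_stepQ, case_names unit excursion])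
        case 1: unit
        then have "\<not> interleave i j k l"
          using unit_same_side(2)[of "qy l" "qy k" "py i"] unit_same_side(2)[of "qy l" "qy k" "py j"] neq
          unfolding interleave_def by metis
        moreover have "\<not> crossed i j k l"
          using kh 1(1) v0_less_Suc[of h k] by (auto simp: crossed_def)
        ultimately show ?thesis by blast
      next
        case exQ: (excursion m'' l')
        have "m'' = m'" using exP exQ by auto
        have m': "m' < m" using exP(1) less_add_one by metis
        have l'l: "l' < l" using exQ(2) less_add_one by metis
        have "interleave i j k l \<longleftrightarrow> interleave (i + 1) j' (k + 1) l'"
          using exP exQ by (simp add: interleave_def)
        also have "\<dots> \<longleftrightarrow> crossed (i + 1) j' (k + 1) l'"
          using IH[OF m' exP(4) _ exQ(4)[unfolded \<open>m'' = m'\<close>]] j'j l'l P(2) Q(2) by simp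
        also have "\<dots> \<longleftrightarrow> crossed i j k l"
        proof
          assume "crossed (i + 1) j' (k + 1) l'"
          then show "crossed i j k l"
            using j'j l'l by (auto simp: crossed_def v0_Suc_le)
        next
          assume c: "crossed i j k l"
          note gx = crossedD[OF c P(2) Q(2)]
          have kl': "k + 1 \<le> h" "h < l'"
          proof -
            show "k + 1 \<le> h" using c kh by (auto simp: crossed_def v0_Suc_le)
            have "h \<le> l'" using c exQ(2) v0_less_Suc[of h l'] by (simp add: crossed_def)
            then show "h < l'" using lh[OF exQ(2)] by simp
          qed
          \<comment> \<open>The hop lies inside the excursion of \<open>Q\<close>, hence on a column
            at most \<open>m - 1\<close>. The first and the last step of the excursion of
            \<open>P\<close> touch column \<open>m\<close>, which step \<open>g\<close> cannot do,
            as it runs between columns \<open>x - 1\<close> and \<open>x\<close>. So the crossing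
            survives the removal of the outer steps.\<close>
          then have "qx h \<le> m''" using exQ(4) by (simp add: arc_def)
          then have xm: "x \<le> m'" using hop[OF gx(1)] \<open>m'' = m'\<close> by simp
          have "g \<noteq> i"
          proof
            assume "g = i"
            then have "m = x \<or> m + 1 = x" using gx(3) ij by auto
            then have "m \<le> x" using less_add_one[of m] by auto
            then show False using xm m' by simp
          qed
          moreover have "g \<noteq> j'"
          proof
            assume "g = j'"
            then have "m = x \<or> m + 1 = x" using gx(3) ij exP(2) by auto
            then have "m \<le> x" using less_add_one[of m] by auto
            then show False using xm m' by simp
          qed
          moreover have "g \<le> j'" using c exP(2) v0_less_Suc[of g j'] by (simp add: crossed_def)
          ultimately show "crossed (i + 1) j' (k + 1) l'"
            using c kl' by (auto simp: crossed_def v0_Suc_le)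
        qed
        finally show ?thesis .
      qed
    qed
  qed
qed

lemma interleave_add:
  "interleave i j k l \<longleftrightarrow> interleave i i' k l \<noteq> interleave i' j k l"
  "interleave i j k l \<longleftrightarrow> interleave i j k k' \<noteq> interleave i j k' l"
  by (auto simp: interleave_def)

lemma crossed_add:
  "i \<le> i' \<Longrightarrow> i' \<le> j \<Longrightarrow> crossed i j k l \<longleftrightarrow> crossed i i' k l \<noteq> crossed i' j k l"
  "k \<le> k' \<Longrightarrow> k' \<le> l \<Longrightarrow> crossed i j k l \<longleftrightarrow> crossed i j k k' \<noteq> crossed i j k' l"
  unfolding crossed_def by (metis le_less_trans less_le_trans not_le)+

lemma definable_interleave:
  assumes "fdef i" "fdef j" "fdef k" "fdef l"
  shows "definable (\<lambda>e. interleave (i e) (j e) (k e) (l e))"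
  unfolding interleave_def
  by (intro definable_intros dfuns[THEN fdef_app] assms)

lemma definable_crossed:
  assumes "fdef i" "fdef j" "fdef k" "fdef l"
  shows "definable (\<lambda>e. crossed (i e) (j e) (k e) (l e))"
  unfolding crossed_def by (intro definable_intros assms)

text \<open>Three inductions are nested. The outer one, on the column, needs its hypothesis for all
  arcs, so these are quantified with bounds \<open>T\<close> and \<open>S\<close>. The inner ones
  fix the starting times and split off the last leap, for \<open>P\<close> against a single leap of
  \<open>Q\<close> and then for \<open>Q\<close> against a whole arc of \<open>P\<close>; exclusive
  disjunction adds up on both sides of the equivalence.\<close>

theorem interleave_iff_crossed:
  assumes "arc px m i j" "j \<le> T" "arc qx m k l" "l \<le> S"
  shows "interleave i j k l \<longleftrightarrow> crossed i j k l"
proof -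
  let ?C = "\<lambda>i j k l. interleave i j k l \<longleftrightarrow> crossed i j k l"
  let ?N = "\<lambda>m. \<forall>j. j \<le> T \<longrightarrow> (\<forall>i. i \<le> j \<longrightarrow> (\<forall>l. l \<le> S \<longrightarrow> (\<forall>k. k \<le> l \<longrightarrow>
     arc px m i j \<longrightarrow> arc qx m k l \<longrightarrow> ?C i j k l)))"
  have "?N m"
  proof (rule definable_less_induct[where P = ?N])
    show "definable (\<lambda>e. ?N (e 0))"
      by (intro definable_intros definable_arc definable_interleave definable_crossed dfuns)
    fix m assume N: "\<And>m'. m' < m \<Longrightarrow> ?N m'"
    have IHm: "?C i j k l" if "m' < m" "arc px m' i j" "j \<le> T" "arc qx m' k l" "l \<le> S" for m' i j k l
    proof -
      have "i \<le> j" "k \<le> l" using that by (auto simp: arc_def)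
      then show ?thesis using N[OF that(1)] that(2-5) by blast
    qed
    have leap_case: "?C i j k l" if "leap px m i j" "j \<le> T" "leap qx m k l" "l \<le> S" for i j k l
      using that IHm by (rule leap_leap)
    have arc_leap: "?C i j k l" if Q: "leap qx m k l" "l \<le> S" and P: "arc px m i j" "j \<le> T" for i j k l
    proof -
      have "arc px m i j \<longrightarrow> j \<le> T \<longrightarrow> ?C i j k l"
      proof (rule definable_less_induct[where a = j])
        show "definable (\<lambda>e. arc px m i (e 0) \<longrightarrow> e 0 \<le> T \<longrightarrow> ?C i (e 0) k l)"
          by (intro definable_intros definable_arc definable_interleave definable_crossed dfuns)
        fix j assume IH: "\<And>j'. j' < j \<Longrightarrow> arc px m i j' \<longrightarrow> j' \<le> T \<longrightarrow> ?C i j' k l"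
        show "arc px m i j \<longrightarrow> j \<le> T \<longrightarrow> ?C i j k l"
        proof (intro impI)
          assume j: "arc px m i j" "j \<le> T"
          show "?C i j k l"
          proof (cases "i = j")
            case True
            then show ?thesis by (auto simp: interleave_def crossed_def)
          next
            case False
            then have "i < j" using j(1) by (simp add: arc_def le_less)
            then obtain j' where j': "i \<le> j'" "j' < j" "arc px m i j'" "leap px m j' j"
              using arc_last_leap[OF dfuns(1) j(1)] by blast
            then have "?C i j' k l" "?C j' j k l" using IH[of j'] j(2) leap_case Q by auto
            then show ?thesis
              using interleave_add(1)[of i j k l j'] crossed_add(1)[of i j' j k l] j' by auto
          qed
        qed
      qed
      with P show ?thesis by blast
    qed
    have "?C i j k l" if P: "arc px m i j" "j \<le> T" and Q: "arc qx m k l" "l \<le> S" for i j k l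
    proof -
      have "arc qx m k l \<longrightarrow> l \<le> S \<longrightarrow> ?C i j k l"
      proof (rule definable_less_induct[where a = l])
        show "definable (\<lambda>e. arc qx m k (e 0) \<longrightarrow> e 0 \<le> S \<longrightarrow> ?C i j k (e 0))"
          by (intro definable_intros definable_arc definable_interleave definable_crossed dfuns)
        fix l assume IH: "\<And>l'. l' < l \<Longrightarrow> arc qx m k l' \<longrightarrow> l' \<le> S \<longrightarrow> ?C i j k l'"
        show "arc qx m k l \<longrightarrow> l \<le> S \<longrightarrow> ?C i j k l"
        proof (intro impI)
          assume l: "arc qx m k l" "l \<le> S"
          show "?C i j k l"
          proof (cases "k = l")
            case True
            then show ?thesis by (auto simp: interleave_def crossed_def)
          next
            case False
            then have "k < l" using l(1) by (simp add: arc_def le_less)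
            then obtain l' where l': "k \<le> l'" "l' < l" "arc qx m k l'" "leap qx m l' l"
              using arc_last_leap[OF dfuns(3) l(1)] by blast
            then have "?C i j k l'" "?C i j l' l" using IH[of l'] l(2) arc_leap[OF l'(4) l(2) P] by auto
            then show ?thesis
              using interleave_add(2)[of i j k l l'] crossed_add(2)[of k l' l i j] l' by auto
          qed
        qed
      qed
      with Q show ?thesis by blast
    qed
    then show "?N m" by blast
  qed
  with assms show ?thesis by (auto simp: arc_def)
qed

end

section \<open>Cutting out an arc around a given step\<close>

lemma v0_le_obtain:
  assumes "(x::'a::v0_model) \<le> y" obtains d where "y = x + d"
  using assms v0_le_iff by metis

lemma v0_diff_le: "(x::'a::v0_model) - y \<le> x"
proof (cases "y \<le> x")
  case True
  then obtain d where "x = y + d" by (rule v0_le_obtain)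
  then show ?thesis using B8[of d y] by (simp add: add.commute)
qed (simp add: minus_eq B9)

text \<open>A discrete intermediate value argument: the ends are the last time up to
  \<open>g\<close> and the first time after \<open>g\<close> at which the column is at least
  \<open>M\<close>. As columns change by at most 1 per step, it equals \<open>M\<close>
  there.\<close>

lemma arc_around:
  assumes f: "dfun f" and step: "\<And>u. u < T \<Longrightarrow> f u \<le> f (u + 1) + 1 \<and> f (u + 1) \<le> f u + 1"
    and g: "g < T" "f g \<le> M" "f (g + 1) \<le> M" and ends: "M \<le> f 0" "M \<le> f T"
  obtains i j where "i \<le> g" "g < j" "j \<le> T" "arc f M i j"
proof -
  have def: "definable (\<lambda>e. M \<le> f (e 0))" by (intro definable_intros fdef_app[OF f])
  obtain i where i: "M \<le> f i" "0 \<le> i" "i \<le> g" "\<And>u. i < u \<Longrightarrow> u \<le> g \<Longrightarrow> \<not> M \<le> f u"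
    by (rule definable_greatest[of "\<lambda>u. M \<le> f u", OF def ends(1) B9[of g]]) blast
  have fi: "f i = M"
  proof (cases "i = g")
    case True
    then show ?thesis using i(1) g(2) by simp
  next
    case False
    then have "i < g" using i(3) by simp
    then have "f (i + 1) < M" using i(4)[of "i + 1"] less_add_one[of i] v0_Suc_le[of i g] by simp
    moreover have "f i \<le> f (i + 1) + 1" using step[of i] \<open>i < g\<close> g(1) by simp
    ultimately have "f i \<le> M" using v0_Suc_le[of "f (i + 1)" M] by simp
    then show ?thesis using i(1) by simp
  qed
  have "definable (\<lambda>e. g + 1 \<le> e 0 \<and> M \<le> f (e 0))" by (intro definable_intros def)
  moreover have "g + 1 \<le> T \<and> M \<le> f T" using ends(2) g(1) v0_Suc_le[of g T] by simp
  ultimately obtain j where j: "g + 1 \<le> j" "M \<le> f j" "j \<le> T" "\<And>u. u < j \<Longrightarrow> g + 1 \<le> u \<Longrightarrow> \<not> M \<le> f u"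
    by (rule definable_least[of "\<lambda>j. g + 1 \<le> j \<and> M \<le> f j" T]) blast
  have fj: "f j = M"
  proof (cases "j = g + 1")
    case True
    then show ?thesis using j(2) g(3) by simp
  next
    case False
    then have "g + 1 < j" using j(1) by simp
    then obtain j' where j': "j' + 1 = j" using v0_pred[of "g + 1" j] by auto
    then have "j' < j" "g + 1 \<le> j'" using less_add_one[of j'] \<open>g + 1 < j\<close> v0_less_Suc[of "g + 1" j'] by auto
    then have "f j' < M" using j(4)[of j'] by simp
    moreover have "f j \<le> f j' + 1" using step[of j'] j' \<open>j' < j\<close> j(3) by auto
    ultimately have "f j \<le> M" using v0_Suc_le[of "f j'" M] by simp
    then show ?thesis using j(2) by simp
  qed
  have gj: "g < j" using j(1) v0_Suc_le[of g j] by simp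
  have "arc f M i j" unfolding arc_def
  proof (intro conjI allI impI fi fj)
    show "i \<le> j" using i(3) gj by simp
    fix u assume u: "u \<le> j" "i \<le> u"
    consider "u = i" | "u = j" | "i < u" "u \<le> g" | "u < j" "g + 1 \<le> u"
      using u v0_Suc_le[of g u] by (cases "u \<le> g"; cases "u = i"; cases "u = j"; force simp: le_less)
    then show "f u \<le> M"
    proof cases
      case 3
      then show ?thesis using i(4)[of u] by simp
    next
      case 4
      then show ?thesis using j(4)[of u] by simp
    qed (simp_all add: fi fj)
  qed
  then show ?thesis using that i(3) gj j(3) by blast
qed

lemma adj_column_step: "adj x y x' y' \<Longrightarrow> x \<le> x' + 1 \<and> x' \<le> x + (1::'a::v0_model)"
  by (auto simp: adj_def add.assoc B8)

section \<open>The crossing principle for paths\<close>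

text \<open>Timetable of the prolonged path: up to time \<open>K\<close> it runs along row
  \<open>c\<close> from column \<open>K\<close> to column 0, at time \<open>K + 1 + j\<close> it is
  at point \<open>j\<close> of the original path, one row higher, and one further step takes it to
  column \<open>K\<close>.\<close>

definition ext_x :: "'a::v0_model \<Rightarrow> ('a \<Rightarrow> 'a) \<Rightarrow> 'a \<Rightarrow> 'a \<Rightarrow> 'a" where
  "ext_x K f t i = (if i \<le> K then K - i else if i \<le> K + 1 + t then f (i - (K + 1)) else K)"

definition ext_y :: "'a::v0_model \<Rightarrow> 'a \<Rightarrow> ('a \<Rightarrow> 'a) \<Rightarrow> 'a \<Rightarrow> 'a \<Rightarrow> 'a" where
  "ext_y K c f t i = (if i \<le> K then c else if i \<le> K + 1 + t then f (i - (K + 1)) + 1 else f t + 1)"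

lemma ext_simps:
  "i \<le> K \<Longrightarrow> ext_x K f t i = K - i" "i \<le> K \<Longrightarrow> ext_y K c f t i = c"
  "j \<le> t \<Longrightarrow> ext_x K f t (K + 1 + j) = f j" "j \<le> t \<Longrightarrow> ext_y K c f t (K + 1 + j) = f j + 1"
  "ext_x K f t (K + 1 + t + 1) = K" "ext_y K c f t (K + 1 + t + 1) = f t + 1"
proof -
  have 1: "\<not> K + 1 + j \<le> K" for j
    using less_add_one[of K] B8[of "K + 1" j] by (meson less_le_trans not_le)
  have 2: "\<not> K + 1 + t + 1 \<le> K + 1 + t" using less_add_one[of "K + 1 + t"] by simp
  show "i \<le> K \<Longrightarrow> ext_x K f t i = K - i" "i \<le> K \<Longrightarrow> ext_y K c f t i = c"
    by (simp_all add: ext_x_def ext_y_def)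
  show "j \<le> t \<Longrightarrow> ext_x K f t (K + 1 + j) = f j" "j \<le> t \<Longrightarrow> ext_y K c f t (K + 1 + j) = f j + 1"
    unfolding ext_x_def ext_y_def using 1[of j] by (simp_all only: if_False add_le_cancel_left if_True add_diff_cancel_left')
  show "ext_x K f t (K + 1 + t + 1) = K" "ext_y K c f t (K + 1 + t + 1) = f t + 1"
    unfolding ext_x_def ext_y_def using 1[of "t + 1"] 2 by (simp_all only: add.assoc if_False)
qed

lemma ext_cases:
  assumes "(i::'a::v0_model) \<le> K + 1 + t + 1"
  obtains "i \<le> K" | j where "j \<le> t" "i = K + 1 + j" | "i = K + 1 + t + 1"
proof (cases "i \<le> K")
  case False
  then have "K + 1 \<le> i" using v0_Suc_le[of K i] by simp
  then obtain j where j: "i = K + 1 + j" by (rule v0_le_obtain)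
  then have "j \<le> t + 1" using assms by (simp only: add.assoc add_le_cancel_left)
  then consider "j \<le> t" | "j = t + 1" using v0_less_Suc[of j t] by (cases "j = t + 1") (simp_all add: le_less)
  then show ?thesis using that(2)[of j] that(3) j by cases (simp_all add: add.assoc)
qed

lemma ext_dfun:
  assumes "dfun f" shows "dfun (ext_x K f t)" "dfun (ext_y K c f t)"
proof -
  obtain b where b: "\<And>x. f x \<le> b" using assms by (auto simp: dfun_def)
  show "dfun (ext_x K f t)"
  proof (rule dfunI)
    show "ext_x K f t i \<le> K + b" for i
      using b v0_diff_le[of K i] B9 by (auto simp: ext_x_def intro: add_increasing add_increasing2)
    show "fdef (\<lambda>e. ext_x K f t (e 0))" unfolding ext_x_def by (intro definable_intros fdef_app[OF assms])
  qed
  show "dfun (ext_y K c f t)"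
  proof (rule dfunI)
    show "ext_y K c f t i \<le> c + (b + 1)" for i
      using b B9 by (auto simp: ext_y_def intro: add_increasing add_increasing2)
    show "fdef (\<lambda>e. ext_y K c f t (e 0))" unfolding ext_y_def by (intro definable_intros fdef_app[OF assms])
  qed
qed

lemma ext_step:
  assumes step: "\<And>i. i < t \<Longrightarrow> adj (fx i) (fy i) (fx (i + 1)) (fy (i + 1))"
    and start: "adj 0 c (fx 0) (fy 0 + 1)" and last: "fx t + 1 = K" and i: "i < K + 1 + t + 1"
  shows "adj (ext_x K fx t i) (ext_y K c fy t i) (ext_x K fx t (i + 1)) (ext_y K c fy t (i + 1))"
proof (cases rule: ext_cases[OF less_imp_le[OF i]])
  case 1
  show ?thesis
  proof (cases "i = K")
    case True
    then show ?thesis using start ext_simps(3,4)[of 0 t K] B9[of t] by (simp add: ext_simps(1,2))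
  next
    case False
    then have "i + 1 \<le> K" using 1 v0_Suc_le[of i K] by simp
    moreover from this obtain d where d: "K = (i + 1) + d" by (rule v0_le_obtain)
    have "K - (i + 1) = d" unfolding d by (rule add_diff_cancel_left')
    moreover have "K = i + (d + 1)" using d by (simp add: algebra_simps)
    then have "K - i = d + 1" by simp
    ultimately show ?thesis using 1 by (simp add: ext_simps adj_def)
  qed
next
  case (2 j)
  show ?thesis
  proof (cases "j = t")
    case True
    have "i = K + 1 + t" using 2 True by simp
    then have "ext_x K fx t (i + 1) = K" "ext_y K c fy t (i + 1) = fy t + 1"
      by (simp_all only: ext_simps)
    then show ?thesis using 2 True last by (simp add: ext_simps adj_def)
  next
    case False
    then have "j < t" using 2 by simp
    then have "j + 1 \<le> t" using v0_Suc_le[of j t] by simp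
    moreover have "i + 1 = K + 1 + (j + 1)" using 2 by (simp add: add.assoc)
    ultimately have "ext_x K fx t (i + 1) = fx (j + 1)" "ext_y K c fy t (i + 1) = fy (j + 1) + 1"
      by (simp_all only: ext_simps)
    then show ?thesis using step[OF \<open>j < t\<close>] 2 by (auto simp: ext_simps adj_def)
  qed
qed (use i in simp)

text \<open>Both paths are shifted up by one row and their ends prolonged to column \<open>n + 1\<close>: the start of
  one along the top, the start of the other along the bottom.\<close>

theorem paths_cross:
  fixes bx by' rx ry :: "'a::v0_model \<Rightarrow> 'a"
  assumes dfuns: "dfun bx" "dfun by'" "dfun rx" "dfun ry"
    and stepB: "\<And>i. i < t \<Longrightarrow> adj (bx i) (by' i) (bx (i + 1)) (by' (i + 1))"
    and stepR: "\<And>i. i < s \<Longrightarrow> adj (rx i) (ry i) (rx (i + 1)) (ry (i + 1))"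
    and gridB: "\<And>i. i \<le> t \<Longrightarrow> bx i \<le> n \<and> by' i \<le> n"
    and gridR: "\<And>i. i \<le> s \<Longrightarrow> rx i \<le> n \<and> ry i \<le> n"
    and ends: "bx 0 = 0" "by' 0 = n" "bx t = n" "by' t = 0" "rx 0 = 0" "ry 0 = 0" "rx s = n" "ry s = n"
  obtains i k where "i \<le> t" "k \<le> s" "bx i = rx k" "by' i = ry k"
proof (rule ccontr)
  assume "\<not> thesis"
  with that have dis: "\<And>i k. i \<le> t \<Longrightarrow> k \<le> s \<Longrightarrow> bx i = rx k \<Longrightarrow> by' i \<noteq> ry k" by blast
  \<comment> \<open>On the one-point grid both paths start at the same point.\<close>
  have "n \<noteq> 0" using dis[of 0 0] ends B9 by auto
  define K where "K = n + 1"
  define px where "px = ext_x K bx t"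
  \<comment> \<open>The shifted grid occupies rows 1 to \<open>K\<close>. This leaves row
    \<open>K + 1\<close> for the start of one path and row 0 for that of the other.\<close>
  define py where "py = ext_y K (K + 1) by' t"
  define qx where "qx = ext_x K rx s"
  define qy where "qy = ext_y K 0 ry s"
  define T where "T = K + 1 + t + 1"
  define S where "S = K + 1 + s + 1"
  note defs = px_def py_def qx_def qy_def
  have nK: "n < K" "K < K + 1" "0 < K" using less_add_one[of n] less_add_one[of K] v0_less_Suc[of 0 n] B9[of n] by (simp_all add: K_def)
  have 0: "\<not> u + 1 = 0" for u :: 'a by (rule B1)
  \<comment> \<open>The hop time \<open>S\<close> lies beyond the last step, so there is no hop, and
    the three zeros are placeholders.\<close>
  interpret two_paths px py qx qy T S 0 S 0 0
  proof
    show "dfun px" "dfun py" "dfun qx" "dfun qy" unfolding defs by (intro ext_dfun dfuns)+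
    show "adj (px i) (py i) (px (i + 1)) (py (i + 1))" if "i < T" for i
      unfolding px_def py_def
      by (rule ext_step[of t bx by']) (use stepB that in \<open>simp_all add: ends K_def T_def adj_def\<close>)
    show "adj (qx k) (qy k) (qx (k + 1)) (qy (k + 1))" if "k < S" for k
      unfolding qx_def qy_def
      by (rule ext_step[of s rx ry]) (use stepR that in \<open>simp_all add: ends K_def S_def adj_def\<close>)
    show "py i \<noteq> qy k" if i: "i \<le> T" and k: "k \<le> S" and x: "px i = qx k" for i k
    proof -
      have qyK: "qy k \<le> K" using k[unfolded S_def]
      proof (cases rule: ext_cases)
        case (2 j)
        then show ?thesis using gridR[of j] by (simp add: qy_def ext_simps K_def)
      qed (use nK in \<open>simp_all add: qy_def ext_simps ends K_def\<close>)
      show ?thesis using i[unfolded T_def]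
      proof (cases rule: ext_cases)
        case 1
        then have "py i = K + 1" by (simp add: py_def ext_simps)
        then show ?thesis using qyK nK(2) by (metis not_le)
      next
        case i: (2 j)
        show ?thesis using k[unfolded S_def]
        proof (cases rule: ext_cases)
          case 1
          then show ?thesis using i by (simp add: py_def qy_def ext_simps 0)
        next
          case (2 j')
          then show ?thesis using i dis[of j j'] x by (simp add: defs ext_simps)
        next
          case 3
          then show ?thesis using i x gridB[of j] nK(1) by (auto simp: px_def qx_def ext_simps)
        qed
      next
        case i: 3
        then have pi: "px i = K" "py i = 1" by (simp_all add: px_def py_def ext_simps ends)
        show ?thesis using k[unfolded S_def]
        proof (cases rule: ext_cases)
          case 1
          then show ?thesis using pi by (simp add: qy_def ext_simps)
        next
          case (2 j')
          then show ?thesis using pi x gridR[of j'] nK(1) by (auto simp: qx_def ext_simps)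
        next
          case 3
          then show ?thesis using pi \<open>n \<noteq> 0\<close> by (simp add: qy_def ext_simps ends)
        qed
      qed
    qed
  qed simp_all
  have "px 0 = K" "qx 0 = K" "py 0 = K + 1" "qy 0 = 0" using B9[of K] by (simp_all add: defs ext_simps)
  have pT: "px T = K" "py T = 1" by (simp_all add: px_def py_def T_def ext_simps ends)
  have qS: "qx S = K" "qy S = K" by (simp_all add: qx_def qy_def S_def ext_simps ends K_def)
  have "px i \<le> K" if "i \<le> T" for i using that[unfolded T_def]
  proof (cases rule: ext_cases)
    case (2 j)
    then show ?thesis using gridB[of j] nK(1) by (force simp: px_def ext_simps)
  qed (simp_all add: px_def ext_simps v0_diff_le)
  then have "arc px K 0 T" using B9[of T] pT \<open>px 0 = K\<close> by (simp add: arc_def)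
  have "qx i \<le> K" if "i \<le> S" for i using that[unfolded S_def]
  proof (cases rule: ext_cases)
    case (2 j)
    then show ?thesis using gridR[of j] nK(1) by (force simp: qx_def ext_simps)
  qed (simp_all add: qx_def ext_simps v0_diff_le)
  then have "arc qx K 0 S" using B9[of S] qS \<open>qx 0 = K\<close> by (simp add: arc_def)
  \<comment> \<open>On column \<open>K\<close> the heights 0, 1, \<open>K\<close>,
    \<open>K + 1\<close> belong to \<open>Q\<close>, \<open>P\<close>, \<open>Q\<close>,
    \<open>P\<close> in turn. They are distinct because \<open>n\<close> is not 0.\<close>
  have "interleave 0 T 0 S"
  proof -
    have "1 < K" using \<open>n \<noteq> 0\<close> B9[of n] by (simp add: K_def le_less)
    then show ?thesis unfolding interleave_def pT qS \<open>py 0 = K + 1\<close> \<open>qy 0 = 0\<close>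
      using nK v0_not_less_0 by auto
  qed
  moreover have "\<not> crossed 0 T 0 S" by (simp add: crossed_def)
  ultimately show False
    using interleave_iff_crossed[OF \<open>arc px K 0 T\<close> order_refl \<open>arc qx K 0 S\<close> order_refl] by blast
qed

section \<open>The Jordan curve principle for paths\<close>

text \<open>Addition modulo \<open>t\<close>. One subtraction suffices for \<open>a < t\<close> and
  \<open>u \<le> t\<close>, and time \<open>t\<close> leads back to \<open>a\<close>, so that a
  closed curve becomes a path with coinciding ends.\<close>

definition rot :: "'a::v0_model \<Rightarrow> 'a \<Rightarrow> 'a \<Rightarrow> 'a" where
  "rot a t u = (if a + u < t then a + u else a + u - t)"

lemma rot_cases:
  obtains "a + u < t" "rot a t u = a + u" | d where "a + u = t + d" "rot a t u = d"
proof (cases "a + u < t")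
  case False
  then have "t \<le> a + u" by simp
  then obtain d where "a + u = t + d" by (rule v0_le_obtain)
  then show ?thesis using that(2)[of d] False by (simp add: rot_def)
qed (use that(1) in \<open>simp add: rot_def\<close>)

lemma rot_eqI: "a + u < t \<Longrightarrow> rot a t u = a + u" "a + u = t + d \<Longrightarrow> rot a t u = d"
  using B8[of t d] by (auto simp: rot_def not_less[symmetric])

lemma rot_less:
  assumes "a < t" "u \<le> t" shows "rot a t u < t"
proof (cases rule: rot_cases[of a u t])
  case (2 d)
  have "t + d < t + t" using add_less_le_mono[OF assms] 2(1) by simp
  then show ?thesis using 2(2) by simp
qed simp

lemma rot_0: "a < t \<Longrightarrow> rot a t 0 = a"
  by (simp add: rot_def)

lemma rot_end: "rot a t t = a"
  by (rule rot_eqI(2)) (rule add.commute)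

lemma rot_Suc:
  assumes "a < t" "u < t"
  shows "rot a t (u + 1) = (if rot a t u + 1 = t then 0 else rot a t u + 1)"
proof (cases rule: rot_cases[of a u t])
  case 1
  show ?thesis
  proof (cases "a + u + 1 = t")
    case True
    then have "rot a t (u + 1) = 0" by (intro rot_eqI(2)) (simp add: add.assoc)
    then show ?thesis using 1 True by simp
  next
    case False
    then have "a + (u + 1) < t" using 1(1) v0_Suc_le[of "a + u" t] by (simp add: add.assoc le_less)
    then show ?thesis using rot_eqI(1) 1 False by (simp add: add.assoc)
  qed
next
  case (2 d)
  have "rot a t (u + 1) = d + 1" using 2(1) by (intro rot_eqI(2)) (metis add.assoc)
  moreover have "u + 1 \<le> t" using assms(2) v0_Suc_le by blast
  ultimately have "d + 1 \<noteq> t" using rot_less[OF assms(1), of "u + 1"] by auto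
  then show ?thesis using 2 \<open>rot a t (u + 1) = d + 1\<close> by simp
qed

lemma rot_surj:
  assumes "a < t" "z < t"
  obtains u where "u < t" "rot a t u = z"
proof (cases "a \<le> z")
  case True
  then obtain u where u: "z = a + u" by (rule v0_le_obtain)
  have "u \<le> z" unfolding u using B8[of u a] by (simp only: add.commute)
  then have "u < t" using assms(2) by (rule le_less_trans)
  then show ?thesis using that[of u] u assms(2) by (simp add: rot_eqI(1))
next
  case False
  obtain d where d: "t = a + d" using less_imp_le[OF assms(1)] by (rule v0_le_obtain)
  have *: "a + (d + z) = t + z" by (simp add: d add.assoc)
  also have "\<dots> < t + a" using False by simp
  finally have "d + z < t" by (simp add: add.commute)
  then show ?thesis using that[of "d + z"] rot_eqI(2)[OF *] by simp
qed

lemma rot_inj: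
  assumes "u < t" "v < t" "rot a t u = rot a t v"
  shows "u = v"
proof -
  have *: False if "u < t" "v < t" "a + u < t" "rot a t u = a + u" "a + v = t + d" "rot a t v = d"
    "rot a t u = rot a t v" for u v d
  proof -
    have "a + v = a + (t + u)" using that by (simp add: add.left_commute)
    then have "v = t + u" by simp
    then show False using that(2) B8[of t u] by simp
  qed
  show ?thesis
  proof (cases rule: rot_cases[of a u t])
    case u: 1
    show ?thesis
    proof (cases rule: rot_cases[of a v t])
      case 1
      then show ?thesis using u assms(3) by simp
    next
      case (2 d)
      then show ?thesis using * u assms by blast
    qed
  next
    case u: (2 d)
    show ?thesis
    proof (cases rule: rot_cases[of a v t])
      case 1
      then show ?thesis using *[of v u d] u assms by simp
    next
      case (2 d')
      then have "a + u = a + v" using u assms(3) by simp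
      then show ?thesis by simp
    qed
  qed
qed

lemma dfun_rot: "dfun f \<Longrightarrow> dfun (\<lambda>u. f (rot a t u))"
proof -
  assume f: "dfun f"
  then obtain c where c: "\<And>x. f x \<le> c" by (auto simp: dfun_def)
  have "fdef (\<lambda>e. f (rot a t (e 0)))" unfolding rot_def by (intro definable_intros fdef_app[OF f])
  then show ?thesis using dfunI[of "\<lambda>u. f (rot a t u)"] c by blast
qed

text \<open>The maximum is sought among the attained values, which form a definable property with a
  constant bound; \<open>e\<close> shows that there is one.\<close>

lemma definable_argmax:
  fixes t :: "'a::v0_model"
  assumes "dfun f" "e < t"
  obtains m where "m < t" "\<And>u. u < t \<Longrightarrow> f u \<le> f m"
proof -
  obtain c where c: "\<And>x. f x \<le> c" using assms(1) by (auto simp: dfun_def)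
  have "definable (\<lambda>v. \<exists>u. u < t \<and> f u = v 0)" by (intro definable_intros fdef_app[OF assms(1)])
  moreover have "\<exists>u. u < t \<and> f u = f e" using assms(2) by blast
  ultimately obtain M where "\<exists>u. u < t \<and> f u = M" "\<And>y. M < y \<Longrightarrow> y \<le> c \<Longrightarrow> \<not> (\<exists>u. u < t \<and> f u = y)"
    using c[of e] by (rule definable_greatest[of "\<lambda>v. \<exists>u. u < t \<and> f u = v" "f e" c]) blast
  then show ?thesis using that c by (metis not_le)
qed

lemma adj_horizontal:
  assumes "adj x y x' y'" "\<not> (x' = x \<and> y' = y + 1)" "\<not> (x' = x \<and> y = y' + 1)"
  shows "y' = y" "x' + 1 = x \<or> x' = x + 1"
  using assms by (auto simp: adj_def)

text \<open>Both \<open>B\<close> and \<open>R\<close>, the latter closed by a hop over \<open>(x, y)\<close>, are rotated so as to start and end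
  at a rightmost point.  Let \<open>M\<close> be the smaller one of the two largest columns.  The curve that
  stays within the columns up to \<open>M\<close> is an arc with equal ends, so it interleaves with no arc of
  the other one, although one of these arcs crosses it.\<close>

theorem closed_curve_meets_path:
  fixes bx by' rx ry :: "'a::v0_model \<Rightarrow> 'a"
  assumes dfuns: "dfun bx" "dfun by'" "dfun rx" "dfun ry" and t: "1 + 1 < t"
    and stepB: "\<And>i. i + 1 < t \<Longrightarrow> adj (bx i) (by' i) (bx (i + 1)) (by' (i + 1))"
    and closeB: "\<And>i. i + 1 = t \<Longrightarrow> adj (bx i) (by' i) (bx 0) (by' 0)"
    and injB: "\<And>i j. i < t \<Longrightarrow> j < t \<Longrightarrow> bx i = bx j \<Longrightarrow> by' i = by' j \<Longrightarrow> i = j"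
    and stepR: "\<And>k. k < s \<Longrightarrow> adj (rx k) (ry k) (rx (k + 1)) (ry (k + 1))"
    and ends: "rx 0 = x" "rx s = x" "y = ry 0 + 1 \<and> ry s = y + 1 \<or> y = ry s + 1 \<and> ry 0 = y + 1"
    and mid: "e < t" "bx e = x" "by' e = y"
  obtains i k where "i < t" "k \<le> s" "bx i = rx k" "by' i = ry k"
proof (rule ccontr)
  assume "\<not> thesis"
  with that have dis: "\<And>i k. i < t \<Longrightarrow> k \<le> s \<Longrightarrow> bx i = rx k \<Longrightarrow> by' i \<noteq> ry k" by blast
  obtain \<beta> where \<beta>: "\<beta> < t" "\<And>u. u < t \<Longrightarrow> bx u \<le> bx \<beta>"
    using definable_argmax[OF dfuns(1) mid(1)] by blast
  \<comment> \<open>Closing \<open>R\<close> adds one step, from its last point back to its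
    first.\<close>
  define S where "S = s + 1"
  have le_s: "k \<le> s \<longleftrightarrow> k < S" for k by (simp add: S_def v0_less_Suc)
  obtain \<rho> where \<rho>: "\<rho> < S" "\<And>u. u < S \<Longrightarrow> rx u \<le> rx \<rho>"
    using definable_argmax[OF dfuns(3), of s S] le_s by blast
  define px where "px u = bx (rot \<beta> t u)" for u
  define py where "py u = by' (rot \<beta> t u)" for u
  define qx where "qx k = rx (rot \<rho> S k)" for k
  define qy where "qy k = ry (rot \<rho> S k)" for k
  note rotP = rot_less[OF \<beta>(1)] and rotQ = rot_less[OF \<rho>(1)]
  have stepP: "adj (px i) (py i) (px (i + 1)) (py (i + 1))" if "i < t" for i
  proof -
    have less: "rot \<beta> t i < t" using rotP[of i] that by simp
    show ?thesis
    proof (cases "rot \<beta> t i + 1 = t")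
      case True
      then show ?thesis using closeB[OF True] rot_Suc[OF \<beta>(1) that] by (simp add: px_def py_def)
    next
      case False
      then have "rot \<beta> t i + 1 < t" using less v0_Suc_le[of "rot \<beta> t i" t] by (simp add: le_less)
      then show ?thesis using stepB False rot_Suc[OF \<beta>(1) that] by (simp add: px_def py_def)
    qed
  qed
  have dis': "py i \<noteq> qy k" if "i \<le> t" "k \<le> S" "px i = qx k" for i k
    using dis[of "rot \<beta> t i" "rot \<rho> S k"] rotP[OF that(1)] rotQ[OF that(2)] le_s that(3)
    by (simp add: px_def py_def qx_def qy_def)
  have p_ends: "px t = px 0" "py t = py 0" using \<beta>(1) by (simp_all add: px_def py_def rot_0 rot_end)
  have q_ends: "qx S = qx 0" "qy S = qy 0" using \<rho>(1) by (simp_all add: qx_def qy_def rot_0 rot_end)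
  have injP: "u = v" if "u < t" "v < t" "px u = px v" "py u = py v" for u v
  proof (rule rot_inj[OF that(1,2)])
    show "rot \<beta> t u = rot \<beta> t v"
      using injB[OF rotP rotP] that by (simp add: px_def py_def less_imp_le)
  qed
  \<comment> \<open>The rotated curve is at the last point of \<open>R\<close> at time
    \<open>h\<close>, so step \<open>h\<close> is the hop.\<close>
  obtain h where h: "h < S" "rot \<rho> S h = s" using rot_surj[OF \<rho>(1), of s] le_s by blast
  have hops: "qx h = x" "qx (h + 1) = x" "qy h = ry s" "qy (h + 1) = ry 0"
    using rot_Suc[OF \<rho>(1) h(1)] h(2) ends by (simp_all add: qx_def qy_def S_def)
  obtain m where m: "m < t" "rot \<beta> t m = e" using rot_surj[OF \<beta>(1) mid(1)] by blast
  then have pm: "px m = x" "py m = y" using mid by (simp_all add: px_def py_def)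
  \<comment> \<open>A time at \<open>(x, y)\<close> that has a predecessor: it is \<open>m\<close>,
    or \<open>t\<close> in case the rotated curve starts at \<open>(x, y)\<close>.\<close>
  obtain m' where m': "m' = m \<or> m = 0 \<and> m' = t" "0 < m'" "px m' = x" "py m' = y" "m' \<le> t"
  proof (cases "m = 0")
    case True
    then show ?thesis using that[of t] pm p_ends m(1) by simp
  next
    case False
    then have "0 < m" using B9[of m] by (simp add: le_less)
    then show ?thesis using that[of m] pm m(1) by simp
  qed
  obtain p where p: "p + 1 = m'" using v0_pred[OF m'(2)] by blast
  have "p < t" using p m'(5) v0_Suc_le by metis
  have "m + 1 \<le> t" using m(1) v0_Suc_le by blast
  \<comment> \<open>The points directly above and below \<open>(x, y)\<close> are the ends of
    \<open>R\<close>, so \<open>B\<close> avoids them and passes through \<open>(x, y)\<close>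
    horizontally.\<close>
  have not_vertical: "\<not> (px u = x \<and> py u = y + 1)" "\<not> (px u = x \<and> y = py u + 1)" if "u \<le> t" for u
    using dis'[OF that less_imp_le[OF h(1)]] dis'[OF that, of "h + 1"] hops ends h(1) v0_Suc_le[of h S] by auto
  have "adj x y (px p) (py p)" using adj_sym[OF stepP[OF \<open>p < t\<close>]] m' p by simp
  note prev = adj_horizontal[OF this not_vertical[OF less_imp_le[OF \<open>p < t\<close>]]]
  have "adj x y (px (m + 1)) (py (m + 1))" using stepP[OF m(1)] pm by simp
  note nxt = adj_horizontal[OF this not_vertical[OF \<open>m + 1 \<le> t\<close>]]
  \<comment> \<open>If \<open>B\<close> turned back at \<open>(x, y)\<close>, injectivity would
    identify the predecessor and the successor on the cycle, so its length would be at most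
    2.\<close>
  have "px p \<noteq> px (m + 1)"
  proof
    assume eq: "px p = px (m + 1)"
    have small: "\<not> t \<le> 1 + 1" using t by simp
    show False
    proof (cases "m + 1 = t")
      case True
      then have "p = 0" using injP[of p 0] eq prev(1) nxt(1) p_ends \<open>p < t\<close> m(1) B9[of m]
        by (metis le_less_trans)
      then have "m' = 1" using p by simp
      then have "m = 1 \<or> m = 0" using m' by auto
      then have "t \<le> 1 + 1" using True by (auto simp: le_less)
      then show False using small by contradiction
    next
      case False
      then have "m + 1 < t" using \<open>m + 1 \<le> t\<close> by simp
      then have pm1: "p = m + 1" using injP[of p "m + 1"] eq prev(1) nxt(1) \<open>p < t\<close> by simp
      then have "m' = m + (1 + 1)" using p by (simp add: add.assoc)
      then have "m' \<noteq> m" using B1 by (metis add.assoc add_cancel_left_right)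
      then have "t = 1 + 1" using m'(1) \<open>m' = m + (1 + 1)\<close> by auto
      then show False using t by simp
    qed
  qed
  then consider (left) "px p + 1 = x" "px (m + 1) = x + 1" | (right) "px p = x + 1" "px (m + 1) + 1 = x"
    using prev(2) nxt(2) by auto
  note sides = this
  have px_le: "px u \<le> px 0" if "u \<le> t" for u
    using \<beta> rotP[OF that] by (simp add: px_def rot_0)
  have qx_le: "qx k \<le> qx 0" if "k \<le> S" for k
    using \<rho> rotQ[OF that] by (simp add: qx_def rot_0)
  \<comment> \<open>One neighbour of \<open>(x, y)\<close> on \<open>B\<close> lies in column
    \<open>x + 1\<close>, and time 0 is at a rightmost point. Hence \<open>(x, y)\<close> is not the
    start, and \<open>m'\<close> is \<open>m\<close> after all.\<close>
  have "x + 1 \<le> px 0" using sides px_le[of p] px_le[of "m + 1"] \<open>p < t\<close> \<open>m + 1 \<le> t\<close> by cases simp_all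
  then have x0: "x < px 0" using v0_Suc_le by blast
  have "m \<noteq> 0" using x0 pm by auto
  then have mm: "m' = m" using m'(1) by simp
  have unique: "u = m" if "u \<le> t" "px u = x" "py u = y" for u
  proof -
    have "u \<noteq> t" using that x0 p_ends by auto
    then show ?thesis using injP[of u m] that m(1) pm by simp
  qed
  \<comment> \<open>The step between \<open>(x, y)\<close> and its left neighbour: the arriving step
    \<open>p\<close> if \<open>B\<close> comes from the left, and otherwise the departing step
    \<open>m\<close>.\<close>
  define g where "g = (if px p + 1 = x then p else m)"
  have xx: "x + 1 + 1 \<noteq> x" using B1 by (metis add.assoc add_cancel_left_right)
  have edge: "px u = x \<and> py u = y \<and> px (u + 1) + 1 = x \<or> px (u + 1) = x \<and> py (u + 1) = y \<and> px u + 1 = x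
    \<longleftrightarrow> u = g" if "u < t" for u
  proof -
    have u: "u \<le> t" "u + 1 \<le> t" using that v0_Suc_le[of u t] by simp_all
    have 1: "px u = x \<and> py u = y \<longleftrightarrow> u = m" using unique[OF u(1)] pm by blast
    have 2: "px (u + 1) = x \<and> py (u + 1) = y \<longleftrightarrow> u = p" 
      using unique[OF u(2)] pm p mm by (metis add_right_cancel)
    have "px u = x \<and> py u = y \<and> px (u + 1) + 1 = x \<or> px (u + 1) = x \<and> py (u + 1) = y \<and> px u + 1 = x
      \<longleftrightarrow> (u = m \<and> px (m + 1) + 1 = x) \<or> (u = p \<and> px p + 1 = x)"
      using 1 2 by blast
    also have "\<dots> \<longleftrightarrow> u = g" using sides xx by cases (simp_all add: g_def)
    finally show ?thesis .
  qed
  have g: "g < t" using m(1) \<open>p < t\<close> by (simp add: g_def)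
  interpret two_paths px py qx qy t S g h x y
  proof
    show "dfun px" "dfun py" "dfun qx" "dfun qy"
      unfolding px_def py_def qx_def qy_def by (intro dfun_rot dfuns)+
    show "adj (qx k) (qy k) (qx (k + 1)) (qy (k + 1))" if "k < S" "k \<noteq> h" for k
    proof -
      have "rot \<rho> S k \<noteq> s" using rot_inj[OF that(1) h(1)] h(2) that(2) by auto
      moreover have "rot \<rho> S k \<le> s" using rotQ[of k] that(1) le_s by simp
      ultimately have "rot \<rho> S k < s" by simp
      then show ?thesis using stepR[of "rot \<rho> S k"] rot_Suc[OF \<rho>(1) that(1)] \<open>rot \<rho> S k \<noteq> s\<close>
        by (simp add: qx_def qy_def S_def)
    qed
    show "qx h = x \<and> qx (h + 1) = x
      \<and> (y = qy h + 1 \<and> qy (h + 1) = y + 1 \<or> y = qy (h + 1) + 1 \<and> qy h = y + 1)"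
      using hops ends(3) by auto
    show "u = g \<longleftrightarrow> px u = x \<and> py u = y \<and> px (u + 1) + 1 = x \<or> px (u + 1) = x \<and> py (u + 1) = y \<and> px u + 1 = x"
      if "u < t" for u using edge[OF that] by blast
    show "u = v" if "u \<le> t" "v \<le> t" "px u = x" "py u = y" "px v = x" "py v = y" for u v
      using unique that by blast
  qed (use stepP dis' in auto)
  have gx: "px g \<le> x" "px (g + 1) \<le> x"
    using edge[OF g] B8[of "px g" 1] B8[of "px (g + 1)" 1] by (metis order_refl)+
  show False
  proof (cases "px 0 \<le> qx 0")
    case True
    have "x \<le> px 0" using x0 by simp
    have P: "arc px (px 0) 0 t" using px_le p_ends B9[of t] by (simp add: arc_def)
    have "qx u \<le> qx (u + 1) + 1 \<and> qx (u + 1) \<le> qx u + 1" if "u < S" for u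
    proof (cases "u = h")
      case True
      then show ?thesis using hops B8[of x 1] by simp
    next
      case False
      then show ?thesis using adj_column_step[OF stepQ[OF that False]] by simp
    qed
    then obtain k l where kl: "k \<le> h" "h < l" "l \<le> S" "arc qx (px 0) k l"
      by (rule arc_around[of qx S h "px 0", OF dfuns(3)]) (use \<open>x \<le> px 0\<close> True q_ends h hops in auto)
    have "\<not> interleave 0 t k l" by (simp add: interleave_def p_ends)
    moreover have "crossed 0 t k l" using kl g B9[of g] by (simp add: crossed_def)
    ultimately show False using interleave_iff_crossed[OF P order_refl kl(4,3)] by blast
  next
    case False
    have "x \<le> qx 0" using qx_le[of h] h(1) hops(1) by simp
    have Q: "arc qx (qx 0) 0 S" using qx_le q_ends B9[of S] by (simp add: arc_def)
    have "px u \<le> px (u + 1) + 1 \<and> px (u + 1) \<le> px u + 1" if "u < t" for u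
      using adj_column_step[OF stepP[OF that]] .
    then obtain i j where ij: "i \<le> g" "g < j" "j \<le> t" "arc px (qx 0) i j"
      by (rule arc_around[of px t g "qx 0", OF dfuns(1)]) (use \<open>x \<le> qx 0\<close> False p_ends g gx in auto)
    have "\<not> interleave i j 0 S" by (simp add: interleave_def q_ends)
    moreover have "crossed i j 0 S" using ij h B9[of h] by (simp add: crossed_def)
    ultimately show False using interleave_iff_crossed[OF ij(4,3) Q order_refl] by blast
  qed
qed

section \<open>Decoding points, edges and sequences\<close>

definition pr :: "'a::v0_model \<Rightarrow> 'a \<Rightarrow> 'a" where
  "pr x y = (x + y) * (x + y + 1) + (1 + 1) * y"

lemma double_inject:
  assumes "(1 + 1) * y = (1 + 1) * (z::'a::v0_model)"
  shows "y = z"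
proof -
  have "(0::'a) < 1 + 1" by (simp add: v0_less_Suc)
  then show ?thesis
    using mult_strict_left_mono[of y z "1 + 1"] mult_strict_left_mono[of z y "1 + 1"] assms
    by (metis less_irrefl linorder_neqE)
qed

text \<open>Codes are ordered by diagonals: on the diagonal with sum \<open>d\<close> they stay
  below \<open>(d + 1) * (d + 2)\<close>, where the next one begins. On a single diagonal they
  differ by twice the second coordinate.\<close>

lemma pr_inject:
  fixes x y x' y' :: "'a::v0_model"
  assumes "pr x y = pr x' y'"
  shows "x = x' \<and> y = y'"
proof -
  have less: "pr x y < pr x' y'" if "x + y < x' + y'" for x y x' y' :: 'a
  proof -
    have "y \<le> x + y" using B8[of y x] by (simp add: add.commute)
    then have "(1 + 1) * y \<le> (1 + 1) * (x + y)" by (intro mult_left_mono) (auto simp: B9)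
    also have "\<dots> < (1 + 1) * (x + y) + 1 + 1"
      using less_add_one[of "(1 + 1) * (x + y)"] less_add_one[of "(1 + 1) * (x + y) + 1"] by (rule less_trans)
    finally have "pr x y < (x + y) * (x + y + 1) + ((1 + 1) * (x + y) + 1 + 1)"
      unfolding pr_def by (rule add_strict_left_mono)
    also have "\<dots> = (x + y + 1) * (x + y + 1 + 1)" by (simp add: algebra_simps mult_2 mult_2_right)
    also have "\<dots> \<le> (x' + y') * (x' + y' + 1)"
      using that by (intro mult_mono add_right_mono) (auto simp: v0_Suc_le B9)
    also have "\<dots> \<le> pr x' y'" unfolding pr_def by (rule B8)
    finally show ?thesis .
  qed
  have sum: "x + y = x' + y'"
    using less[of x y x' y'] less[of x' y' x y] assms by (metis less_irrefl linorder_neqE)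
  then have "(1 + 1) * y = (1 + 1) * y'" using assms by (simp add: pr_def)
  then have "y = y'" by (rule double_inject)
  then show ?thesis using sum by simp
qed

definition sel :: "'a::v0_model set \<Rightarrow> 'a \<Rightarrow> 'a \<Rightarrow> bool" where
  "sel Z i v \<longleftrightarrow> (v < len Z \<and> pr i v \<in> Z \<and> (\<forall>x. x < v \<longrightarrow> pr i x \<notin> Z))
     \<or> ((\<forall>x. x < len Z \<longrightarrow> pr i x \<notin> Z) \<and> v = len Z)"

lemma sel_unique: "sel Z i v \<Longrightarrow> sel Z i w \<Longrightarrow> v = w"
  unfolding sel_def by (metis linorder_neqE)

lemma definable_sel:
  assumes "Z \<in> Sets" "fdef i" "fdef v"
  shows "definable (\<lambda>e. sel Z (i e) (v e))"
proof (rule definable_rel[OF _ assms(2,3)])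
  show "definable (\<lambda>e. sel Z (e 0) (e 1))"
    unfolding sel_def pr_def
    by (intro definable_intros definable_mem[OF assms(1)] polynomial_plus polynomial_times
        polynomial_var polynomial_const)
qed

text \<open>This predicate and those up to \<open>cycle\<close> have the logical shape of the
  formulas they interpret, so that satisfaction reduces to unfolding.\<close>

definition edge :: "'a::v0_model set \<Rightarrow> 'a \<Rightarrow> 'a \<Rightarrow> 'a \<Rightarrow> 'a \<Rightarrow> 'a \<Rightarrow> bool" where
  "edge E i a b c d \<longleftrightarrow> sel E i (pr (pr a b) (pr c d)) \<or> sel E i (pr (pr c d) (pr a b))"

lemma edge_sym: "edge E i a b c d \<longleftrightarrow> edge E i c d a b"
  by (auto simp: edge_def)

text \<open>\<open>sel\<close> is functional and pairing is injective, so a position carries a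
  single edge in one of its two orientations.\<close>

lemma edge_unique:
  assumes "edge E i a b c d" "edge E i a' b' c' d'"
  shows "a = a' \<and> b = b' \<or> a = c' \<and> b = d'"
  using assms unfolding edge_def by (metis pr_inject sel_unique)

definition some_edge :: "'a::v0_model set \<Rightarrow> 'a \<Rightarrow> 'a \<Rightarrow> 'a \<Rightarrow> 'a \<Rightarrow> 'a \<Rightarrow> bool" where
  "some_edge E t a b c d \<longleftrightarrow> (\<exists>i. i < t \<and> edge E i a b c d)"

definition link :: "'a::v0_model \<Rightarrow> 'a set \<Rightarrow> 'a set \<Rightarrow> 'a \<Rightarrow> 'a \<Rightarrow> bool" where
  "link n E Q i j \<longleftrightarrow> (\<exists>a b. (a \<le> n \<and> b \<le> n) \<and> (\<exists>c d. (c \<le> n \<and> d \<le> n)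
     \<and> sel Q i (pr a b) \<and> sel Q j (pr c d) \<and> adj a b c d \<and> edge E i a b c d))"

definition touches :: "'a::v0_model \<Rightarrow> 'a set \<Rightarrow> 'a \<Rightarrow> 'a \<Rightarrow> 'a \<Rightarrow> bool" where
  "touches n E t a b \<longleftrightarrow> (\<exists>c d. (c \<le> n \<and> d \<le> n) \<and> some_edge E t a b c d)"

definition dist :: "'a::v0_model set \<Rightarrow> 'a \<Rightarrow> bool" where
  "dist Q m \<longleftrightarrow> (\<forall>i. i < m \<longrightarrow> (\<forall>j. j < m \<longrightarrow> (\<forall>v. sel Q i v \<and> sel Q j v \<longrightarrow> i = j)))"

definition path :: "'a::v0_model \<Rightarrow> 'a set \<Rightarrow> 'a \<Rightarrow> 'a \<Rightarrow> 'a \<Rightarrow> 'a \<Rightarrow> 'a \<Rightarrow> bool" where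
  "path n E s a b c d \<longleftrightarrow> 1 \<le> s \<and> (\<exists>Q\<in>Sets. sel Q 0 (pr a b) \<and> sel Q s (pr c d) \<and> dist Q (s + 1)
     \<and> (\<forall>i. i < s \<longrightarrow> link n E Q i (i + 1)))"

definition cycle :: "'a::v0_model \<Rightarrow> 'a set \<Rightarrow> 'a \<Rightarrow> bool" where
  "cycle n E t \<longleftrightarrow> 1 + 1 + 1 + 1 \<le> t \<and> (\<exists>Q\<in>Sets. dist Q t
     \<and> (\<forall>i. i < t \<longrightarrow> (i + 1 < t \<longrightarrow> link n E Q i (i + 1)) \<and> (i + 1 = t \<longrightarrow> link n E Q i 0)))"

section \<open>Satisfaction of the formulas for points, edges and curves\<close>

lemma tval_pairing [simp]: "tval e S \<^bold>\<langle>s, t\<^bold>\<rangle> = pr (tval e S s) (tval e S t)"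
  by (simp add: pairing_def pr_def)

lemma tval_code [simp]: "tval e S (code p) = pr (tval e S (fst p)) (tval e S (snd p))"
  by (simp add: code_def)

lemma fst_snd_lift [simp]: "fst \<up>\<^sub>pp = \<up>(fst p)" "snd \<up>\<^sub>pp = \<up>(snd p)"
  "fst \<Up>\<^sub>pp = \<Up>(fst p)" "snd \<Up>\<^sub>pp = \<Up>(snd p)"
  by (simp_all add: liftP_def liftPS_def)

lemma sat_elem [simp]: "sat e S (elem Z i v) \<longleftrightarrow> sel (S Z) (tval e S i) (tval e S v)"
  by (simp add: elem_def sel_def less_le)

lemma sat_eqP [simp]: "sat e S (eqP p q) \<longleftrightarrow> tval e S (fst p) = tval e S (fst q) \<and> tval e S (snd p) = tval e S (snd q)"
  by (simp add: eqP_def)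

lemma sat_grid [simp]: "sat e S (grid n p) \<longleftrightarrow> tval e S (fst p) \<le> tval e S n \<and> tval e S (snd p) \<le> tval e S n"
  by (simp add: grid_def)

lemma sat_AllP [simp]: "sat e S (AllP n \<phi>) \<longleftrightarrow>
    (\<forall>a b. a \<le> tval e S n \<and> b \<le> tval e S n \<longrightarrow> sat (case_nat b (case_nat a e)) S \<phi>)"
  by (simp add: AllP_def)

lemma sat_ExP [simp]: "sat e S (ExP n \<phi>) \<longleftrightarrow>
    (\<exists>a b. (a \<le> tval e S n \<and> b \<le> tval e S n) \<and> sat (case_nat b (case_nat a e)) S \<phi>)"
  by (simp add: ExP_def)

lemma sat_adjacent [simp]: "sat e S (adjacent p q) \<longleftrightarrow>
    adj (tval e S (fst p)) (tval e S (snd p)) (tval e S (fst q)) (tval e S (snd q))"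
  by (simp add: adjacent_def adj_def)

lemma sat_edge_at [simp]: "sat e S (edge_at E i p q) \<longleftrightarrow> edge (S E) (tval e S i)
    (tval e S (fst p)) (tval e S (snd p)) (tval e S (fst q)) (tval e S (snd q))"
  by (simp add: edge_at_def edge_def)

lemma sat_has_edge [simp]: "sat e S (has_edge E t p q) \<longleftrightarrow> some_edge (S E) (tval e S t)
    (tval e S (fst p)) (tval e S (snd p)) (tval e S (fst q)) (tval e S (snd q))"
  by (simp add: has_edge_def some_edge_def less_le)

lemma sat_joins [simp]: "sat e S (joins n E Q i j) \<longleftrightarrow>
    link (tval e S n) (S E) (S Q) (tval e S i) (tval e S j)"
  by (simp add: joins_def link_def Let_def)

lemma sat_distinct_upto [simp]: "sat e S (distinct_upto Q m) \<longleftrightarrow> dist (S Q) (tval e S m)"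
  by (simp add: distinct_upto_def dist_def less_le)

lemma sat_closed_curve [simp]: "sat e S (closed_curve n E t) \<longleftrightarrow> cycle (tval e S n) (S E) (tval e S t)"
  by (simp add: closed_curve_def cycle_def Let_def less_le)

lemma sat_connects [simp]: "sat e S (connects n E s p q) \<longleftrightarrow> path (tval e S n) (S E) (tval e S s)
    (tval e S (fst p)) (tval e S (snd p)) (tval e S (fst q)) (tval e S (snd q))"
  by (simp add: connects_def path_def Let_def less_le)

lemma sat_degree_pos [simp]: "sat e S (degree_pos n E t p) \<longleftrightarrow>
    touches (tval e S n) (S E) (tval e S t) (tval e S (fst p)) (tval e S (snd p))"
  by (simp add: degree_pos_def touches_def)

text \<open>Either of the two neighbours supplies an incident edge, which places the point on the
  curve.\<close>

lemma sat_degree_2: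
  "sat e S (degree_2 n E t p) \<Longrightarrow>
    touches (tval e S n) (S E) (tval e S t) (tval e S (fst p)) (tval e S (snd p))"
  by (auto simp: degree_2_def touches_def)

lemma sat_intersect [simp]: "sat e S (intersect n E t F s) \<longleftrightarrow>
    (\<exists>a b. (a \<le> tval e S n \<and> b \<le> tval e S n) \<and> touches (tval e S n) (S E) (tval e S t) a b
      \<and> touches (tval e S n) (S F) (tval e S s) a b)"
  by (simp add: intersect_def)

text \<open>The coordinates are obtained by choice, but \<open>sel\<close> and the injectivity of
  pairing determine them, so their graphs are definable. Beyond \<open>L\<close> they are set to 0
  to remain bounded and total.\<close>

lemma coordinate_functions:
  fixes n :: "'a::v0_model"
  assumes Q: "Q \<in> Sets" and pts: "\<And>i. i < L \<Longrightarrow> \<exists>a b. a \<le> n \<and> b \<le> n \<and> sel Q i (pr a b)"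
  obtains fx fy where "dfun fx" "dfun fy"
    "\<And>i. i < L \<Longrightarrow> fx i \<le> n \<and> fy i \<le> n \<and> sel Q i (pr (fx i) (fy i))"
proof -
  obtain gx gy where g: "\<And>i. i < L \<Longrightarrow> gx i \<le> n \<and> gy i \<le> n \<and> sel Q i (pr (gx i) (gy i))"
    using pts by metis
  have uniq: "a = gx i \<and> b = gy i" if "i < L" "sel Q i (pr a b)" for i a b
    using pr_inject[OF sel_unique[OF that(2), of "pr (gx i) (gy i)"]] g[OF that(1)] by simp
  define fx fy where "fx i = (if i < L then gx i else 0)" and "fy i = (if i < L then gy i else 0)" for i
  have pr: "fdef (\<lambda>e. pr (e i) (e j))" for i j :: nat
    unfolding pr_def by (intro fdef_poly polynomial_plus polynomial_times polynomial_var polynomial_const)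
  have "x = fx i \<longleftrightarrow> (i < L \<and> (\<exists>b. b \<le> n \<and> sel Q i (pr x b))) \<or> (\<not> i < L \<and> x = 0)" for i x
    using g[of i] uniq[of i] by (auto simp: fx_def)
  then have "definable (\<lambda>e. e 0 = fx (e 1))"
    by (simp only:) (intro definable_intros definable_sel Q pr)
  moreover have "x = fy i \<longleftrightarrow> (i < L \<and> (\<exists>a. a \<le> n \<and> sel Q i (pr a x))) \<or> (\<not> i < L \<and> x = 0)" for i x
    using g[of i] uniq[of i] by (auto simp: fy_def)
  then have "definable (\<lambda>e. e 0 = fy (e 1))"
    by (simp only:) (intro definable_intros definable_sel Q pr)
  moreover have "fx i \<le> n" "fy i \<le> n" for i using g[of i] B9 by (auto simp: fx_def fy_def)
  ultimately have "dfun fx" "dfun fy" by (auto simp: dfun_def)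
  then show ?thesis using that[of fx fy] g by (simp add: fx_def fy_def)
qed

lemma linkD:
  assumes "link n E Q i j" "sel Q i (pr a b)" "sel Q j (pr c d)"
  shows "a \<le> n" "b \<le> n" "c \<le> n" "d \<le> n" "adj a b c d" "edge E i a b c d"
proof -
  obtain a' b' c' d' where *: "a' \<le> n" "b' \<le> n" "c' \<le> n" "d' \<le> n" "sel Q i (pr a' b')"
    "sel Q j (pr c' d')" "adj a' b' c' d'" "edge E i a' b' c' d'"
    using assms(1) by (auto simp: link_def)
  have "a' = a \<and> b' = b" "c' = c \<and> d' = d"
    by (rule pr_inject[OF sel_unique[OF *(5) assms(2)]], rule pr_inject[OF sel_unique[OF *(6) assms(3)]])
  with * show "a \<le> n" "b \<le> n" "c \<le> n" "d \<le> n" "adj a b c d" "edge E i a b c d" by simp_all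
qed

lemma path_functions:
  fixes n :: "'a::v0_model"
  assumes "path n E s a b c d"
  obtains fx fy where "dfun fx" "dfun fy" "\<And>i. i < s \<Longrightarrow> adj (fx i) (fy i) (fx (i + 1)) (fy (i + 1))"
    "\<And>i. i \<le> s \<Longrightarrow> fx i \<le> n \<and> fy i \<le> n" "fx 0 = a" "fy 0 = b" "fx s = c" "fy s = d"
    "\<And>i. i \<le> s \<Longrightarrow> touches n E s (fx i) (fy i)"
proof -
  obtain Q where Q: "Q \<in> Sets" "sel Q 0 (pr a b)" "sel Q s (pr c d)" "1 \<le> s"
    and link: "\<And>i. i < s \<Longrightarrow> link n E Q i (i + 1)"
    using assms by (auto simp: path_def)
  \<comment> \<open>No link starts at the last point; its bounds and its incident edge come from the
    step \<open>s'\<close> that leads to it.\<close>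
  have "0 < s" using Q(4) v0_Suc_le[of 0 s] by simp
  then obtain s' where s': "s' + 1 = s" using v0_pred by blast
  then have "s' < s" using less_add_one[of s'] by simp
  have pts: "\<exists>a b. a \<le> n \<and> b \<le> n \<and> sel Q i (pr a b)" if "i < s + 1" for i
  proof (cases "i < s")
    case True
    then show ?thesis using link[OF True] by (auto simp: link_def)
  next
    case False
    then have "i = s' + 1" using that v0_less_Suc[of i s] s' by simp
    then show ?thesis using link[OF \<open>s' < s\<close>] by (auto simp: link_def)
  qed
  obtain fx fy where f: "dfun fx" "dfun fy"
    "\<And>i. i < s + 1 \<Longrightarrow> fx i \<le> n \<and> fy i \<le> n \<and> sel Q i (pr (fx i) (fy i))"
    using coordinate_functions[OF Q(1) pts] by blast
  have sel: "fx i \<le> n" "fy i \<le> n" "sel Q i (pr (fx i) (fy i))" if "i \<le> s" for i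
    using f(3)[of i] that v0_less_Suc[of i s] by simp_all
  have step: "adj (fx i) (fy i) (fx (i + 1)) (fy (i + 1))" "edge E i (fx i) (fy i) (fx (i + 1)) (fy (i + 1))"
    if "i < s" for i
    using linkD(5,6)[OF link[OF that] sel(3) sel(3)] that v0_Suc_le[of i s] by simp_all
  have "touches n E s (fx i) (fy i)" if "i \<le> s" for i
  proof (cases "i < s")
    case True
    then have "i + 1 \<le> s" using v0_Suc_le[of i s] by simp
    then show ?thesis using step(2)[OF True] sel[of "i + 1"] True unfolding touches_def some_edge_def by blast
  next
    case False
    then have "i = s' + 1" using that s' by simp
    then have "edge E s' (fx i) (fy i) (fx s') (fy s')" using step(2)[OF \<open>s' < s\<close>] edge_sym by metis
    then show ?thesis using sel[of s'] \<open>s' < s\<close> unfolding touches_def some_edge_def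
      by (metis less_imp_le)
  qed
  moreover have "fx 0 = a \<and> fy 0 = b" "fx s = c \<and> fy s = d"
    using pr_inject[OF sel_unique[OF sel(3)[of 0] Q(2)]] pr_inject[OF sel_unique[OF sel(3)[of s] Q(3)]] B9[of s]
    by simp_all
  ultimately show ?thesis using that[of fx fy] f(1,2) step(1) sel(1,2) by simp
qed

lemma cycle_functions:
  fixes n :: "'a::v0_model"
  assumes "cycle n E t"
  obtains fx fy where "dfun fx" "dfun fy" "1 + 1 < t"
    "\<And>i. i + 1 < t \<Longrightarrow> adj (fx i) (fy i) (fx (i + 1)) (fy (i + 1))"
    "\<And>i. i + 1 = t \<Longrightarrow> adj (fx i) (fy i) (fx 0) (fy 0)"
    "\<And>i j. i < t \<Longrightarrow> j < t \<Longrightarrow> fx i = fx j \<Longrightarrow> fy i = fy j \<Longrightarrow> i = j"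
    "\<And>i. i < t \<Longrightarrow> fx i \<le> n \<and> fy i \<le> n"
    "\<And>i. i < t \<Longrightarrow> touches n E t (fx i) (fy i)"
    "\<And>a b. touches n E t a b \<Longrightarrow> \<exists>i<t. fx i = a \<and> fy i = b"
proof -
  obtain Q where Q: "Q \<in> Sets" "dist Q t" "1 + 1 + 1 + 1 \<le> t"
    and link: "\<And>i. i < t \<Longrightarrow> i + 1 < t \<Longrightarrow> link n E Q i (i + 1)" "\<And>i. i < t \<Longrightarrow> i + 1 = t \<Longrightarrow> link n E Q i 0"
    using assms by (auto simp: cycle_def)
  have "(1 + 1::'a) < 1 + 1 + 1 + 1" by simp
  then have t: "1 + 1 < t" using Q(3) by (rule less_le_trans)
  \<comment> \<open>The cyclic successor unites the inner links with the closing one.\<close>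
  define nx where "nx i = (if i + 1 < t then i + 1 else 0)" for i
  have "0 < t" using t B9[of "1 + 1::'a"] by (rule le_less_trans[rotated])
  then have nx: "nx i < t" for i by (simp add: nx_def)
  have link: "link n E Q i (nx i)" if "i < t" for i
  proof (cases "i + 1 < t")
    case False
    then have "i + 1 = t" using that v0_Suc_le[of i t] by simp
    then show ?thesis using link(2) that by (simp add: nx_def)
  qed (use link(1) that in \<open>simp add: nx_def\<close>)
  have pts: "\<exists>a b. a \<le> n \<and> b \<le> n \<and> sel Q i (pr a b)" if "i < t" for i
    using link[OF that] by (auto simp: link_def)
  obtain fx fy where f: "dfun fx" "dfun fy"
    "\<And>i. i < t \<Longrightarrow> fx i \<le> n \<and> fy i \<le> n \<and> sel Q i (pr (fx i) (fy i))"
    using coordinate_functions[OF Q(1) pts] by blast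
  have step: "adj (fx i) (fy i) (fx (nx i)) (fy (nx i))" "edge E i (fx i) (fy i) (fx (nx i)) (fy (nx i))"
    if "i < t" for i
    using linkD(5,6)[OF link[OF that]] f(3)[OF that] f(3)[OF nx[of i]] by blast+
  show ?thesis
  proof (rule that[OF f(1,2) t])
    show "adj (fx i) (fy i) (fx (i + 1)) (fy (i + 1))" if "i + 1 < t" for i
      using step(1)[OF less_trans[OF less_add_one that]] that by (simp add: nx_def)
    show "adj (fx i) (fy i) (fx 0) (fy 0)" if "i + 1 = t" for i
      using step(1)[of i] that less_add_one[of i] by (simp add: nx_def)
    show "i = j" if "i < t" "j < t" "fx i = fx j" "fy i = fy j" for i j
      using Q(2) f(3)[OF that(1)] f(3)[OF that(2)] that unfolding dist_def by metis
    show "fx i \<le> n \<and> fy i \<le> n" if "i < t" for i using f(3)[OF that] by simp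
    show "touches n E t (fx i) (fy i)" if "i < t" for i
      using step(2)[OF that] f(3)[OF nx[of i]] that unfolding touches_def some_edge_def by blast
    show "\<exists>i<t. fx i = a \<and> fy i = b" if ab: "touches n E t a b" for a b
    proof -
      obtain i c d where "i < t" "edge E i a b c d" using ab by (auto simp: touches_def some_edge_def)
      then show ?thesis using edge_unique[OF _ step(2)] nx by metis
    qed
  qed
qed

theorem sat_grid_crossing_principle: "sat (e :: nat \<Rightarrow> 'a::v0_model) S grid_crossing_principle"
proof -
  have "\<exists>a b. (a \<le> n \<and> b \<le> n) \<and> touches n B t a b \<and> touches n R s a b"
    if B: "path n B t 0 n n 0" and R: "path n R s 0 0 n n" for B R and n t s :: 'a
  proof -
    obtain bx by' where b: "dfun bx" "dfun by'" "\<And>i. i < t \<Longrightarrow> adj (bx i) (by' i) (bx (i + 1)) (by' (i + 1))"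
      "\<And>i. i \<le> t \<Longrightarrow> bx i \<le> n \<and> by' i \<le> n" "bx 0 = 0" "by' 0 = n" "bx t = n" "by' t = 0"
      "\<And>i. i \<le> t \<Longrightarrow> touches n B t (bx i) (by' i)"
      by (rule path_functions[OF B]) blast
    obtain rx ry where r: "dfun rx" "dfun ry" "\<And>i. i < s \<Longrightarrow> adj (rx i) (ry i) (rx (i + 1)) (ry (i + 1))"
      "\<And>i. i \<le> s \<Longrightarrow> rx i \<le> n \<and> ry i \<le> n" "rx 0 = 0" "ry 0 = 0" "rx s = n" "ry s = n"
      "\<And>i. i \<le> s \<Longrightarrow> touches n R s (rx i) (ry i)"
      by (rule path_functions[OF R]) blast
    obtain i k where "i \<le> t" "k \<le> s" "bx i = rx k" "by' i = ry k"
      by (rule paths_cross[OF b(1,2) r(1,2) b(3) r(3) b(4) r(4) b(5-8) r(5-8)]) blast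
    then show ?thesis using b(4,9)[of i] r(9)[of k] by auto
  qed
  then show ?thesis by (simp add: grid_crossing_principle_def Let_def)
qed

theorem sat_jordan_curve_principle: "sat (e :: nat \<Rightarrow> 'a::v0_model) S jordan_curve_principle"
proof -
  have main: "\<exists>a b. (a \<le> n \<and> b \<le> n) \<and> touches n B t a b \<and> touches n R s a b"
    if B: "cycle n B t" and sides: "y1 = y2 + (1 + 1) \<or> y2 = y1 + (1 + 1)"
      and mid: "(1 + 1) * y = y1 + y2" "touches n B t x y"
      and R: "path n R s x y1 x y2" for B R and n t s x y y1 y2 :: 'a
  proof -
    obtain bx by' where b: "dfun bx" "dfun by'" "1 + 1 < t"
      "\<And>i. i + 1 < t \<Longrightarrow> adj (bx i) (by' i) (bx (i + 1)) (by' (i + 1))"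
      "\<And>i. i + 1 = t \<Longrightarrow> adj (bx i) (by' i) (bx 0) (by' 0)"
      "\<And>i j. i < t \<Longrightarrow> j < t \<Longrightarrow> bx i = bx j \<Longrightarrow> by' i = by' j \<Longrightarrow> i = j"
      "\<And>i. i < t \<Longrightarrow> bx i \<le> n \<and> by' i \<le> n"
      "\<And>i. i < t \<Longrightarrow> touches n B t (bx i) (by' i)"
      "\<And>a b. touches n B t a b \<Longrightarrow> \<exists>i<t. bx i = a \<and> by' i = b"
      by (rule cycle_functions[OF B]) blast
    obtain rx ry where r: "dfun rx" "dfun ry" "\<And>i. i < s \<Longrightarrow> adj (rx i) (ry i) (rx (i + 1)) (ry (i + 1))"
      "\<And>i. i \<le> s \<Longrightarrow> rx i \<le> n \<and> ry i \<le> n" "rx 0 = x" "ry 0 = y1" "rx s = x" "ry s = y2"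
      "\<And>i. i \<le> s \<Longrightarrow> touches n R s (rx i) (ry i)"
      by (rule path_functions[OF R]) blast
    obtain e where e: "e < t" "bx e = x" "by' e = y" using b(9)[OF mid(2)] by blast
    \<comment> \<open>With \<open>z\<close> the lower of the two heights, their sum is
      \<open>z + (z + 2)\<close>, and halving it gives the height in the middle.\<close>
    have half: "y = z + 1" if "(1 + 1) * y = z + (z + (1 + 1))" for z
    proof -
      have "(1 + 1) * (z + 1) = z + (z + (1 + 1))" by (simp add: distrib_left mult_2 add.assoc)
      then have "(1 + 1) * y = (1 + 1) * (z + 1)" using that by (rule trans[OF _ sym, rotated])
      then show ?thesis by (rule double_inject)
    qed
    have y: "y = ry 0 + 1 \<and> ry s = y + 1 \<or> y = ry s + 1 \<and> ry 0 = y + 1"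
      using sides
    proof
      assume *: "y1 = y2 + (1 + 1)"
      then have "y = y2 + 1" using mid(1) by (intro half) (simp add: ac_simps)
      then show ?thesis using * r(6,8) by (simp add: add.assoc)
    next
      assume *: "y2 = y1 + (1 + 1)"
      then have "y = y1 + 1" using mid(1) by (intro half) (simp add: ac_simps)
      then show ?thesis using * r(6,8) by (simp add: add.assoc)
    qed
    obtain i k where "i < t" "k \<le> s" "bx i = rx k" "by' i = ry k"
      by (rule closed_curve_meets_path[OF b(1,2) r(1,2) b(3-6) r(3,5,7) y e]) blast
    then show ?thesis using b(7,8)[of i] r(9)[of k] by auto
  qed
  \<comment> \<open>Simplification turns \<open>1 + 1\<close> into \<open>2\<close>; this
    restatement matches the unfolded principle.\<close>
  have main': "\<exists>a\<le>n. \<exists>b\<le>n. touches n B t a b \<and> touches n R s a b"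
    if "cycle n B t" "path n R s x y1 x y2" "touches n B t x y" "y1 = y2 + 2 \<or> y2 = y1 + 2"
      "2 * y = y1 + y2" for B R and n t s x y y1 y2 :: 'a
    using main[OF that(1) _ _ that(3,2)] that(4,5) by auto
  show ?thesis
    unfolding jordan_curve_principle_def Let_def different_sides_def
    by (auto dest!: sat_degree_2) (rule main', assumption, assumption, assumption, simp, simp)+
qed

section \<open>The standard model\<close>

instantiation nat :: v0_struct
begin
definition Sets_nat :: "nat set set" where "Sets_nat = {X. finite X}"
definition len_nat :: "nat set \<Rightarrow> nat" where "len_nat X = (if X = {} then 0 else Suc (Max X))"
instance ..
end

lemma nat_mem_less_len: "finite X \<Longrightarrow> y \<in> X \<Longrightarrow> y < len (X :: nat set)"
  by (auto simp: len_nat_def less_Suc_eq_le)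

lemma nat_last_mem: "finite X \<Longrightarrow> Suc y = len X \<Longrightarrow> y \<in> (X :: nat set)"
  using Max_in[of X] by (auto simp: len_nat_def split: if_splits)

lemma nat_len_le: "finite X \<Longrightarrow> (\<And>x. x \<in> X \<Longrightarrow> x < b) \<Longrightarrow> len (X :: nat set) \<le> b"
  by (auto simp: len_nat_def Suc_le_eq)

lemma sat_V0_nat:
  fixes e :: "nat \<Rightarrow> nat"
  assumes \<phi>: "\<phi> \<in> V0" and S: "\<And>X. finite (S X)"
  shows "sat e S \<phi>"
proof (cases "\<phi> \<in> two_BASIC")
  case True
  have "S 0 = S (Suc 0)"
    if "len (S 0) = len (S (Suc 0))" "\<forall>x. x \<le> len (S (Suc 0)) \<and> x \<noteq> len (S (Suc 0)) \<longrightarrow> (x \<in> S 0 \<longleftrightarrow> x \<in> S (Suc 0))"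
    using that nat_mem_less_len[OF S] by (metis less_le set_eqI)
  moreover have "e 0 \<noteq> 0 \<Longrightarrow> \<exists>x\<le>e 0. Suc x = e 0" by (cases "e 0") auto
  ultimately show ?thesis
    using True nat_mem_less_len[OF S, of "e 1" 0] nat_last_mem[OF S, of "e 1" 0]
    by (auto simp: two_BASIC_def Let_def)
next
  case False
  then obtain y \<psi> where \<psi>: "\<phi> = comprehension y \<psi>" using \<phi> by (auto simp: V0_def)
  let ?X = "{z. z < e y \<and> sat (case_nat z e) S \<psi>}"
  have "finite ?X" by simp
  moreover have "len ?X \<le> e y" by (rule nat_len_le) auto
  ultimately show ?thesis unfolding \<psi> comprehension_def sat_derived(6)
    by (intro bexI[of _ ?X]) (simp_all add: Sets_nat_def less_le)
qed

lemma case_nat_tval: "(\<lambda>i. tval e S (case_nat t NVar i)) = case_nat (tval e S t) e"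
  by (auto simp: fun_eq_iff split: nat.split)

lemma case_nat_set: "(\<lambda>Y. S (case_nat X id Y)) = case_nat (S X) S"
  by (auto simp: fun_eq_iff split: nat.split)

lemma sat_instN: "sat e S (instN t \<phi>) \<longleftrightarrow> sat (case_nat (tval e S t) e) S \<phi>"
  by (simp add: instN_def sat_sub case_nat_tval)

lemma sat_instS: "sat e S (instS X \<phi>) \<longleftrightarrow> sat e (case_nat (S X) S) \<phi>"
  by (simp add: instS_def sat_sub case_nat_set[unfolded id_def] id_def)

text \<open>The valuation names every number by a variable, and the binary coding
  \<open>set_decode\<close> names every finite set, so instances at terms exhaust both
  quantifiers.\<close>

lemma henkin_nat: "henkin V0 {\<phi>. sat (\<lambda>i. i) set_decode \<phi>}"
proof
  fix \<phi> \<psi> s t X Y \<sigma> \<rho>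
  have names: "Sets = range set_decode"
    by (auto simp: Sets_nat_def) (metis set_encode_inverse range_eqI)
  show "AllN \<phi> \<in> {\<phi>. sat (\<lambda>i. i) set_decode \<phi>} \<longleftrightarrow> (\<forall>t. instN t \<phi> \<in> {\<phi>. sat (\<lambda>i. i) set_decode \<phi>})"
    by (auto simp: sat_instN) (metis tval.simps(1))
  show "AllS \<phi> \<in> {\<phi>. sat (\<lambda>i. i) set_decode \<phi>} \<longleftrightarrow> (\<forall>X. instS X \<phi> \<in> {\<phi>. sat (\<lambda>i. i) set_decode \<phi>})"
    by (auto simp: sat_instS names)
  show "sub \<sigma> \<rho> \<phi> \<in> {\<phi>. sat (\<lambda>i. i) set_decode \<phi>}" if "\<phi> \<in> V0"
    using sat_V0_nat[OF that] by (simp add: sat_sub)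
qed (auto simp: sat_instN sat_instS)

section \<open>The countermodel\<close>

text \<open>If the theorem were not provable, \<open>H\<close> would be the complete theory of a countermodel.\<close>

definition equivalence :: fm where
  "equivalence = (jordan_curve_principle \<^bold>\<longleftrightarrow> grid_crossing_principle)"

definition H :: "fm set" where
  "H = (SOME H. henkin V0 H \<and> (equivalence \<in> H \<longrightarrow> V0 \<turnstile> equivalence))"

text \<open>If the equivalence is derivable, the theory of the standard model is a witness for the
  choice. Otherwise its negation is consistent, and a Henkin theory containing the negation omits
  the equivalence.\<close>

lemma H: "henkin V0 H" "equivalence \<in> H \<Longrightarrow> V0 \<turnstile> equivalence"
proof -
  have "\<exists>H. henkin V0 H \<and> (equivalence \<in> H \<longrightarrow> V0 \<turnstile> equivalence)"
  proof (cases "V0 \<turnstile> equivalence")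
    case True
    then show ?thesis using henkin_nat by blast
  next
    case False
    then have "consistent V0 [\<^bold>\<not> equivalence]"
      using derivable.Raa by (auto simp: consistent_def proves_def)
    then obtain H where "henkin V0 H" "(\<^bold>\<not> equivalence) \<in> H" using henkin_exists by fastforce
    then show ?thesis using henkin.Imp henkin.Falsum unfolding Neg_def by blast
  qed
  from someI_ex[OF this, folded H_def]
  show "henkin V0 H" "equivalence \<in> H \<Longrightarrow> V0 \<turnstile> equivalence" by blast+
qed

interpretation H: henkin V0 H
  by (rule H(1))

section \<open>The structure of terms modulo equality in \<open>H\<close>\<close>

lemma inst_lift [simp]: "tsub (case_nat t NVar) id (\<up>u) = u"
  by (simp add: liftN_def tsub_tsub comp_def)

lemma eq_subst: "(s \<^bold>= t) \<in> H \<Longrightarrow> instN s \<phi> \<in> H \<longleftrightarrow> instN t \<phi> \<in> H"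
proof -
  assume st: "(s \<^bold>= t) \<in> H"
  have "(t \<^bold>= s) \<in> H" using H.NSubst[OF st, of "NVar 0 \<^bold>= \<up>s"] by (simp add: instN_def H.NRefl)
  then show ?thesis using st H.NSubst by blast
qed

lemma eq_cong: "(s \<^bold>= t) \<in> H \<Longrightarrow> (tsub (case_nat s NVar) id u \<^bold>= tsub (case_nat t NVar) id u) \<in> H"
  using eq_subst[of s t "\<up>(tsub (case_nat s NVar) id u) \<^bold>= u"] by (simp add: instN_def H.NRefl)

definition eq_class :: "nterm \<Rightarrow> nterm set" where
  "eq_class t = {u. (t \<^bold>= u) \<in> H}"

lemma eq_class: "eq_class s = eq_class t \<longleftrightarrow> (s \<^bold>= t) \<in> H"
proof
  show "(s \<^bold>= t) \<in> H" if "eq_class s = eq_class t"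
    using that H.NRefl[of t] unfolding eq_class_def by blast
  show "eq_class s = eq_class t" if "(s \<^bold>= t) \<in> H"
    using eq_subst[OF that, of "NVar 0 \<^bold>= \<up>u" for u] by (auto simp: eq_class_def instN_def)
qed

typedef tnum = "range eq_class"
  by blast

definition val :: "nterm \<Rightarrow> tnum" where
  "val t = Abs_tnum (eq_class t)"

lemma val_eq: "val s = val t \<longleftrightarrow> (s \<^bold>= t) \<in> H"
  by (simp add: val_def Abs_tnum_inject[OF rangeI rangeI] eq_class)

lemma val_surj: "\<exists>t. x = val t"
  by (cases x) (auto simp: val_def)

definition name :: "tnum \<Rightarrow> nterm" where
  "name x = (SOME t. x = val t)"

lemma val_name [simp]: "val (name x) = x"
  unfolding name_def using someI_ex[OF val_surj[of x]] by simp

lemma name_eq: "(name (val t) \<^bold>= t) \<in> H"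
  by (simp flip: val_eq)

definition ext :: "nat \<Rightarrow> tnum set" where
  "ext X = {x. (name x \<^bold>\<in> X) \<in> H}"

instantiation tnum :: v0_struct
begin
definition zero_tnum :: tnum where "0 = val \<^bold>0"
definition one_tnum :: tnum where "1 = val \<^bold>1"
definition plus_tnum :: "tnum \<Rightarrow> tnum \<Rightarrow> tnum" where "x + y = val (name x \<^bold>+ name y)"
definition times_tnum :: "tnum \<Rightarrow> tnum \<Rightarrow> tnum" where "x * y = val (name x \<^bold>* name y)"
definition less_eq_tnum :: "tnum \<Rightarrow> tnum \<Rightarrow> bool" where "x \<le> y \<longleftrightarrow> (name x \<^bold>\<le> name y) \<in> H"
definition less_tnum :: "tnum \<Rightarrow> tnum \<Rightarrow> bool" where
  "(x::tnum) < y \<longleftrightarrow> x \<le> y \<and> x \<noteq> y"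
definition minus_tnum :: "tnum \<Rightarrow> tnum \<Rightarrow> tnum" where
  "(x::tnum) - y = (if y \<le> x then THE z. y + z = x else 0)"
definition Sets_tnum :: "tnum set set" where "Sets_tnum = range ext"
text \<open>The choice of a name for the set is harmless because names with equal extensions turn
  out to be equal in \<open>H\<close>.\<close>

definition len_tnum :: "tnum set \<Rightarrow> tnum" where "len_tnum A = val (Len (SOME X. ext X = A))"
instance ..
end

lemma val_plus: "val (s \<^bold>+ t) = val s + val t"
proof -
  have "val (s \<^bold>+ t) = val (name (val s) \<^bold>+ t)"
    using eq_cong[OF name_eq, of s "NVar 0 \<^bold>+ \<up>t"] by (simp add: val_eq[symmetric])
  also have "\<dots> = val (name (val s) \<^bold>+ name (val t))"
    using eq_cong[OF name_eq, of t "\<up>(name (val s)) \<^bold>+ NVar 0"] by (simp add: val_eq[symmetric])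
  finally show ?thesis by (simp add: plus_tnum_def)
qed

lemma val_times: "val (s \<^bold>* t) = val s * val t"
proof -
  have "val (s \<^bold>* t) = val (name (val s) \<^bold>* t)"
    using eq_cong[OF name_eq, of s "NVar 0 \<^bold>* \<up>t"] by (simp add: val_eq[symmetric])
  also have "\<dots> = val (name (val s) \<^bold>* name (val t))"
    using eq_cong[OF name_eq, of t "\<up>(name (val s)) \<^bold>* NVar 0"] by (simp add: val_eq[symmetric])
  finally show ?thesis by (simp add: times_tnum_def)
qed

lemma val_le: "(s \<^bold>\<le> t) \<in> H \<longleftrightarrow> val s \<le> val t"
  using eq_subst[OF name_eq, of s "NVar 0 \<^bold>\<le> \<up>t"]
    eq_subst[OF name_eq, of t "\<up>(name (val s)) \<^bold>\<le> NVar 0"]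
  by (simp add: instN_def less_eq_tnum_def)

lemma val_mem: "(t \<^bold>\<in> X) \<in> H \<longleftrightarrow> val t \<in> ext X"
  using eq_subst[OF name_eq, of t "NVar 0 \<^bold>\<in> X"] by (simp add: instN_def ext_def)

text \<open>\<open>holds\<close> is satisfaction in the structure of classes of terms.\<close>

definition holds :: "(nat \<Rightarrow> nterm) \<Rightarrow> (nat \<Rightarrow> nat) \<Rightarrow> fm \<Rightarrow> bool" where
  "holds \<sigma> \<rho> \<phi> \<longleftrightarrow> sub \<sigma> \<rho> \<phi> \<in> H"

lemma val_all: "(\<forall>t. P (val t)) \<longleftrightarrow> (\<forall>x. P x)"
  by (metis val_name)

lemma holds_simps:
  "\<not> holds \<sigma> \<rho> \<^bold>\<bottom>"
  "holds \<sigma> \<rho> (s \<^bold>= t) \<longleftrightarrow> val (tsub \<sigma> \<rho> s) = val (tsub \<sigma> \<rho> t)"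
  "holds \<sigma> \<rho> (s \<^bold>\<le> t) \<longleftrightarrow> val (tsub \<sigma> \<rho> s) \<le> val (tsub \<sigma> \<rho> t)"
  "holds \<sigma> \<rho> (t \<^bold>\<in> X) \<longleftrightarrow> val (tsub \<sigma> \<rho> t) \<in> ext (\<rho> X)"
  "holds \<sigma> \<rho> (\<phi> \<^bold>\<longrightarrow> \<psi>) \<longleftrightarrow> (holds \<sigma> \<rho> \<phi> \<longrightarrow> holds \<sigma> \<rho> \<psi>)"
  "holds \<sigma> \<rho> (AllN \<phi>) \<longleftrightarrow> (\<forall>t. holds (case_nat t \<sigma>) \<rho> \<phi>)"
  "holds \<sigma> \<rho> (AllS \<phi>) \<longleftrightarrow> (\<forall>X. holds \<sigma> (case_nat X \<rho>) \<phi>)"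
  by (simp_all add: holds_def H.Falsum H.Imp H.AllN H.AllS instN_sub instS_sub val_eq val_le val_mem)

lemma holds_derived:
  "holds \<sigma> \<rho> (\<^bold>\<not> \<phi>) \<longleftrightarrow> \<not> holds \<sigma> \<rho> \<phi>"
  "holds \<sigma> \<rho> (\<phi> \<^bold>\<and> \<psi>) \<longleftrightarrow> holds \<sigma> \<rho> \<phi> \<and> holds \<sigma> \<rho> \<psi>"
  "holds \<sigma> \<rho> (\<phi> \<^bold>\<or> \<psi>) \<longleftrightarrow> holds \<sigma> \<rho> \<phi> \<or> holds \<sigma> \<rho> \<psi>"
  "holds \<sigma> \<rho> (\<phi> \<^bold>\<longleftrightarrow> \<psi>) \<longleftrightarrow> (holds \<sigma> \<rho> \<phi> \<longleftrightarrow> holds \<sigma> \<rho> \<psi>)"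
  "holds \<sigma> \<rho> (ExN \<phi>) \<longleftrightarrow> (\<exists>t. holds (case_nat t \<sigma>) \<rho> \<phi>)"
  by (auto simp: Neg_def Conj_def Disj_def Iff_def ExN_def holds_simps)

lemma tsub_lift_case [simp]: "tsub (case_nat t \<sigma>) \<rho> (\<up>u) = tsub \<sigma> \<rho> u"
  by (simp add: liftN_def tsub_tsub comp_def)

lemma holds_BASIC: "\<phi> \<in> two_BASIC \<Longrightarrow> holds \<sigma> \<rho> \<phi>"
  unfolding holds_def by (rule H.axiom) (simp add: V0_def)

text \<open>The extensionality axiom also asks for equal lengths, so these have to be recovered from
  the members: a nonzero length is one more than some member, and every member is below the length.
  The structure is not yet known to be a model, hence the order axioms are read off from
  \<open>H\<close> directly.\<close>

lemma ext_eq: "ext X = ext Y \<longleftrightarrow> (X \<^bold>=\<^sub>s Y) \<in> H"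
proof
  assume "(X \<^bold>=\<^sub>s Y) \<in> H"
  moreover from this have "(Y \<^bold>=\<^sub>s X) \<in> H"
    using H.SSubst[of X Y "0 \<^bold>=\<^sub>s Suc X"] by (simp add: instS_def H.SRefl)
  ultimately have "(t \<^bold>\<in> X) \<in> H \<longleftrightarrow> (t \<^bold>\<in> Y) \<in> H" for t
    using H.SSubst[of X Y "\<Up>t \<^bold>\<in> 0"] H.SSubst[of Y X "\<Up>t \<^bold>\<in> 0"]
    by (auto simp: instS_def liftS_def tsub_tsub case_nat_comp)
  then show "ext X = ext Y" by (simp add: ext_def)
next
  assume XY: "ext X = ext Y"
  have basic: "holds (case_nat (name x) (\<lambda>_. name y)) (case_nat U (\<lambda>_. V)) \<phi>" if "\<phi> \<in> two_BASIC" for x y U V \<phi>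
    by (rule holds_BASIC[OF that])
  note simps = two_BASIC_def Let_def holds_simps holds_derived Lt_def AllLt_def ExLe_def val_plus
    zero_tnum_def[symmetric] one_tnum_def[symmetric]
  have B7: "x = y" if "x \<le> y" "y \<le> x" for x y :: tnum
    using basic[of "NVar 0 \<^bold>\<le> NVar 1 \<^bold>\<and> NVar 1 \<^bold>\<le> NVar 0 \<^bold>\<longrightarrow> NVar 0 \<^bold>= NVar 1" x y] that by (simp add: simps)
  have B9: "0 \<le> x" for x :: tnum
    using basic[of "\<^bold>0 \<^bold>\<le> NVar 0" x] by (simp add: simps)
  have B10: "x \<le> y \<or> y \<le> x" for x y :: tnum
    using basic[of "NVar 0 \<^bold>\<le> NVar 1 \<^bold>\<or> NVar 1 \<^bold>\<le> NVar 0" x y] by (simp add: simps)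
  have B11: "x \<le> y \<longleftrightarrow> x \<le> y + 1 \<and> x \<noteq> y + 1" for x y :: tnum
    using basic[of "NVar 0 \<^bold>\<le> NVar 1 \<^bold>\<longleftrightarrow> NVar 0 \<^bold>< NVar 1 \<^bold>+ \<^bold>1" x y] by (simp add: simps)
  have B12: "\<exists>y. y + 1 = x" if "x \<noteq> 0" for x :: tnum
    using basic[of "\<^bold>\<not> NVar 0 \<^bold>= \<^bold>0 \<^bold>\<longrightarrow> ExLe (NVar 0) (NVar 0 \<^bold>+ \<^bold>1 \<^bold>= \<up>(NVar 0))" x] that
    by (auto simp: simps)
  have L1: "y \<le> val (Len U) \<and> y \<noteq> val (Len U)" if "y \<in> ext U" for y U
    using basic[of "NVar 1 \<^bold>\<in> 0 \<^bold>\<longrightarrow> NVar 1 \<^bold>< Len 0" undefined y U] that by (simp add: simps)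
  have L2: "y \<in> ext U" if "y + 1 = val (Len U)" for y U
    using basic[of "NVar 1 \<^bold>+ \<^bold>1 \<^bold>= Len 0 \<^bold>\<longrightarrow> NVar 1 \<^bold>\<in> 0" undefined y U] that by (simp add: simps)
  \<comment> \<open>If the length of \<open>V\<close> were larger, it would be \<open>y + 1\<close>
    with \<open>y\<close> a common member. But then \<open>y\<close> is below the length of
    \<open>U\<close>, which by discreteness is at most \<open>y\<close>.\<close>
  have le: "val (Len V) \<le> val (Len U)" if eq: "ext U = ext V" for U V
  proof (rule ccontr)
    assume *: "\<not> ?thesis"
    then have ge: "val (Len U) \<le> val (Len V)" using B10 by blast
    have "val (Len V) \<noteq> 0" using * B9 by metis
    then obtain y where y: "y + 1 = val (Len V)" using B12 by blast
    then have "y \<in> ext U" using L2 eq by blast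
    then have "y \<le> val (Len U)" "y \<noteq> val (Len U)" using L1 by blast+
    moreover have "val (Len U) \<le> y" using ge * B11[of "val (Len U)" y] y by metis
    ultimately show False using B7 by blast
  qed
  have "val (Len X) = val (Len Y)" using le XY B7 by metis
  then show "(X \<^bold>=\<^sub>s Y) \<in> H"
    using holds_BASIC[of "Len 0 \<^bold>= Len 1 \<^bold>\<and> AllLt (Len 0) (NVar 0 \<^bold>\<in> 0 \<^bold>\<longleftrightarrow> NVar 0 \<^bold>\<in> 1) \<^bold>\<longrightarrow> 0 \<^bold>=\<^sub>s 1"
        NVar "case_nat X (\<lambda>_. Y)"] XY
    by (simp add: simps holds_def[of _ _ "_ \<^bold>=\<^sub>s _"])
qed

lemma len_ext: "len (ext X) = val (Len X)"
proof -
  let ?Y = "SOME Y. ext Y = ext X"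
  have "ext ?Y = ext X" by (rule someI) (rule refl)
  then have "(?Y \<^bold>=\<^sub>s X) \<in> H" by (simp add: ext_eq)
  from H.SSubst[OF this, of "\<Up>(Len ?Y) \<^bold>= Len 0"]
  have "(Len ?Y \<^bold>= Len X) \<in> H" by (simp add: instS_def liftS_def H.NRefl)
  then show ?thesis by (simp add: len_tnum_def val_eq)
qed

lemma tval_val: "tval (\<lambda>i. val (\<sigma> i)) (\<lambda>X. ext (\<rho> X)) t = val (tsub \<sigma> \<rho> t)"
  by (induction t) (simp_all add: val_plus val_times zero_tnum_def one_tnum_def len_ext)

lemma case_nat_val: "(\<lambda>i. val (case_nat t \<sigma> i)) = case_nat (val t) (\<lambda>i. val (\<sigma> i))"
  "(\<lambda>Y. ext (case_nat X \<rho> Y)) = case_nat (ext X) (\<lambda>Y. ext (\<rho> Y))"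
  by (auto simp: fun_eq_iff split: nat.split)

text \<open>Both quantifiers agree with their instances in \<open>H\<close> because every number is
  the value of a term and every set of the structure is the extension of a set variable.\<close>

lemma truth: "sat (\<lambda>i. val (\<sigma> i)) (\<lambda>X. ext (\<rho> X)) \<phi> \<longleftrightarrow> holds \<sigma> \<rho> \<phi>"
proof (induction \<phi> arbitrary: \<sigma> \<rho>)
  case (SEq X Y)
  show ?case by (simp add: holds_def ext_eq)
next
  case (AllN \<phi>)
  have "sat (\<lambda>i. val (\<sigma> i)) (\<lambda>X. ext (\<rho> X)) (AllN \<phi>) \<longleftrightarrow>
      (\<forall>t. sat (case_nat (val t) (\<lambda>i. val (\<sigma> i))) (\<lambda>X. ext (\<rho> X)) \<phi>)"
    unfolding sat.simps by (rule val_all[symmetric])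
  also have "\<dots> \<longleftrightarrow> (\<forall>t. holds (case_nat t \<sigma>) \<rho> \<phi>)" by (simp flip: AllN case_nat_val)
  finally show ?case by (simp add: holds_simps)
next
  case (AllS \<phi>)
  then show ?case by (simp add: holds_simps Sets_tnum_def flip: case_nat_val)
qed (simp_all add: holds_simps tval_val)

text \<open>An arbitrary valuation is realized by a substitution of names, and \<open>H\<close>
  contains all substitution instances of axioms.\<close>

lemma sat_V0_tnum:
  fixes e :: "nat \<Rightarrow> tnum"
  assumes "\<phi> \<in> V0" "\<And>X. S X \<in> Sets"
  shows "sat e S \<phi>"
proof -
  have "\<forall>X. \<exists>Y. S X = ext Y" using assms(2) by (auto simp: Sets_tnum_def)
  then obtain \<rho> where \<rho>: "\<And>X. S X = ext (\<rho> X)" by metis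
  have "sat (\<lambda>i. val (name (e i))) (\<lambda>X. ext (\<rho> X)) \<phi>"
    unfolding truth holds_def using assms(1) by (rule H.axiom)
  then show ?thesis by (simp flip: \<rho>)
qed

instance tnum :: v0_model
proof
  have sat: "sat (case_nat x (\<lambda>_. y)) (\<lambda>_. X) \<phi>" if "\<phi> \<in> two_BASIC" "X \<in> Sets" for x y :: tnum and X \<phi>
    by (rule sat_V0_tnum) (use that in \<open>auto simp: V0_def\<close>)
  have "ext 0 \<in> Sets" by (simp add: Sets_tnum_def)
  then have *: "\<forall>\<phi>\<in>two_BASIC. sat (case_nat x (\<lambda>_. y)) (\<lambda>_. ext 0) \<phi>" for x y :: tnum
    using sat by blast
  note basic = this[unfolded two_BASIC_def Let_def, simplified]
  fix x y z :: tnum and X :: "tnum set"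
  show "x + 1 \<noteq> 0" "x + 1 = y + 1 \<Longrightarrow> x = y" "x + 0 = x" "x + (y + 1) = x + y + 1" "x * 0 = 0"
    "x * (y + 1) = x * y + x" "x \<le> y \<Longrightarrow> y \<le> x \<Longrightarrow> x = y" "x \<le> x + y" "0 \<le> x" "x \<le> y \<or> y \<le> x"
    "x \<le> y \<longleftrightarrow> x \<le> y + 1 \<and> x \<noteq> y + 1" "x \<noteq> 0 \<Longrightarrow> \<exists>y. y \<le> x \<and> y + 1 = x"
    by (use basic[of x y] in \<open>elim conjE, (assumption | iprover)\<close>)+
  show "y \<le> len X \<and> y \<noteq> len X" if "X \<in> Sets" "y \<in> X"
    using sat[of "NVar 1 \<^bold>\<in> 0 \<^bold>\<longrightarrow> NVar 1 \<^bold>< Len 0" X x y] that by (simp add: two_BASIC_def Let_def)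
  show "y \<in> X" if "X \<in> Sets" "y + 1 = len X"
    using sat[of "NVar 1 \<^bold>+ \<^bold>1 \<^bold>= Len 0 \<^bold>\<longrightarrow> NVar 1 \<^bold>\<in> 0" X x y] that by (simp add: two_BASIC_def Let_def)
  show "(Sets :: tnum set set) \<noteq> {}" by (simp add: Sets_tnum_def)
  show "x < y \<longleftrightarrow> x \<le> y \<and> x \<noteq> y" by (rule less_tnum_def)
  show "x - y = (if y \<le> x then THE z. y + z = x else 0)" by (rule minus_tnum_def)
  fix \<phi> :: fm and S :: "nat \<Rightarrow> tnum set" and e :: "nat \<Rightarrow> tnum"
  assume \<phi>: "\<phi> \<in> SigmaB0" and S: "\<And>i. S i \<in> Sets"
  \<comment> \<open>Index 0 remains the comprehended element, while the parameters move up by one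
    place to free a variable for the bound \<open>y\<close>.\<close>
  let ?\<sigma> = "case_nat (NVar 0) (\<lambda>i. NVar (Suc (Suc i)))"
  have "comprehension 0 (sub ?\<sigma> (\<lambda>X. X) \<phi>) \<in> V0" using SigmaB0_sub[OF \<phi>] by (auto simp: V0_def)
  from sat_V0_tnum[OF this S]
  have "sat (case_nat y e) S (comprehension 0 (sub ?\<sigma> (\<lambda>X. X) \<phi>))" .
  moreover have "(\<lambda>i. tval (case_nat z (case_nat y e)) S (?\<sigma> i)) = case_nat z e" for z
    by (auto simp: fun_eq_iff split: nat.split)
  ultimately show "\<exists>X\<in>Sets. len X \<le> y \<and> (\<forall>z. z \<le> y \<and> z \<noteq> y \<longrightarrow> (z \<in> X \<longleftrightarrow> sat (case_nat z e) S \<phi>))"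
    by (simp add: comprehension_def sat_sub)
qed

theorem theorem5p2:
  shows "V0 \<turnstile> (jordan_curve_principle \<^bold>\<longleftrightarrow> grid_crossing_principle)"
proof -
  \<comment> \<open>Under the valuation that lets each variable name itself, truth in the structure
    is membership in \<open>H\<close>.\<close>
  have "sat (\<lambda>i. val (NVar i)) (\<lambda>X. ext X) equivalence"
    by (simp add: equivalence_def sat_jordan_curve_principle sat_grid_crossing_principle)
  then have "equivalence \<in> H" using truth[of NVar "\<lambda>X. X" equivalence] by (simp add: holds_def)
  then show ?thesis using H(2) by (simp add: equivalence_def)
qed

end
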